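(* Let $q$ be a prime power and $F\in\mathbf{F}_q[X_1,\ldots,X_n]^n$. (1) If $\mathcal{S}_q(F)$ is cofinite in $\mathbf{N}_{>0}$, then $\mathcal{S}_q(F)=\mathbf{N}_{>0}$. (2) If, in addition, $F$ is Keller, then the following are equivalent: (a) $F$ is a polynomial automorphism over $\mathbf{F}_q$; (b) $\mathcal{S}_q(F)=\mathbf{N}_{>0}$; (c) $\mathcal{S}_q(F)$ is cofinite in $\mathbf{N}_{>0}$. (In (2), the assumption on $F$ is only that $F$ is a Keller map; cofiniteness is condition (c), not a hypothesis.)
   Context: $\mathcal{S}_q(F)=\{m\in\mathbf{N}_{>0}: F\colon\mathbf{F}_{q^m}^n\to\mathbf{F}_{q^m}^n\text{ is bijective}\}$. $F$ is a Keller map if the determinant of its Jacobian matrix is a nonzero constant. $F$ is a polynomial automorphism over $\mathbf{F}_q$ if it has a two-sided compositional inverse that is a polynomial map over $\mathbf{F}_q$. *)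

theory Defs
  imports
    "HOL-Analysis.Determinants"
    "HOL-Library.Poly_Mapping"
    "HOL-Algebra.Algebraic_Closure_Type"
    "HOL-Number_Theory.Residues"
begin

section \<open>Polynomials in finitely many variables\<close>

text \<open>
  A polynomial with coefficients in \<open>'a\<close> and variables indexed by the finite type \<open>'n\<close>
  is a finitely supported map from exponent vectors to coefficients; the ring structure
  (convolution product) is the one of \<^theory>\<open>HOL-Library.Poly_Mapping\<close>.
\<close>

type_synonym ('a, 'n) mpoly = "('n \<Rightarrow>\<^sub>0 nat) \<Rightarrow>\<^sub>0 'a"

definition mconst :: "'a::zero \<Rightarrow> ('a, 'n) mpoly" where
  "mconst c = Poly_Mapping.single 0 c"

definition mvar :: "'n \<Rightarrow> ('a::{zero,one}, 'n) mpoly" where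
  "mvar i = Poly_Mapping.single (Poly_Mapping.single i 1) 1"

text \<open>
  Substitution of \<open>x\<close> for the variables, the coefficients being sent along \<open>\<phi>\<close>.
  It is used both for evaluation at points over an extension field and for the formal
  composition of polynomial maps.
\<close>

definition msubst ::
  "('a::zero \<Rightarrow> 'b::comm_semiring_1) \<Rightarrow> 'b ^ 'n \<Rightarrow> ('a, 'n::finite) mpoly \<Rightarrow> 'b" where
  "msubst \<phi> x p = (\<Sum>e\<in>Poly_Mapping.keys p.
     \<phi> (Poly_Mapping.lookup p e) * (\<Prod>i\<in>UNIV. (x $ i) ^ Poly_Mapping.lookup e i))"

text \<open>
  The exponent subtraction is truncated, but the terms with \<open>e i = 0\<close> have coefficient \<open>0\<close>.
\<close>

definition mpderiv :: "'n \<Rightarrow> ('a::comm_semiring_1, 'n) mpoly \<Rightarrow> ('a, 'n) mpoly" where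
  "mpderiv i p = (\<Sum>e\<in>Poly_Mapping.keys p.
     Poly_Mapping.single (e - Poly_Mapping.single i 1)
       (of_nat (Poly_Mapping.lookup e i) * Poly_Mapping.lookup p e))"


section \<open>Polynomial maps\<close>

type_synonym ('a, 'n) pmap = "('a, 'n) mpoly ^ 'n"

definition pmap_id :: "('a::{zero,one}, 'n::finite) pmap" where
  "pmap_id = (\<chi> i. mvar i)"

definition pmap_comp ::
  "('a::comm_semiring_1, 'n::finite) pmap \<Rightarrow> ('a, 'n) pmap \<Rightarrow> ('a, 'n) pmap" where
  "pmap_comp F G = (\<chi> i. msubst mconst G (F $ i))"

text \<open>
  The inverse is one of formal polynomial tuples: over a finite field, different tuples can
  induce the same self-map of the rational points.
\<close>

definition polynomial_automorphism :: "('a::comm_semiring_1, 'n::finite) pmap \<Rightarrow> bool" where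
  "polynomial_automorphism F \<longleftrightarrow>
     (\<exists>G. pmap_comp F G = pmap_id \<and> pmap_comp G F = pmap_id)"

definition jacobian :: "('a::comm_semiring_1, 'n::finite) pmap \<Rightarrow> ('a, 'n) mpoly ^ 'n ^ 'n" where
  "jacobian F = (\<chi> i j. mpderiv j (F $ i))"

definition keller :: "('a::comm_ring_1, 'n::finite) pmap \<Rightarrow> bool" where
  "keller F \<longleftrightarrow> (\<exists>c. c \<noteq> 0 \<and> det (jacobian F) = mconst c)"


section \<open>Points over finite extensions\<close>

text \<open>
  The finite field \<open>\<^bold>F\<^sub>q\<close> is an arbitrary type \<open>'a\<close> of class \<^class>\<open>finite_field\<close>, with
  \<open>q = CARD('a)\<close>. Its extension of degree \<open>m\<close> is realised inside the algebraic closure of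
  \<open>'a\<close>, as the set of roots of \<open>X^(q^m) - X\<close>; the lemmas below show that
  for \<open>m > 0\<close> this is a subfield with \<open>q^m\<close> elements that contains \<open>'a\<close>.
\<close>

definition ext_field :: "nat \<Rightarrow> 'a::finite_field alg_closure set" where
  "ext_field m = {x. x ^ (CARD('a) ^ m) = x}"

definition ext_points :: "nat \<Rightarrow> ('a::finite_field alg_closure ^ 'n) set" where
  "ext_points m = {x. \<forall>i. x $ i \<in> ext_field m}"

definition pmap_eval ::
  "('a::field, 'n::finite) pmap \<Rightarrow> 'a alg_closure ^ 'n \<Rightarrow> 'a alg_closure ^ 'n" where
  "pmap_eval F x = (\<chi> i. msubst to_ac x (F $ i))"

definition bijective_degrees :: "('a::finite_field, 'n::finite) pmap \<Rightarrow> nat set" where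
  "bijective_degrees F = {m. m > 0 \<and> bij_betw (pmap_eval F) (ext_points m) (ext_points m)}"

definition cofinite_pos :: "nat set \<Rightarrow> bool" where
  "cofinite_pos S \<longleftrightarrow> finite ({0<..} - S)"


section \<open>The extension fields\<close>

lemma of_nat_CARD_alg_closure: "of_nat CARD('a) = (0 :: 'a::finite_field alg_closure)"
  using CHAR_dvd_CARD[where 'a = 'a] by (simp add: of_nat_eq_0_iff_char_dvd)

lemma CARD_field_gt_1: "CARD('a::finite_field) > 1"
proof -
  have "card {0, 1 :: 'a} \<le> CARD('a)"
    by (rule card_mono) auto
  thus ?thesis by simp
qed

lemma to_ac_in_ext_field: "to_ac (c :: 'a::finite_field) \<in> ext_field m"
  by (simp add: ext_field_def finite_field_power_card_power_eq_same flip: to_ac_power)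

lemma mult_in_ext_field: "x \<in> ext_field m \<Longrightarrow> y \<in> ext_field m \<Longrightarrow> x * y \<in> ext_field m"
  by (simp add: ext_field_def power_mult_distrib)

lemma inverse_in_ext_field: "x \<in> ext_field m \<Longrightarrow> inverse x \<in> ext_field m"
  by (simp add: ext_field_def power_inverse)

lemma power_CARD_add_aux:
  fixes y :: "'a::finite_field alg_closure"
  assumes "\<And>c :: 'a. (to_ac c + y) ^ CARD('a) = to_ac c ^ CARD('a) + y ^ CARD('a)"
  shows "(x + y) ^ CARD('a) = x ^ CARD('a) + y ^ CARD('a)"
proof -
  define q where "q = CARD('a)"
  have q: "q > 1" using CARD_field_gt_1[where 'a='a] by (simp add: q_def)
  define g where "g = [:y, 1:] ^ q - monom 1 q - [:y ^ q:]"
  have deg1: "degree ([:y, 1:] ^ q) = q"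
    by (simp add: degree_power_eq)
  have "degree g \<le> q"
    unfolding g_def using q deg1
    by (intro degree_diff_le) (auto simp: degree_monom_eq)
  moreover have "coeff g q = 0"
  proof -
    have "coeff ([:y, 1:] ^ q) q = 1"
      using lead_coeff_power[of "[:y, 1:]" q] deg1 by simp
    moreover have "coeff [:y ^ q:] q = 0"
      using q by (intro coeff_eq_0) auto
    ultimately show ?thesis by (simp add: g_def)
  qed
  ultimately have *: "g = 0 \<or> degree g < q"
    by (metis eq_zero_or_degree_less)
  have root: "poly g (to_ac c) = 0" for c :: 'a
    using assms[of c] by (simp add: g_def poly_monom q_def add.commute)
  have "g = 0"
  proof (rule ccontr)
    assume "g \<noteq> 0"
    have "q = card (range (to_ac :: 'a \<Rightarrow> _))"
      by (simp add: q_def card_image inj_to_ac)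
    also have "\<dots> \<le> card {x. poly g x = 0}"
      using \<open>g \<noteq> 0\<close> root by (intro card_mono poly_roots_finite) auto
    also have "\<dots> \<le> degree g"
      using \<open>g \<noteq> 0\<close> by (rule card_poly_roots_bound)
    finally show False using * \<open>g \<noteq> 0\<close> by simp
  qed
  hence "poly g x = 0" by simp
  thus ?thesis by (simp add: g_def poly_monom q_def algebra_simps)
qed

lemma power_CARD_add:
  fixes x y :: "'a::finite_field alg_closure"
  shows "(x + y) ^ CARD('a) = x ^ CARD('a) + y ^ CARD('a)"
proof (rule power_CARD_add_aux)
  fix c :: 'a
  have "(y + to_ac c) ^ CARD('a) = y ^ CARD('a) + to_ac c ^ CARD('a)"
    by (rule power_CARD_add_aux)
       (simp add: finite_field_power_card_eq_same flip: to_ac_add to_ac_power)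
  thus "(to_ac c + y) ^ CARD('a) = to_ac c ^ CARD('a) + y ^ CARD('a)"
    by (simp add: add.commute)
qed

lemma add_in_ext_field:
  fixes x y :: "'a::finite_field alg_closure"
  assumes "x \<in> ext_field m" "y \<in> ext_field m"
  shows "x + y \<in> ext_field m"
proof -
  have "(x + y) ^ (CARD('a) ^ m) = x ^ (CARD('a) ^ m) + y ^ (CARD('a) ^ m)"
  proof (induction m)
    case (Suc m)
    have "(x + y) ^ (CARD('a) ^ Suc m) = ((x + y) ^ (CARD('a) ^ m)) ^ CARD('a)"
      by (simp add: power_mult mult.commute flip: power_mult)
    also have "\<dots> = x ^ (CARD('a) ^ Suc m) + y ^ (CARD('a) ^ Suc m)"
      by (simp add: Suc.IH power_CARD_add mult.commute flip: power_mult)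
    finally show ?case .
  qed simp
  thus ?thesis using assms by (simp add: ext_field_def)
qed

lemma uminus_in_ext_field: "x \<in> ext_field m \<Longrightarrow> - x \<in> ext_field m"
  using mult_in_ext_field[OF to_ac_in_ext_field[of "-1"]] by simp

lemma card_ext_field:
  assumes "m > 0"
  shows "card (ext_field m :: 'a::finite_field alg_closure set) = CARD('a) ^ m"
proof -
  define Q where "Q = CARD('a) ^ m"
  have Q: "Q > 1"
    unfolding Q_def using CARD_field_gt_1[where 'a='a] assms by (intro one_less_power)
  have Q0: "of_nat Q = (0 :: 'a alg_closure)"
    using assms of_nat_CARD_alg_closure[where 'a='a] by (simp add: Q_def power_0_left)
  define p where "p = monom 1 Q - monom (1 :: 'a alg_closure) 1"
  have deg: "degree p = Q"
    unfolding p_def diff_conv_add_uminus using Q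
    by (subst degree_add_eq_left) (auto simp: degree_monom_eq)
  have p0: "p \<noteq> 0" using deg Q by auto
  obtain A where A: "size A = degree p" "p = smult (lead_coeff p) (\<Prod>x\<in>#A. [:-x, 1:])"
    using alg_closed_imp_factorization[OF p0] by blast
  have dp: "poly (pderiv p) x = -1" for x
    using Q0 by (simp add: p_def pderiv_diff pderiv_monom poly_monom)
  have simple: "count A a \<le> 1" for a
  proof (rule ccontr)
    assume "\<not> count A a \<le> 1"
    hence "2 \<le> count A a" by simp
    hence "replicate_mset 2 a \<subseteq># A"
      by (simp only: count_le_replicate_mset_subset_eq)
    then obtain C where "A = replicate_mset 2 a + C"
      by (rule mset_subset_eq_exists_conv[THEN iffD1, THEN exE])
    hence "A = add_mset a (add_mset a C)"
      by (simp add: numeral_2_eq_2)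
    then obtain B where B: "A = add_mset a (add_mset a B)"
      by blast
    define r where "r = smult (lead_coeff p) (\<Prod>x\<in>#B. [:-x, 1:])"
    have "p = [:-a, 1:] * ([:-a, 1:] * r)"
      by (subst A(2)) (simp only: B r_def image_mset_add_mset prod_mset.add_mset mult_smult_right)
    hence "poly (pderiv p) a = 0"
      by (simp only: pderiv_mult poly_mult poly_add poly_pCons) simp
    thus False using dp[of a] by simp
  qed
  have roots: "{x. poly p x = 0} = set_mset A"
  proof -
    have "poly p x = lead_coeff p * (\<Prod>a\<in>#A. x - a)" for x
      by (subst A(2)) (simp add: poly_prod_mset image_mset.compositionality o_def)
    thus ?thesis
      using p0 by (auto simp: prod_mset_zero_iff)
  qed
  have "card (set_mset A) = size A"
  proof -
    have "A = mset_set (set_mset A)"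
    proof (rule multiset_eqI)
      fix a
      show "count A a = count (mset_set (set_mset A)) a"
        using simple[of a] by (cases "a \<in># A") (auto simp: le_Suc_eq count_eq_zero_iff)
    qed
    hence "size A = size (mset_set (set_mset A))" by (rule arg_cong)
    thus ?thesis by (simp only: size_mset_set)
  qed
  moreover have "ext_field m = {x. poly p x = 0}"
    by (auto simp: ext_field_def p_def poly_monom Q_def)
  ultimately show ?thesis using roots A(1) deg by (simp add: Q_def)
qed

end

theory Submission
  imports Defs "HOL-Library.Function_Algebras"
begin

text \<open>
  Injectivity on the points of degree \<open>m r\<close> implies injectivity on the finite set of points of
  degree \<open>m\<close>, which gives the first part. For the second part let \<open>k\<close> be the algebraic closure of the finite field.
  A Keller map \<open>F\<close> that is bijective in every degree is an etale bijection of \<open>k^n\<close>. Write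
  \<open>F x - F y = M(x,y) (x - y)\<close>. Where \<open>F x = F y\<close> we have \<open>x = y\<close>, so \<open>det M\<close> is a nonzero
  constant there; by the Nullstellensatz and Cramer's rule every \<open>x_i - y_i\<close> lies in the ideal
  of the \<open>F_j(x) - F_j(y)\<close>. Eliminating the functions of \<open>y\<close> in such a relation shows that
  \<open>a(F(y)) y_i = b(F(y))\<close> for polynomials \<open>a \<noteq> 0\<close> and \<open>b\<close>. Lifting lines through \<open>F\<close> to any
  finite order (Hensel) shows that \<open>a\<close> divides \<open>b\<close> on every line on which \<open>a\<close> does not vanish, and
  division with remainder in a direction in which \<open>a\<close> is monic gives \<open>b = a g\<close> with \<open>g\<close> polynomial.
  Hence \<open>y_i = g(F(y))\<close>, and \<open>g\<close> commutes with Frobenius, so its coefficients lie in the finite field.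
\<close>

section \<open>Homomorphisms defined on subrings\<close>

text \<open>Bijectivity alone cannot give a polynomial inverse in characteristic p: raising every
  coordinate to the power q is bijective in every degree. The Keller condition excludes such
  inseparable maps and enters at two places, in the invertibility of M on the diagonal and in the
  solvability of every lifting step. Lines are used because there the absence of poles of b / a is a
  comparison of multiplicities of polynomials in one variable; lifting to the multiplicity of a zero
  of a is enough, which is why a finite order suffices. Polynomials in several variables are handled
  as functions: k is infinite, so values determine the polynomial, and evaluation is application.
  The rings are therefore subsets of a ring of functions, and subrings, ideals and homomorphisms are
  taken relative to a carrier set. The Nullstellensatz adjoins one generator after the other, so the
  coefficient ring changes during the induction while its type does not.\<close>

definition unital_subring :: "'r::comm_ring_1 set \<Rightarrow> bool" where
  "unital_subring A \<longleftrightarrow> 1 \<in> A \<and> (\<forall>x\<in>A. \<forall>y\<in>A. x - y \<in> A \<and> x * y \<in> A)"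

lemma unital_subringD:
  assumes "unital_subring A"
  shows "0 \<in> A" "1 \<in> A" "x \<in> A \<Longrightarrow> y \<in> A \<Longrightarrow> x + y \<in> A" "x \<in> A \<Longrightarrow> y \<in> A \<Longrightarrow> x - y \<in> A"
    "x \<in> A \<Longrightarrow> y \<in> A \<Longrightarrow> x * y \<in> A" "x \<in> A \<Longrightarrow> - x \<in> A" "x \<in> A \<Longrightarrow> x ^ n \<in> A"
    "(\<And>i. i \<in> I \<Longrightarrow> f i \<in> A) \<Longrightarrow> sum f I \<in> A"
    "(\<And>i. i \<in> I \<Longrightarrow> f i \<in> A) \<Longrightarrow> prod f I \<in> A"
proof -
  show zero: "0 \<in> A" and one: "1 \<in> A"
    using assms unfolding unital_subring_def by (metis diff_self)+
  show minus: "- x \<in> A" if "x \<in> A" for x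
    using assms zero that unfolding unital_subring_def by (metis diff_0)
  show add: "x + y \<in> A" if "x \<in> A" "y \<in> A" for x y
    using assms minus that unfolding unital_subring_def by (metis diff_minus_eq_add)
  show "x - y \<in> A" if "x \<in> A" "y \<in> A" for x y
    using assms that unfolding unital_subring_def by blast
  show mult: "x * y \<in> A" if "x \<in> A" "y \<in> A" for x y
    using assms that unfolding unital_subring_def by blast
  show "x ^ n \<in> A" if "x \<in> A"
    by (induction n) (use one mult that in auto)
  show "sum f I \<in> A" if "\<And>i. i \<in> I \<Longrightarrow> f i \<in> A"
    using that by (induction I rule: infinite_finite_induct) (use zero add in auto)
  show "prod f I \<in> A" if "\<And>i. i \<in> I \<Longrightarrow> f i \<in> A"
    using that by (induction I rule: infinite_finite_induct) (use one mult in auto)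
qed

lemma unital_subring_UNIV: "unital_subring UNIV"
  by (simp add: unital_subring_def)

text \<open>Restricting the coefficients to a subset lets the coefficient ring grow by one generator
  at a time inside a fixed type of polynomials.\<close>

definition polys_over :: "'r::comm_ring_1 set \<Rightarrow> 'r poly set" where
  "polys_over A = {p. \<forall>i. coeff p i \<in> A}"

lemma polys_overD: "p \<in> polys_over A \<Longrightarrow> coeff p i \<in> A"
  by (simp add: polys_over_def)

lemma unital_subring_polys_over:
  assumes "unital_subring A" shows "unital_subring (polys_over A)"
  unfolding unital_subring_def polys_over_def
  by (auto simp: coeff_mult of_bool_def intro!: unital_subringD(1-5,8)[OF assms])

lemma monom_in_polys_over: "unital_subring A \<Longrightarrow> c \<in> A \<Longrightarrow> monom c n \<in> polys_over A"
  by (simp add: polys_over_def unital_subringD)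

lemma const_in_polys_over: "unital_subring A \<Longrightarrow> c \<in> A \<Longrightarrow> [:c:] \<in> polys_over A"
  using monom_in_polys_over[of A c 0] by (simp add: monom_0)

lemma poly_in_subring:
  assumes "unital_subring S" "A \<subseteq> S" "t \<in> S" "p \<in> polys_over A"
  shows "poly p t \<in> S"
  unfolding poly_altdef using assms
  by (intro unital_subringD[OF assms(1)]) (auto simp: polys_over_def)

text \<open>Values off \<open>A\<close> are unconstrained, so extending a homomorphism means finding
  another function of the same type that agrees with it on \<open>A\<close>.\<close>

definition hom_on :: "'r::comm_ring_1 set \<Rightarrow> ('r \<Rightarrow> 's::comm_ring_1) \<Rightarrow> bool" where
  "hom_on A \<phi> \<longleftrightarrow> \<phi> 1 = 1 \<and> (\<forall>x\<in>A. \<forall>y\<in>A. \<phi> (x + y) = \<phi> x + \<phi> y \<and> \<phi> (x * y) = \<phi> x * \<phi> y)"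

lemma hom_on_0:
  assumes "unital_subring A" "hom_on A \<phi>" shows "\<phi> 0 = 0"
proof -
  have "\<phi> (0 + 0) = \<phi> 0 + \<phi> 0"
    using assms unital_subringD(1)[OF assms(1)] unfolding hom_on_def by blast
  thus ?thesis by simp
qed

lemma hom_on_sum:
  assumes "unital_subring A" "hom_on A \<phi>" "\<And>i. i \<in> I \<Longrightarrow> f i \<in> A"
  shows "\<phi> (sum f I) = (\<Sum>i\<in>I. \<phi> (f i))"
  using assms(3)
proof (induction I rule: infinite_finite_induct)
  case (insert x I)
  have "f x \<in> A" "sum f I \<in> A"
    using insert.prems by (auto intro: unital_subringD(8)[OF assms(1)])
  thus ?case using insert assms(2) by (simp add: hom_on_def)
qed (use hom_on_0[OF assms(1,2)] in auto)

lemma hom_on_map_poly: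
  assumes A: "unital_subring A" and \<phi>: "hom_on A \<phi>"
  shows "hom_on (polys_over A) (map_poly \<phi>)"
proof -
  note 0 = hom_on_0[OF A \<phi>]
  have add: "map_poly \<phi> (p + q) = map_poly \<phi> p + map_poly \<phi> q"
    if "p \<in> polys_over A" "q \<in> polys_over A" for p q
    using that \<phi> 0 by (intro poly_eqI) (auto simp: coeff_map_poly polys_over_def hom_on_def)
  have mult: "map_poly \<phi> (p * q) = map_poly \<phi> p * map_poly \<phi> q"
    if "p \<in> polys_over A" "q \<in> polys_over A" for p q
  proof (rule poly_eqI)
    fix n
    have "\<phi> (\<Sum>i\<le>n. coeff p i * coeff q (n - i)) = (\<Sum>i\<le>n. \<phi> (coeff p i * coeff q (n - i)))"
      using that by (intro hom_on_sum[OF A \<phi>] unital_subringD(5)[OF A]) (auto simp: polys_over_def)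
    also have "\<dots> = (\<Sum>i\<le>n. \<phi> (coeff p i) * \<phi> (coeff q (n - i)))"
      using that \<phi> by (intro sum.cong) (auto simp: hom_on_def polys_over_def)
    finally show "coeff (map_poly \<phi> (p * q)) n = coeff (map_poly \<phi> p * map_poly \<phi> q) n"
      by (simp add: coeff_map_poly coeff_mult 0)
  qed
  have "map_poly \<phi> 1 = 1"
    using \<phi> 0 by (intro poly_eqI) (auto simp: coeff_map_poly hom_on_def of_bool_def)
  thus ?thesis using add mult by (simp add: hom_on_def)
qed

text \<open>Scaling \<open>g\<close> by the coefficient of \<open>f\<close> in degree
  \<open>d\<close>, instead of dividing by it, cancels the top term without leaving the ring. The
  bound on \<open>degree h\<close> later allows the quotient to be tested against a minimal
  degree.\<close>

lemma pseudo_division: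
  fixes f g :: "'r::comm_ring_1 poly"
  assumes A: "unital_subring A" and f: "f \<in> polys_over A" and g: "g \<in> polys_over A"
    and d: "degree f \<le> d" "d > 0"
  obtains r h q where "h \<in> polys_over A" "q \<in> polys_over A"
    "smult (coeff f d ^ r) g = h * f + q" "degree q < d" "degree h \<le> degree g - d"
proof -
  define c where "c = coeff f d"
  note P = unital_subringD[OF unital_subring_polys_over[OF A]]
  have "\<exists>r h q. h \<in> polys_over A \<and> q \<in> polys_over A \<and> smult (c ^ r) g = h * f + q \<and>
     degree q < d \<and> degree h \<le> degree g - d"
    using g
  proof (induction "degree g" arbitrary: g rule: less_induct)
    case (less g)
    show ?case
    proof (cases "degree g < d")
      case True
      show ?thesis
        using less.prems True P(1) by (intro exI[of _ 0] exI[of _ g]) auto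
    next
      case False
      define n where "n = degree g"
      define m where "m = monom (lead_coeff g) (n - d)"
      define g' where "g' = smult c g - m * f"
      have m: "m \<in> polys_over A"
        unfolding m_def using less.prems polys_overD by (intro monom_in_polys_over[OF A]) auto
      have cA: "c \<in> A" using f polys_overD by (auto simp: c_def)
      have g'A: "g' \<in> polys_over A"
        unfolding g'_def using P(5)[OF const_in_polys_over[OF A cA] less.prems] P(5)[OF m f] P(4)
        by auto
      have n: "n \<ge> d" "n > 0" using False d by (auto simp: n_def)
      have "degree g' \<le> n"
      proof -
        have "degree (m * f) \<le> (n - d) + d"
          using degree_mult_le[of m f] degree_monom_le[of "lead_coeff g" "n - d"] d(1)
          unfolding m_def[symmetric] by linarith
        thus ?thesis unfolding g'_def using n degree_smult_le[of c g]
          by (intro degree_diff_le) (auto simp: n_def)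
      qed
      moreover have "coeff g' n = 0"
        using n by (simp add: g'_def m_def coeff_monom_mult c_def n_def)
      ultimately have deg: "degree g' < degree g"
        using n(2) eq_zero_or_degree_less[of g' n] by (auto simp: n_def)
      from less.hyps[OF deg g'A] obtain r h q where
        *: "h \<in> polys_over A" "q \<in> polys_over A" "smult (c ^ r) g' = h * f + q" "degree q < d"
          "degree h \<le> degree g' - d" by blast
      have "smult (c ^ Suc r) g = (h + smult (c ^ r) m) * f + q"
      proof -
        have "smult (c ^ Suc r) g = smult (c ^ r) g' + smult (c ^ r) m * f"
          by (simp add: g'_def smult_diff_right mult.commute)
        thus ?thesis using *(3) by (simp add: algebra_simps)
      qed
      moreover have "h + smult (c ^ r) m \<in> polys_over A"
        using P(3)[OF *(1) P(5)[OF const_in_polys_over[OF A unital_subringD(7)[OF A cA]] m]]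
        by simp
      moreover have "degree (h + smult (c ^ r) m) \<le> degree g - d"
        using *(5) deg degree_smult_le[of "c ^ r" m] degree_monom_le[of "lead_coeff g" "n - d"]
        by (intro degree_add_le) (auto simp: m_def n_def)
      ultimately show ?thesis using *(2,4) by blast
    qed
  qed
  thus ?thesis using that by (auto simp: c_def)
qed

section \<open>Prime ideals and rings with one adjoined element\<close>

definition prime_ideal_of :: "'r::comm_ring_1 set \<Rightarrow> 'r set \<Rightarrow> bool" where
  "prime_ideal_of S P \<longleftrightarrow> P \<subseteq> S \<and> 0 \<in> P \<and> 1 \<notin> P \<and>
     (\<forall>x\<in>P. \<forall>y\<in>P. x + y \<in> P) \<and> (\<forall>x\<in>P. \<forall>a\<in>S. a * x \<in> P) \<and>
     (\<forall>a\<in>S. \<forall>b\<in>S. a * b \<in> P \<longrightarrow> a \<in> P \<or> b \<in> P)"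

definition adjoin :: "'r::comm_ring_1 set \<Rightarrow> 'r \<Rightarrow> 'r set" where
  "adjoin A t = (\<lambda>p. poly p t) ` polys_over A"

lemma unital_subring_adjoin:
  assumes "unital_subring A" shows "unital_subring (adjoin A t)"
  unfolding unital_subring_def adjoin_def
proof (intro conjI ballI)
  note P = unital_subringD[OF unital_subring_polys_over[OF assms]]
  show "1 \<in> (\<lambda>p. poly p t) ` polys_over A"
    using P(2) by (metis image_eqI poly_1)
  fix x y assume "x \<in> (\<lambda>p. poly p t) ` polys_over A" "y \<in> (\<lambda>p. poly p t) ` polys_over A"
  then obtain p q where *: "p \<in> polys_over A" "q \<in> polys_over A" "x = poly p t" "y = poly q t"
    by blast
  show "x - y \<in> (\<lambda>p. poly p t) ` polys_over A"
    using P(4)[OF *(1,2)] *(3,4) by (intro image_eqI[of _ _ "p - q"]) auto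
  show "x * y \<in> (\<lambda>p. poly p t) ` polys_over A"
    using P(5)[OF *(1,2)] *(3,4) by (intro image_eqI[of _ _ "p * q"]) auto
qed

lemma adjoin_base: "unital_subring A \<Longrightarrow> a \<in> A \<Longrightarrow> a \<in> adjoin A t"
  unfolding adjoin_def using const_in_polys_over[of A a] by (intro image_eqI[of _ _ "[:a:]"]) auto

lemma adjoin_self: "unital_subring A \<Longrightarrow> t \<in> adjoin A t"
  unfolding adjoin_def using monom_in_polys_over[of A 1 1] unital_subringD(2)[of A]
  by (intro image_eqI[of _ _ "monom 1 1"]) (auto simp: poly_monom)

text \<open>Two polynomials with the same value at \<open>t\<close> differ by one whose value is 0,
  an element of \<open>P\<close>; by \<open>kill\<close> the choice of the representing polynomial
  is harmless.\<close>

lemma hom_on_adjoin: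
  fixes \<phi> :: "'r::comm_ring_1 \<Rightarrow> 's::comm_ring_1"
  assumes A: "unital_subring A" and \<phi>: "hom_on A \<phi>"
    and P0: "0 \<in> P"
    and kill: "\<And>p. p \<in> polys_over A \<Longrightarrow> poly p t \<in> P \<Longrightarrow> poly (map_poly \<phi> p) s = 0"
  obtains \<psi> where "hom_on (adjoin A t) \<psi>"
    "\<And>p. p \<in> polys_over A \<Longrightarrow> \<psi> (poly p t) = poly (map_poly \<phi> p) s"
proof -
  define \<psi> where
    "\<psi> z = poly (map_poly \<phi> (SOME p. p \<in> polys_over A \<and> poly p t = z)) s" for z
  note Q = unital_subringD[OF unital_subring_polys_over[OF A]]
  note H = hom_on_map_poly[OF A \<phi>, unfolded hom_on_def]
  have eq: "\<psi> (poly p t) = poly (map_poly \<phi> p) s" if p: "p \<in> polys_over A" for p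
  proof -
    define q where "q = (SOME q. q \<in> polys_over A \<and> poly q t = poly p t)"
    have q: "q \<in> polys_over A \<and> poly q t = poly p t"
      unfolding q_def by (rule someI[of _ p]) (use p in auto)
    have "poly (map_poly \<phi> (q - p)) s = 0"
      using q p Q(4) P0 by (intro kill) auto
    moreover have "map_poly \<phi> ((q - p) + p) = map_poly \<phi> (q - p) + map_poly \<phi> p"
      using H q p Q(4) by blast
    ultimately have "poly (map_poly \<phi> q) s = poly (map_poly \<phi> p) s" by simp
    thus ?thesis by (simp add: \<psi>_def q_def)
  qed
  have "hom_on (adjoin A t) \<psi>"
    unfolding hom_on_def
  proof (intro conjI ballI)
    show "\<psi> 1 = 1" using eq[OF Q(2)] H by simp
    fix x y assume "x \<in> adjoin A t" "y \<in> adjoin A t"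
    then obtain p q where *: "p \<in> polys_over A" "q \<in> polys_over A" "x = poly p t" "y = poly q t"
      by (auto simp: adjoin_def)
    have "\<psi> (poly (p + q) t) = poly (map_poly \<phi> p + map_poly \<phi> q) s"
      using eq[OF Q(3)[OF *(1,2)]] H *(1,2) by simp
    thus "\<psi> (x + y) = \<psi> x + \<psi> y"
      using * by (simp add: eq)
    have "\<psi> (poly (p * q) t) = poly (map_poly \<phi> p * map_poly \<phi> q) s"
      using eq[OF Q(5)[OF *(1,2)]] H *(1,2) by simp
    thus "\<psi> (x * y) = \<psi> x * \<psi> y"
      using * by (simp add: eq)
  qed
  with eq show ?thesis using that by blast
qed

text \<open>Euclid's argument: the product of all X - a, increased by 1, would have a root, yet the
  product vanishes everywhere.\<close>

lemma infinite_alg_closed_field: "infinite (UNIV :: 'b::alg_closed_field set)"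
proof
  assume fin: "finite (UNIV :: 'b set)"
  define p where "p = (\<Prod>a\<in>(UNIV::'b set). [:-a, 1:])"
  have deg: "degree p = card (UNIV :: 'b set)"
    unfolding p_def by (subst degree_prod_eq_sum_degree) auto
  have "degree p > 0" using fin by (simp add: deg finite_UNIV_card_ge_0)
  hence "degree (p + 1) > 0"
    by (subst degree_add_eq_left) auto
  then obtain x where "poly (p + 1) x = 0"
    using alg_closed_imp_poly_has_root by blast
  moreover have "poly p x = 0"
    using fin by (auto simp: p_def poly_prod)
  ultimately show False by simp
qed

section \<open>The weak Nullstellensatz\<close>

lemma prime_ideal_ofD:
  assumes "prime_ideal_of S P"
  shows "P \<subseteq> S" "0 \<in> P" "1 \<notin> P" "x \<in> P \<Longrightarrow> y \<in> P \<Longrightarrow> x + y \<in> P"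
    "a \<in> S \<Longrightarrow> x \<in> P \<Longrightarrow> a * x \<in> P" "a \<in> S \<Longrightarrow> x \<in> P \<Longrightarrow> x * a \<in> P"
    "a \<in> S \<Longrightarrow> b \<in> S \<Longrightarrow> a * b \<in> P \<Longrightarrow> a \<in> P \<or> b \<in> P"
  using assms unfolding prime_ideal_of_def by (auto simp: mult.commute)

lemma prime_ideal_of_diff:
  assumes S: "unital_subring S" and P: "prime_ideal_of S P" and "x \<in> P" "y \<in> P"
  shows "x - y \<in> P"
proof -
  have "- 1 \<in> S" using unital_subringD(6)[OF S unital_subringD(2)[OF S]] .
  hence "- 1 * y \<in> P" using prime_ideal_ofD(5)[OF P] assms(4) by blast
  hence "x + (- 1 * y) \<in> P" using prime_ideal_ofD(4)[OF P] assms(3) by blast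
  thus ?thesis by simp
qed

lemma prime_ideal_of_sum:
  assumes "prime_ideal_of S P" "\<And>i. i \<in> I \<Longrightarrow> f i \<in> P" shows "sum f I \<in> P"
  using assms(2) by (induction I rule: infinite_finite_induct) (auto intro: prime_ideal_ofD[OF assms(1)])

lemma prime_ideal_of_power:
  assumes "unital_subring S" "prime_ideal_of S P" "a \<in> S" "a ^ n \<in> P" shows "a \<in> P"
  using assms(4)
proof (induction n)
  case 0 thus ?case using prime_ideal_ofD(3)[OF assms(2)] by simp
next
  case (Suc n)
  thus ?case using prime_ideal_ofD(7)[OF assms(2,3) unital_subringD(7)[OF assms(1,3)]] by auto
qed

lemma poly_in_prime_ideal:
  assumes "unital_subring S" "prime_ideal_of S P" "t \<in> S" "\<And>i. coeff p i \<in> P"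
  shows "poly p t \<in> P"
  unfolding poly_altdef using assms
  by (intro prime_ideal_of_sum[OF assms(2)] prime_ideal_ofD(6)[OF assms(2)] unital_subringD(7)[OF assms(1)]) auto

lemma degree_diff_lead_monom_less:
  fixes g :: "'r::comm_ring_1 poly"
  assumes "degree g \<noteq> 0"
  shows "degree (g - monom (lead_coeff g) (degree g)) < degree g"
proof -
  define g' where "g' = g - monom (lead_coeff g) (degree g)"
  have "degree g' \<le> degree g"
    unfolding g'_def by (intro degree_diff_le) (auto intro: degree_monom_le)
  moreover have "coeff g' (degree g) = 0" by (simp add: g'_def)
  ultimately show ?thesis
    using eq_zero_or_degree_less[of g' "degree g"] assms by (auto simp: g'_def)
qed

text \<open>
  The induction step of the Nullstellensatz. The element \<open>b\<close> is carried along because a maximal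
  ideal of \<open>A[t]\<close> need not contract to a maximal ideal of \<open>A\<close>: the point of \<open>A\<close> to be
  lifted has to avoid \<open>a\<close>.
\<close>

lemma extend_hom:
  fixes A S P :: "'r::comm_ring_1 set"
  assumes A: "unital_subring A" and S: "unital_subring S" and SA: "S = adjoin A t"
    and P: "prime_ideal_of S P" and b: "b \<in> S" "b \<notin> P"
  obtains a where "a \<in> A" "a \<notin> P"
    "\<forall>\<phi> :: 'r \<Rightarrow> 'b::alg_closed_field. hom_on A \<phi> \<and> (\<forall>x\<in>A \<inter> P. \<phi> x = 0) \<and> \<phi> a \<noteq> 0 \<longrightarrow>
       (\<exists>\<psi>. hom_on S \<psi> \<and> (\<forall>x\<in>P. \<psi> x = 0) \<and> \<psi> b \<noteq> 0 \<and> (\<forall>x\<in>A. \<psi> x = \<phi> x))"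
proof -
  note Ad = unital_subringD[OF A] and Sd = unital_subringD[OF S] and Pd = prime_ideal_ofD[OF P]
  note Q = unital_subringD[OF unital_subring_polys_over[OF A]]
  have AS: "A \<subseteq> S" and tS: "t \<in> S" using adjoin_base[OF A] adjoin_self[OF A] SA by auto
  note ev = poly_in_subring[OF S AS tS]
  obtain pb where pb: "pb \<in> polys_over A" "b = poly pb t"
    using b SA by (auto simp: adjoin_def)
  \<comment> \<open>A value s for t yields an extension of \<open>\<phi>\<close> as soon as every
    relation in \<open>P\<close> holds at s. The two cases below only find such an s and check that
    b survives.\<close>
  have main: "\<exists>\<psi>. hom_on S \<psi> \<and> (\<forall>x\<in>P. \<psi> x = 0) \<and> (\<forall>x\<in>A. \<psi> x = \<phi> x) \<and>
      (\<forall>p\<in>polys_over A. \<psi> (poly p t) = poly (map_poly \<phi> p) s)"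
    if \<phi>: "hom_on A \<phi>" and kill: "\<And>p. p \<in> polys_over A \<Longrightarrow> poly p t \<in> P \<Longrightarrow> poly (map_poly \<phi> p) s = 0"
    for \<phi> :: "'r \<Rightarrow> 'b" and s
  proof -
    obtain \<psi> where \<psi>: "hom_on (adjoin A t) \<psi>"
      "\<And>p. p \<in> polys_over A \<Longrightarrow> \<psi> (poly p t) = poly (map_poly \<phi> p) s"
      using hom_on_adjoin[OF A \<phi> Pd(2) kill] by blast
    have "\<psi> x = 0" if xP: "x \<in> P" for x
    proof -
      obtain p where "p \<in> polys_over A" "x = poly p t"
        using xP Pd(1) SA unfolding adjoin_def by blast
      thus ?thesis using \<psi>(2) kill xP by auto
    qed
    moreover have "\<psi> x = \<phi> x" if "x \<in> A" for x
      using \<psi>(2)[OF const_in_polys_over[OF A that]] hom_on_0[OF A \<phi>] by (simp add: map_poly_pCons)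
    ultimately show ?thesis using \<psi> SA by blast
  qed
  show ?thesis
  proof (cases "\<forall>p\<in>polys_over A. poly p t \<in> P \<longrightarrow> (\<forall>i. coeff p i \<in> P)")
    case transc: True
    \<comment> \<open>Here t is transcendental modulo \<open>P\<close>, so b is outside
      \<open>P\<close> only because some coefficient is. If \<open>\<phi>\<close> keeps that
      coefficient nonzero, all but finitely many s avoid the roots of the image of
      \<open>pb\<close>.\<close>
    obtain j where j: "coeff pb j \<notin> P"
      using poly_in_prime_ideal[OF S P tS, of pb] b pb by auto
    show ?thesis
    proof (rule that; (intro allI impI)?; (elim conjE)?)
      show "coeff pb j \<in> A" using pb by (auto simp: polys_over_def)
      show "coeff pb j \<notin> P" by (rule j)
      fix \<phi> :: "'r \<Rightarrow> 'b"
      assume \<phi>: "hom_on A \<phi>" "\<forall>x\<in>A \<inter> P. \<phi> x = 0" "\<phi> (coeff pb j) \<noteq> 0"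
      note 0 = hom_on_0[OF A \<phi>(1)]
      have "coeff (map_poly \<phi> pb) j \<noteq> 0" using \<phi> 0 by (simp add: coeff_map_poly)
      hence "map_poly \<phi> pb \<noteq> 0" by auto
      hence "finite {s. poly (map_poly \<phi> pb) s = 0}" by (rule poly_roots_finite)
      then obtain s where s: "poly (map_poly \<phi> pb) s \<noteq> 0"
        using infinite_alg_closed_field by (metis (mono_tags, lifting) UNIV_I finite_subset mem_Collect_eq subsetI)
      have "poly (map_poly \<phi> p) s = 0" if "p \<in> polys_over A" "poly p t \<in> P" for p
      proof -
        have "coeff p i \<in> A \<inter> P" for i using transc that by (auto simp: polys_over_def)
        hence "map_poly \<phi> p = 0" using \<phi>(2) 0 by (intro poly_eqI) (auto simp: coeff_map_poly)
        thus ?thesis by simp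
      qed
      from main[OF \<phi>(1) this] s pb
      show "\<exists>\<psi>. hom_on S \<psi> \<and> (\<forall>x\<in>P. \<psi> x = 0) \<and> \<psi> b \<noteq> 0 \<and> (\<forall>x\<in>A. \<psi> x = \<phi> x)"
        by force
    qed
  next
    case False
    \<comment> \<open>The least such d is the degree of t over the fraction field of
      \<open>A\<close> modulo \<open>A \<inter> P\<close>.\<close>
    define alg where "alg d \<longleftrightarrow> (\<exists>f\<in>polys_over A. poly f t \<in> P \<and> degree f \<le> d \<and> coeff f d \<notin> P)" for d
    have "\<exists>d. alg d"
    proof -
      from False obtain p i where p: "p \<in> polys_over A" "poly p t \<in> P" "coeff p i \<notin> P" by blast
      \<comment> \<open>Leading terms in \<open>P\<close> are stripped off until a coefficient
        outside \<open>P\<close> is on top.\<close>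
      have "\<exists>d. alg d" if "p \<in> polys_over A" "poly p t \<in> P" "coeff p i \<notin> P" for p
        using that
      proof (induction "degree p" arbitrary: p rule: less_induct)
        case (less p)
        show ?case
        proof (cases "lead_coeff p \<in> P")
          case False
          thus ?thesis using less.prems unfolding alg_def by blast
        next
          case True
          define p' where "p' = p - monom (lead_coeff p) (degree p)"
          have mon: "monom (lead_coeff p) (degree p) \<in> polys_over A"
            using less.prems by (intro monom_in_polys_over[OF A]) (auto simp: polys_over_def)
          have "p' \<in> polys_over A" unfolding p'_def using Q(4)[OF less.prems(1) mon] .
          moreover have "poly p' t \<in> P"
            unfolding p'_def poly_diff poly_monom
            using True Sd(7)[OF tS] by (intro prime_ideal_of_diff[OF S P] less.prems Pd(6))
          moreover have ci: "coeff p' i \<notin> P"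
          proof
            assume "coeff p' i \<in> P"
            moreover have "coeff (monom (lead_coeff p) (degree p)) i \<in> P"
              using True Pd(2) by auto
            ultimately have "coeff p' i + coeff (monom (lead_coeff p) (degree p)) i \<in> P"
              by (rule Pd(4))
            thus False using less.prems by (simp add: p'_def)
          qed
          moreover have "degree p' < degree p"
          proof (cases "degree p")
            case 0
            hence "p' = 0" unfolding p'_def by (intro poly_eqI) (auto simp: coeff_eq_0)
            thus ?thesis using ci Pd(2) by simp
          next
            case (Suc n)
            thus ?thesis using degree_diff_lead_monom_less[of p] by (metis p'_def nat.simps(3))
          qed
          ultimately show ?thesis using less.hyps by blast
        qed
      qed
      thus ?thesis using p by blast
    qed
    define d where "d = (LEAST d. alg d)"
    have "alg d" unfolding d_def using \<open>\<exists>d. alg d\<close> by (rule LeastI_ex)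
    then obtain f where f: "f \<in> polys_over A" "poly f t \<in> P" "degree f \<le> d" "coeff f d \<notin> P"
      by (auto simp: alg_def)
    define c where "c = coeff f d"
    have cA: "c \<in> A" using f by (auto simp: c_def polys_over_def)
    have cP: "c \<notin> P" using f by (simp add: c_def)
    have d0: "d > 0"
    proof (rule ccontr)
      assume "\<not> d > 0"
      hence "degree f = 0" "d = 0" using f by auto
      hence "poly f t = coeff f d" by (auto elim!: degree_eq_zeroE)
      thus False using f by simp
    qed
    \<comment> \<open>Minimality of d puts the leading coefficient into \<open>P\<close>; removing
      that term and repeating reaches every coefficient.\<close>
    have low: "\<forall>i. coeff g i \<in> P" if "g \<in> polys_over A" "poly g t \<in> P" "degree g < d" for g
      using that
    proof (induction "degree g" arbitrary: g rule: less_induct)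
      case (less g)
      have lc: "lead_coeff g \<in> P"
        using not_less_Least[of "degree g" alg] less.prems unfolding d_def[symmetric]
        by (auto simp: alg_def)
      show ?case
      proof (cases "degree g")
        case 0
        thus ?thesis using lc Pd(2) by (metis coeff_eq_0 gr0I)
      next
        case (Suc n)
        define g' where "g' = g - monom (lead_coeff g) (degree g)"
        have mon: "monom (lead_coeff g) (degree g) \<in> polys_over A"
          using less.prems by (intro monom_in_polys_over[OF A]) (auto simp: polys_over_def)
        have "g' \<in> polys_over A" unfolding g'_def using Q(4)[OF less.prems(1) mon] .
        moreover have "poly g' t \<in> P"
          unfolding g'_def poly_diff poly_monom
          using lc Sd(7)[OF tS] by (intro prime_ideal_of_diff[OF S P] less.prems Pd(6))
        moreover have "degree g' < degree g" using degree_diff_lead_monom_less[of g] Suc by (metis g'_def nat.simps(3))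
        ultimately have g': "coeff g' i \<in> P" for i using less.hyps less.prems(3) by fastforce
        have "coeff g' i + coeff (monom (lead_coeff g) (degree g)) i \<in> P" for i
          using g' lc Pd(2) by (intro Pd(4)) auto
        thus ?thesis by (simp add: g'_def)
      qed
    qed
    \<comment> \<open>Values at t that are nonzero multiples of b modulo \<open>P\<close>. The aim
      is a constant member, an element of \<open>A\<close> whose nonvanishing forces that of b, as a
      norm of b would.\<close>
    define E where "E = {g \<in> polys_over A. poly g t \<notin> P \<and> (\<exists>u\<in>S. \<exists>p\<in>P. poly g t = u * b + p)}"
    have "poly pb t = 1 * b + 0" using pb by simp
    hence pbE: "pb \<in> E" using pb b Sd(2) Pd(2) unfolding E_def by blast
    obtain g where g: "g \<in> E" and gmin: "\<And>h. h \<in> E \<Longrightarrow> degree g \<le> degree h"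
      using ex_has_least_nat[of "\<lambda>g. g \<in> E" pb degree] pbE by blast
    have gA: "g \<in> polys_over A" and gP: "poly g t \<notin> P"
      and gb: "\<exists>u\<in>S. \<exists>p\<in>P. poly g t = u * b + p" using g by (auto simp: E_def)
    \<comment> \<open>The form v g - w g - p covers the three reductions to come: the remainder of g
      by f and g without its leading term (both with w = 0), and the remainder of f by g (with v =
      0).\<close>
    have inE: "q \<in> E" if "q \<in> polys_over A" "poly q t \<notin> P" "poly q t = v * poly g t - w * poly g t - p"
        "v \<in> S" "w \<in> S" "p \<in> P" for q v w p
    proof -
      obtain u p1 where *: "u \<in> S" "p1 \<in> P" "poly g t = u * b + p1" using gb by blast
      have "poly q t = ((v - w) * u) * b + ((v - w) * p1 - p)"
        using that * by (simp add: algebra_simps)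
      moreover have "(v - w) * p1 - p \<in> P"
        using * that by (intro prime_ideal_of_diff[OF S P] Pd(5) Sd(4)) auto
      moreover have "(v - w) * u \<in> S" using * that by (intro Sd(4,5))
      ultimately show ?thesis using that unfolding E_def by blast
    qed
    have powP: "x ^ r \<notin> P" if "x \<in> A" "x \<notin> P" for x r
      using prime_ideal_of_power[OF S P] that AS by blast
    have g_less_d: "degree g < d"
    proof -
      obtain r h q where hq: "h \<in> polys_over A" "q \<in> polys_over A"
        "smult (c ^ r) g = h * f + q" "degree q < d"
        using pseudo_division[OF A f(1) gA f(3) d0] unfolding c_def by metis
      have "poly (smult (c ^ r) g) t = poly (h * f + q) t" by (simp only: hq(3))
      hence q: "poly q t = c ^ r * poly g t - 0 * poly g t - poly h t * poly f t" by simp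
      have hf: "poly h t * poly f t \<in> P" using Pd(5) ev[OF hq(1)] f(2) by blast
      have cr: "c ^ r \<in> S" using cA AS Sd(7) by blast
      have "poly q t \<notin> P"
      proof
        assume "poly q t \<in> P"
        hence "poly q t + poly h t * poly f t \<in> P" using hf Pd(4) by blast
        hence "c ^ r * poly g t \<in> P" by (simp add: q)
        thus False using Pd(7)[OF cr ev[OF gA]] gP powP[OF cA cP] by blast
      qed
      hence "q \<in> E" using inE[OF hq(2) _ q cr Sd(1) hf] by blast
      thus ?thesis using gmin hq(4) by fastforce
    qed
    have lcg: "lead_coeff g \<notin> P"
    proof
      assume lc: "lead_coeff g \<in> P"
      define g' where "g' = g - monom (lead_coeff g) (degree g)"
      have mon: "monom (lead_coeff g) (degree g) \<in> polys_over A"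
        using gA by (intro monom_in_polys_over[OF A]) (auto simp: polys_over_def)
      have g'A: "g' \<in> polys_over A" unfolding g'_def using Q(4)[OF gA mon] .
      have tail: "lead_coeff g * t ^ degree g \<in> P" using lc Sd(7)[OF tS] Pd(6) by blast
      have eq: "poly g' t = 1 * poly g t - 0 * poly g t - lead_coeff g * t ^ degree g"
        by (simp add: g'_def poly_monom)
      have "poly g' t \<notin> P" using Pd(4)[OF _ tail, of "poly g' t"] gP eq by auto
      hence "g' \<in> E" using inE[OF g'A _ eq Sd(2,1) tail] by blast
      hence "degree g \<le> degree g'" by (rule gmin)
      hence "degree g = 0" using degree_diff_lead_monom_less[of g] unfolding g'_def by linarith
      hence "poly g t = lead_coeff g" by (auto elim!: degree_eq_zeroE)
      thus False using lc gP by simp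
    qed
    \<comment> \<open>Otherwise divide f by g. Minimality of g puts the remainder into
      \<open>P\<close> at t, hence also h(t) g(t), and by primality h(t). As h has degree below d,
      \<open>low\<close> puts its coefficients into \<open>P\<close>, and the coefficient of degree
      d then gives l^r c in \<open>P\<close>.\<close>
    have deg_g: "degree g = 0"
    proof (rule ccontr)
      assume "degree g \<noteq> 0"
      define l where "l = lead_coeff g"
      have lA: "l \<in> A" using gA by (auto simp: polys_over_def l_def)
      obtain r h q where hq: "h \<in> polys_over A" "q \<in> polys_over A"
        "smult (l ^ r) f = h * g + q" "degree q < degree g" "degree h \<le> degree f - degree g"
        using pseudo_division[OF A gA f(1) order_refl] \<open>degree g \<noteq> 0\<close> unfolding l_def
        by (metis gr0I)
      have "poly (smult (l ^ r) f) t = poly (h * g + q) t" by (simp only: hq(3))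
      hence q: "poly q t = 0 * poly g t - poly h t * poly g t - (- (l ^ r * poly f t))"
        by (simp add: algebra_simps)
      have lr: "l ^ r \<in> S" using lA AS Sd(7) by blast
      have lf: "l ^ r * poly f t \<in> P" using Pd(5) lr f(2) by blast
      have lf': "- (l ^ r * poly f t) \<in> P" using prime_ideal_of_diff[OF S P Pd(2) lf] by simp
      have qP: "poly q t \<in> P"
        using inE[OF hq(2) _ q Sd(1) ev[OF hq(1)] lf'] gmin hq(4) by fastforce
      have "poly h t * poly g t = l ^ r * poly f t - poly q t" using q by simp
      hence "poly h t * poly g t \<in> P" using prime_ideal_of_diff[OF S P lf qP] by simp
      hence "poly h t \<in> P" using Pd(7)[OF ev[OF hq(1)] ev[OF gA]] gP by blast
      moreover have "degree h < d" using hq(5) f(3) \<open>degree g \<noteq> 0\<close> d0 by linarith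
      ultimately have h: "coeff h i \<in> P" for i using low[OF hq(1)] by blast
      have "l ^ r * c = coeff (smult (l ^ r) f) d" by (simp add: c_def)
      also have "\<dots> = (\<Sum>i\<le>d. coeff h i * coeff g (d - i))"
        using hq(4) g_less_d by (simp add: hq(3) coeff_mult coeff_eq_0)
      also have "\<dots> \<in> P"
        using h gA AS by (intro prime_ideal_of_sum[OF P] Pd(6)) (auto simp: polys_over_def)
      finally show False
        using Pd(7)[OF lr] cA AS cP powP[OF lA] lcg by (auto simp: l_def)
    qed
    define e where "e = lead_coeff g"
    have ge: "poly g t = e" using deg_g by (auto elim!: degree_eq_zeroE simp: e_def)
    have eA: "e \<in> A" using gA by (auto simp: polys_over_def e_def)
    obtain u p where up: "u \<in> S" "p \<in> P" "e = u * b + p" using gb ge by auto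
    \<comment> \<open>\<open>\<phi> c \<noteq> 0\<close> keeps the image of f nonconstant, so that
      it has a root s; \<open>\<phi> e \<noteq> 0\<close> prevents b from vanishing, since e = u b +
      p with p in \<open>P\<close>.\<close>
    show ?thesis
    proof (rule that; (intro allI impI)?; (elim conjE)?)
      show "e * c \<in> A" using eA cA Ad(5) by blast
      show "e * c \<notin> P" using Pd(7)[of e c] eA cA AS cP gP ge by auto
      fix \<phi> :: "'r \<Rightarrow> 'b"
      assume \<phi>: "hom_on A \<phi>" "\<forall>x\<in>A \<inter> P. \<phi> x = 0" "\<phi> (e * c) \<noteq> 0"
      note 0 = hom_on_0[OF A \<phi>(1)]
      note H = hom_on_map_poly[OF A \<phi>(1), unfolded hom_on_def]
      have ec: "\<phi> e \<noteq> 0" "\<phi> c \<noteq> 0" using \<phi> eA cA by (auto simp: hom_on_def)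
      have "degree (map_poly \<phi> f) > 0"
        using le_degree[of "map_poly \<phi> f" d] ec d0 0 by (auto simp: coeff_map_poly c_def)
      then obtain s where s: "poly (map_poly \<phi> f) s = 0"
        using alg_closed_imp_poly_has_root by blast
      \<comment> \<open>Modulo f, some c^r k has degree below d, so by \<open>low\<close> the
        remainder has coefficients in \<open>P\<close> and dies under \<open>\<phi>\<close>; the
        factor c^r does not.\<close>
      have "poly (map_poly \<phi> k) s = 0" if k: "k \<in> polys_over A" "poly k t \<in> P" for k
      proof -
        obtain r h q where hq: "h \<in> polys_over A" "q \<in> polys_over A"
          "smult (c ^ r) k = h * f + q" "degree q < d"
          using pseudo_division[OF A f(1) k(1) f(3) d0] unfolding c_def by metis
        have "poly (smult (c ^ r) k) t = poly (h * f + q) t" by (simp only: hq(3))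
        hence q: "poly q t = c ^ r * poly k t - poly h t * poly f t" by simp
        have "poly q t \<in> P"
          unfolding q using Sd(7) cA AS ev[OF hq(1)] f(2) k(2)
          by (intro prime_ideal_of_diff[OF S P] Pd(5)) auto
        hence "coeff q i \<in> A \<inter> P" for i
          using low[OF hq(2) _ hq(4)] hq(2) by (auto simp: polys_over_def)
        hence q0: "map_poly \<phi> q = 0" using \<phi>(2) 0 by (intro poly_eqI) (auto simp: coeff_map_poly)
        have crA: "[:c ^ r:] \<in> polys_over A" using const_in_polys_over[OF A] Ad(7)[OF cA] by blast
        have "map_poly \<phi> ([:c ^ r:] * k) = map_poly \<phi> [:c ^ r:] * map_poly \<phi> k"
          using H crA k by blast
        moreover have "map_poly \<phi> (h * f + q) = map_poly \<phi> h * map_poly \<phi> f + map_poly \<phi> q"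
          using H hq(1,2) f(1) Q(5) by metis
        ultimately have "map_poly \<phi> [:c ^ r:] * map_poly \<phi> k = map_poly \<phi> h * map_poly \<phi> f"
          using hq(3) q0 by simp
        hence "poly (map_poly \<phi> [:c ^ r:] * map_poly \<phi> k) s = 0" using s by simp
        moreover have "\<phi> (c ^ r) \<noteq> 0"
        proof (induction r)
          case (Suc r)
          have "\<phi> (c * c ^ r) = \<phi> c * \<phi> (c ^ r)"
            using \<phi>(1) cA Ad(7)[OF cA] unfolding hom_on_def by blast
          thus ?case using Suc ec by simp
        qed (use \<phi> in \<open>auto simp: hom_on_def\<close>)
        ultimately show ?thesis by (simp add: map_poly_pCons 0)
      qed
      from main[OF \<phi>(1) this] obtain \<psi> where \<psi>: "hom_on S \<psi>" "\<forall>x\<in>P. \<psi> x = 0" "\<forall>x\<in>A. \<psi> x = \<phi> x"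
        by blast
      have "\<psi> (u * b + p) = \<psi> u * \<psi> b + \<psi> p"
        using \<psi>(1) up b Pd(1) Sd(5)[OF up(1) b(1)] unfolding hom_on_def by (metis subsetD)
      hence "\<psi> b \<noteq> 0" using \<psi> up eA ec by auto
      thus "\<exists>\<psi>. hom_on S \<psi> \<and> (\<forall>x\<in>P. \<psi> x = 0) \<and> \<psi> b \<noteq> 0 \<and> (\<forall>x\<in>A. \<psi> x = \<phi> x)"
        using \<psi> by blast
    qed
  qed
qed

section \<open>Finitely generated algebras over the field and their points\<close>

inductive_set generated :: "('b \<Rightarrow> 'r::comm_ring_1) \<Rightarrow> 'r set \<Rightarrow> 'r set"
  for \<kappa> and B where
  const: "\<kappa> c \<in> generated \<kappa> B"
| gen: "x \<in> B \<Longrightarrow> x \<in> generated \<kappa> B"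
| add: "x \<in> generated \<kappa> B \<Longrightarrow> y \<in> generated \<kappa> B \<Longrightarrow> x + y \<in> generated \<kappa> B"
| mult: "x \<in> generated \<kappa> B \<Longrightarrow> y \<in> generated \<kappa> B \<Longrightarrow> x * y \<in> generated \<kappa> B"

lemma unital_subring_generated:
  fixes \<kappa> :: "'b::comm_ring_1 \<Rightarrow> 'r::comm_ring_1"
  assumes "hom_on UNIV \<kappa>"
  shows "unital_subring (generated \<kappa> B)"
proof -
  have *: "\<kappa> 1 = 1" "\<kappa> (1 + - 1) = \<kappa> 1 + \<kappa> (- 1)" using assms unfolding hom_on_def by blast+
  hence "\<kappa> (- 1) = - 1"
    using hom_on_0[OF _ assms] by (simp add: unital_subring_def add_eq_0_iff)
  hence "- 1 \<in> generated \<kappa> B" using generated.const by metis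
  hence neg: "- 1 * y \<in> generated \<kappa> B" if "y \<in> generated \<kappa> B" for y
    using that by (rule generated.mult)
  have "x - y \<in> generated \<kappa> B" if "x \<in> generated \<kappa> B" "y \<in> generated \<kappa> B" for x y
    using generated.add[OF that(1) neg[OF that(2)]] by simp
  thus ?thesis unfolding unital_subring_def using *(1) generated.const[of \<kappa> 1 B] generated.mult by auto
qed

lemma generated_mono:
  assumes "B \<subseteq> Y" "f \<in> generated \<kappa> B" shows "f \<in> generated \<kappa> Y"
  using assms(2) by induction (use assms(1) in \<open>auto intro: generated.intros\<close>)

text \<open>Turns an induction on the generators into adjoining one element to the ring generated so
  far.\<close>

lemma generated_insert:
  fixes \<kappa> :: "'b::comm_ring_1 \<Rightarrow> 'r::comm_ring_1"
  assumes "hom_on UNIV \<kappa>"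
  shows "generated \<kappa> (insert t B) = adjoin (generated \<kappa> B) t"
proof (intro equalityI subsetI)
  note A = unital_subring_generated[OF assms, of B]
  note Ad = unital_subringD[OF unital_subring_adjoin[OF A, of t]]
  fix f assume "f \<in> generated \<kappa> (insert t B)"
  thus "f \<in> adjoin (generated \<kappa> B) t"
    by induction (auto intro: Ad adjoin_base[OF A] adjoin_self[OF A] generated.intros)
next
  fix f assume "f \<in> adjoin (generated \<kappa> B) t"
  then obtain p where p: "p \<in> polys_over (generated \<kappa> B)" "f = poly p t"
    by (auto simp: adjoin_def)
  show "f \<in> generated \<kappa> (insert t B)"
    unfolding p(2)
    by (rule poly_in_subring[OF unital_subring_generated[OF assms] _ _ p(1)])
       (auto intro: generated_mono generated.gen)
qed

text \<open>Induction on the generators: \<open>P\<close> is contracted to the smaller algebra, and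
  \<open>b\<close> is replaced by the element that \<open>extend_hom\<close> asks to avoid. Without
  generators only constants remain, and an ideal of constants without 1 is zero.\<close>

lemma prime_ideal_point:
  fixes \<kappa> :: "'b::alg_closed_field \<Rightarrow> 'r::comm_ring_1"
  assumes \<kappa>: "hom_on UNIV \<kappa>" and "finite B" and "prime_ideal_of (generated \<kappa> B) P"
    and "b \<in> generated \<kappa> B" "b \<notin> P"
  shows "\<exists>\<phi>. hom_on (generated \<kappa> B) \<phi> \<and> (\<forall>c. \<phi> (\<kappa> c) = c) \<and> (\<forall>x\<in>P. \<phi> x = 0) \<and> \<phi> b \<noteq> 0"
  using assms(2-5)
proof (induction B arbitrary: P b rule: finite_induct)
  case empty
  note S = unital_subring_generated[OF \<kappa>, of "{}"]
  note Pd = prime_ideal_ofD[OF empty(1)]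
  have hom: "\<kappa> u + \<kappa> v = \<kappa> (u + v)" "\<kappa> u * \<kappa> v = \<kappa> (u * v)" for u v
    using \<kappa> unfolding hom_on_def by simp_all
  have gen: "generated \<kappa> {} = range \<kappa>"
  proof (intro equalityI subsetI)
    fix f assume "f \<in> generated \<kappa> {}"
    thus "f \<in> range \<kappa>"
    proof induction
      case (add x y)
      then obtain u v where "x = \<kappa> u" "y = \<kappa> v" by blast
      thus ?case by (simp add: hom)
    next
      case (mult x y)
      then obtain u v where "x = \<kappa> u" "y = \<kappa> v" by blast
      thus ?case by (simp add: hom)
    qed auto
  qed (auto intro: generated.const)
  have \<kappa>0: "\<kappa> 0 = 0" using hom_on_0[OF _ \<kappa>] by (simp add: unital_subring_def)
  have unit: "c = 0" if "\<kappa> c \<in> P" for c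
  proof (rule ccontr)
    assume "c \<noteq> 0"
    have "\<kappa> (inverse c) * \<kappa> c \<in> P" using that generated.const by (intro Pd(5)) auto
    hence "\<kappa> 1 \<in> P" using \<open>c \<noteq> 0\<close> by (simp add: hom)
    thus False using Pd(3) \<kappa> by (simp add: hom_on_def)
  qed
  have inj: "inj \<kappa>"
  proof (rule injI)
    fix x y assume "\<kappa> x = \<kappa> y"
    have "\<kappa> ((x - y) + y) = \<kappa> (x - y) + \<kappa> y" using \<kappa> unfolding hom_on_def by blast
    hence "\<kappa> (x - y) = 0" using \<open>\<kappa> x = \<kappa> y\<close> by simp
    thus "x = y" using unit[of "x - y"] Pd(2) by simp
  qed
  define \<phi> where "\<phi> = inv_into UNIV \<kappa>"
  have \<phi>: "\<phi> (\<kappa> c) = c" for c using inj by (simp add: \<phi>_def)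
  have "hom_on (range \<kappa>) \<phi>"
    unfolding hom_on_def
  proof (intro conjI ballI)
    show "\<phi> 1 = 1" using \<phi>[of 1] \<kappa> by (simp add: hom_on_def)
    fix x y assume "x \<in> range \<kappa>" "y \<in> range \<kappa>"
    then obtain u v where *: "x = \<kappa> u" "y = \<kappa> v" by blast
    show "\<phi> (x + y) = \<phi> x + \<phi> y" "\<phi> (x * y) = \<phi> x * \<phi> y"
      unfolding * hom by (simp_all add: \<phi>)
  qed
  moreover have "\<phi> x = 0" if "x \<in> P" for x
  proof -
    obtain c where "x = \<kappa> c" using \<open>x \<in> P\<close> Pd(1) gen by blast
    thus ?thesis using unit \<open>x \<in> P\<close> \<phi> by simp
  qed
  moreover have "\<phi> b \<noteq> 0"
  proof
    assume "\<phi> b = 0"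
    moreover obtain c where "b = \<kappa> c" using empty gen by blast
    ultimately show False using \<phi> \<kappa>0 Pd(2) empty by simp
  qed
  ultimately show ?case using gen \<phi> by auto
next
  case (insert t B)
  define A where "A = generated \<kappa> B"
  define S where "S = generated \<kappa> (insert t B)"
  have A: "unital_subring A" and S: "unital_subring S"
    unfolding A_def S_def by (rule unital_subring_generated[OF \<kappa>])+
  have SA: "S = adjoin A t" unfolding S_def A_def by (rule generated_insert[OF \<kappa>])
  have P: "prime_ideal_of S P" and b: "b \<in> S" "b \<notin> P" using insert.prems by (auto simp: S_def)
  have sub: "A \<subseteq> S" using generated_mono[of B "insert t B"] by (auto simp: A_def S_def)
  have PA: "prime_ideal_of A (P \<inter> A)"
    unfolding prime_ideal_of_def
  proof (intro conjI ballI impI)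
    note Pd = prime_ideal_ofD[OF P] and Ad = unital_subringD[OF A]
    show "P \<inter> A \<subseteq> A" "0 \<in> P \<inter> A" "1 \<notin> P \<inter> A" using Pd(2,3) Ad(1) by auto
    show "x + y \<in> P \<inter> A" if "x \<in> P \<inter> A" "y \<in> P \<inter> A" for x y
      using that Pd(4) Ad(3) by blast
    show "a * x \<in> P \<inter> A" if "x \<in> P \<inter> A" "a \<in> A" for x a
      using that Pd(5) Ad(5) sub by blast
    show "a \<in> P \<inter> A \<or> b \<in> P \<inter> A" if "a \<in> A" "b \<in> A" "a * b \<in> P \<inter> A" for a b
      using that Pd(7)[of a b] sub by blast
  qed
  obtain a where a: "a \<in> A" "a \<notin> P"
    "\<forall>\<phi> :: 'r \<Rightarrow> 'b. hom_on A \<phi> \<and> (\<forall>x\<in>A \<inter> P. \<phi> x = 0) \<and> \<phi> a \<noteq> 0 \<longrightarrow>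
       (\<exists>\<psi>. hom_on S \<psi> \<and> (\<forall>x\<in>P. \<psi> x = 0) \<and> \<psi> b \<noteq> 0 \<and> (\<forall>x\<in>A. \<psi> x = \<phi> x))"
    by (rule extend_hom[OF A S SA P b])
  from insert.IH[of "P \<inter> A" a] PA a obtain \<phi> where \<phi>: "hom_on A \<phi>" "\<forall>c. \<phi> (\<kappa> c) = c"
    "\<forall>x\<in>P \<inter> A. \<phi> x = 0" "\<phi> a \<noteq> 0" unfolding A_def[symmetric] by blast
  from a(3) \<phi>(1,3,4) obtain \<psi> where \<psi>: "hom_on S \<psi>" "\<forall>x\<in>P. \<psi> x = 0" "\<psi> b \<noteq> 0"
    "\<forall>x\<in>A. \<psi> x = \<phi> x" unfolding Int_commute[of P] by blast
  have "\<psi> (\<kappa> c) = c" for c using \<psi>(4) \<phi>(2) generated.const[of \<kappa> c B] by (auto simp: A_def)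
  thus ?case using \<psi> unfolding S_def by blast
qed

section \<open>Ideals, prime ideals above proper ideals, and common zeros\<close>

definition ideal_of :: "'r::comm_ring_1 set \<Rightarrow> 'r set \<Rightarrow> bool" where
  "ideal_of S I \<longleftrightarrow> I \<subseteq> S \<and> 0 \<in> I \<and> (\<forall>x\<in>I. \<forall>y\<in>I. x + y \<in> I) \<and> (\<forall>x\<in>I. \<forall>a\<in>S. a * x \<in> I)"

lemma ideal_ofD:
  assumes "ideal_of S I"
  shows "I \<subseteq> S" "0 \<in> I" "x \<in> I \<Longrightarrow> y \<in> I \<Longrightarrow> x + y \<in> I" "a \<in> S \<Longrightarrow> x \<in> I \<Longrightarrow> a * x \<in> I"
    "a \<in> S \<Longrightarrow> x \<in> I \<Longrightarrow> x * a \<in> I"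
  using assms unfolding ideal_of_def by (auto simp: mult.commute)

lemma ideal_of_sum:
  assumes "ideal_of S P" "\<And>i. i \<in> I \<Longrightarrow> f i \<in> P" shows "sum f I \<in> P"
  using assms(2) by (induction I rule: infinite_finite_induct) (auto intro: ideal_ofD[OF assms(1)])

lemma ideal_of_add_principal:
  assumes S: "unital_subring S" and I: "ideal_of S I" and a: "a \<in> S"
  shows "ideal_of S {x + s * a |x s. x \<in> I \<and> s \<in> S}" (is "ideal_of S ?I")
  unfolding ideal_of_def
proof (intro conjI ballI subsetI)
  note Sd = unital_subringD[OF S] and Id = ideal_ofD[OF I]
  show "z \<in> S" if "z \<in> ?I" for z using that Id(1) Sd(3,5) a by blast
  have "0 = 0 + 0 * a" by simp
  thus "0 \<in> ?I" using Id(2) Sd(1) by blast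
  fix x assume "x \<in> ?I"
  then obtain u s where us: "x = u + s * a" "u \<in> I" "s \<in> S" by blast
  show "x + y \<in> ?I" if "y \<in> ?I" for y
  proof -
    obtain v t where vt: "y = v + t * a" "v \<in> I" "t \<in> S" using \<open>y \<in> ?I\<close> by blast
    have "x + y = (u + v) + (s + t) * a" using us vt by (simp add: algebra_simps)
    thus ?thesis using us vt Id(3) Sd(3) by blast
  qed
  show "c * x \<in> ?I" if "c \<in> S" for c
  proof -
    have "c * x = c * u + (c * s) * a" using us by (simp add: algebra_simps)
    thus ?thesis using us that Id(4) Sd(5) by blast
  qed
qed

lemma exists_prime_ideal:
  assumes S: "unital_subring S" and J: "ideal_of S J" "1 \<notin> J"
  obtains P where "prime_ideal_of S P" "J \<subseteq> P"
proof -
  note Sd = unital_subringD[OF S]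
  define \<A> where "\<A> = {I. ideal_of S I \<and> 1 \<notin> I \<and> J \<subseteq> I}"
  have "\<exists>M\<in>\<A>. \<forall>B\<in>\<A>. M \<subseteq> B \<longrightarrow> B = M"
  proof (rule subset_Zorn_nonempty)
    show "\<A> \<noteq> {}" using J by (auto simp: \<A>_def)
    fix C assume C: "C \<noteq> {}" "subset.chain \<A> C"
    have id: "ideal_of S I" if "I \<in> C" for I
      using C that by (auto simp: \<A>_def subset.chain_def)
    have "ideal_of S (\<Union>C)"
      unfolding ideal_of_def
    proof (intro conjI ballI)
      show "\<Union>C \<subseteq> S" "0 \<in> \<Union>C" using id C(1) ideal_ofD(1,2) by blast+
      fix x assume "x \<in> \<Union>C"
      then obtain I where I: "I \<in> C" "x \<in> I" by blast
      show "a * x \<in> \<Union>C" if "a \<in> S" for a using ideal_ofD(4)[OF id[OF I(1)] that I(2)] I by blast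
      fix y assume "y \<in> \<Union>C"
      then obtain K where K: "K \<in> C" "y \<in> K" by blast
      have "I \<subseteq> K \<or> K \<subseteq> I" using C I K unfolding subset.chain_def by blast
      thus "x + y \<in> \<Union>C"
        using ideal_ofD(3)[OF id[OF I(1)]] ideal_ofD(3)[OF id[OF K(1)]] I K by blast
    qed
    moreover have "1 \<notin> \<Union>C" "J \<subseteq> \<Union>C" using C unfolding subset.chain_def \<A>_def by blast+
    ultimately show "\<Union>C \<in> \<A>" by (simp add: \<A>_def)
  qed
  then obtain P where PA: "P \<in> \<A>" and max: "\<And>B. B \<in> \<A> \<Longrightarrow> P \<subseteq> B \<Longrightarrow> B = P" by blast
  have P: "ideal_of S P" "1 \<notin> P" "J \<subseteq> P" using PA by (auto simp: \<A>_def)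
  note Pd = ideal_ofD[OF P(1)]
  have one: "\<exists>x\<in>P. \<exists>s\<in>S. 1 = x + s * a" if a: "a \<in> S" "a \<notin> P" for a
  proof (rule ccontr)
    define I where "I = {x + s * a |x s. x \<in> P \<and> s \<in> S}"
    assume "\<not> (\<exists>x\<in>P. \<exists>s\<in>S. 1 = x + s * a)"
    hence "1 \<notin> I" unfolding I_def by blast
    moreover have "ideal_of S I" unfolding I_def by (rule ideal_of_add_principal[OF S P(1) a(1)])
    moreover have PI: "P \<subseteq> I"
    proof
      fix x assume "x \<in> P"
      moreover have "x = x + 0 * a" by simp
      ultimately show "x \<in> I" unfolding I_def using Sd(1) by blast
    qed
    ultimately have "I = P" using max P(3) by (auto simp: \<A>_def)
    moreover have "a = 0 + 1 * a" by simp
    hence "a \<in> I" unfolding I_def using Pd(2) Sd(2) by blast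
    ultimately show False using a by simp
  qed
  have "a \<in> P \<or> b \<in> P" if ab: "a \<in> S" "b \<in> S" "a * b \<in> P" for a b
  proof (rule ccontr)
    assume "\<not> (a \<in> P \<or> b \<in> P)"
    then obtain x s y t where *: "x \<in> P" "s \<in> S" "1 = x + s * a" "y \<in> P" "t \<in> S" "1 = y + t * b"
      using one ab by metis
    \<comment> \<open>Every term of the product of the two representations of 1 contains x, y or
      ab.\<close>
    have "1 = (x + s * a) * (y + t * b)" using *(3,6) by (metis mult_1)
    also have "\<dots> = x * y + (x * t * b + s * a * y) + (s * t) * (a * b)" by (simp add: algebra_simps)
    also have "\<dots> \<in> P"
    proof (intro Pd(3))
      show "x * y \<in> P" using * Pd(1,4) by blast
      show "x * t * b \<in> P" using Pd(5)[OF ab(2) Pd(5)[OF *(5) *(1)]] .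
      show "s * a * y \<in> P" using Pd(4)[OF Sd(5)[OF *(2) ab(1)] *(4)] .
      show "s * t * (a * b) \<in> P" using Pd(4)[OF Sd(5)[OF *(2,5)] ab(3)] .
    qed
    finally show False using P by simp
  qed
  hence "prime_ideal_of S P" using P Pd unfolding prime_ideal_of_def by blast
  thus ?thesis using that P by blast
qed

text \<open>The generators \<open>B\<close> will be the coordinate functions, on points or on pairs
  of points. Over an infinite field nothing is lost by replacing polynomials with the functions they
  induce.\<close>

definition polyfuns :: "('x \<Rightarrow> 'b) set \<Rightarrow> ('x \<Rightarrow> 'b::comm_ring_1) set" where
  "polyfuns B = generated (\<lambda>c _. c) B"

lemma hom_on_const_fun: "hom_on UNIV (\<lambda>c. (\<lambda>_. c) :: 'x \<Rightarrow> 'b::comm_ring_1)"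
  by (auto simp: hom_on_def fun_eq_iff)

lemma unital_subring_polyfuns: "unital_subring (polyfuns B)"
  unfolding polyfuns_def by (rule unital_subring_generated[OF hom_on_const_fun])

text \<open>By \<open>indep\<close> the generators take arbitrary values simultaneously, so a
  homomorphism to the field that fixes the constants is evaluation at a point. One that kills a
  prime ideal above \<open>J\<close> is therefore a common zero of \<open>J\<close>.\<close>

theorem weak_nullstellensatz:
  fixes B :: "('x \<Rightarrow> 'b::alg_closed_field) set"
  assumes fin: "finite B" and indep: "\<And>a. \<exists>z. \<forall>f\<in>B. f z = a f"
    and J: "ideal_of (polyfuns B) J" and no_zero: "\<And>z. \<exists>f\<in>J. f z \<noteq> 0"
  shows "1 \<in> J"
proof (rule ccontr)
  assume "1 \<notin> J"
  let ?\<kappa> = "\<lambda>c. (\<lambda>_. c) :: 'x \<Rightarrow> 'b"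
  note S = unital_subring_polyfuns[of B]
  obtain P where P: "prime_ideal_of (polyfuns B) P" "J \<subseteq> P"
    using exists_prime_ideal[OF S J \<open>1 \<notin> J\<close>] by blast
  obtain \<phi> where \<phi>: "hom_on (polyfuns B) \<phi>" "\<forall>c. \<phi> (?\<kappa> c) = c" "\<forall>x\<in>P. \<phi> x = 0"
    using prime_ideal_point[OF hom_on_const_fun fin, of P 1] P(1) prime_ideal_ofD(3)[OF P(1)]
      unital_subringD(2)[OF S] unfolding polyfuns_def by blast
  obtain z where z: "\<forall>f\<in>B. f z = \<phi> f" using indep by blast
  have "\<phi> f = f z" if "f \<in> generated ?\<kappa> B" for f
    using that
  proof induction
    case (const c) thus ?case using \<phi> by simp
  next
    case (gen x) thus ?case using z by simp
  next
    case (add x y)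
    have "\<phi> (x + y) = \<phi> x + \<phi> y"
      using \<phi>(1) add.hyps unfolding hom_on_def polyfuns_def by blast
    thus ?case using add.IH by (simp only: plus_fun_def)
  next
    case (mult x y)
    have "\<phi> (x * y) = \<phi> x * \<phi> y"
      using \<phi>(1) mult.hyps unfolding hom_on_def polyfuns_def by blast
    thus ?case using mult.IH by (simp only: times_fun_def)
  qed
  moreover obtain f where "f \<in> J" "f z \<noteq> 0" using no_zero by blast
  moreover have "f \<in> generated ?\<kappa> B" "\<phi> f = 0"
    using calculation(2) P(2) \<phi>(3) ideal_ofD(1)[OF J] unfolding polyfuns_def by blast+
  ultimately show False by simp
qed

section \<open>Polynomials and polynomial functions\<close>

lemma hom_on_UNIV:
  assumes "hom_on UNIV h"
  shows "h 0 = 0" "h 1 = 1" "h (x + y) = h x + h y" "h (x * y) = h x * h y" "h (x ^ n) = h x ^ n"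
    "h (sum f I) = (\<Sum>i\<in>I. h (f i))" "h (prod f I) = (\<Prod>i\<in>I. h (f i))" "h (- x) = - h x"
    "h (x - y) = h x - h y" "h (of_nat n) = of_nat n"
proof -
  show 0: "h 0 = 0" by (rule hom_on_0[OF unital_subring_UNIV assms])
  show 1: "h 1 = 1" and add: "\<And>x y. h (x + y) = h x + h y" and mult: "\<And>x y. h (x * y) = h x * h y"
    using assms by (auto simp: hom_on_def)
  show "h (x ^ n) = h x ^ n" by (induction n) (auto simp: 1 mult)
  show "h (of_nat n) = of_nat n" by (induction n) (auto simp: 0 1 add)
  show "h (sum f I) = (\<Sum>i\<in>I. h (f i))" by (induction I rule: infinite_finite_induct) (auto simp: 0 add)
  show "h (prod f I) = (\<Prod>i\<in>I. h (f i))" by (induction I rule: infinite_finite_induct) (auto simp: 1 mult)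
  show minus: "h (- x) = - h x" for x using add[of x "- x"] 0 by (simp add: add_eq_0_iff)
  show "h (x - y) = h x - h y" using add[of x "- y"] minus by simp
qed

definition mono_eval :: "'b::comm_semiring_1 ^ 'n::finite \<Rightarrow> ('n \<Rightarrow>\<^sub>0 nat) \<Rightarrow> 'b" where
  "mono_eval x e = (\<Prod>i\<in>UNIV. (x $ i) ^ Poly_Mapping.lookup e i)"

lemma mono_eval_0 [simp]: "mono_eval x 0 = 1"
  by (simp add: mono_eval_def)

lemma mono_eval_add: "mono_eval x (e + e') = mono_eval x e * mono_eval x e'"
  by (simp add: mono_eval_def lookup_add power_add prod.distrib)

lemma mono_eval_single: "mono_eval x (Poly_Mapping.single i n) = (x $ i) ^ n"
proof -
  have "mono_eval x (Poly_Mapping.single i n) = (\<Prod>j\<in>UNIV. if j = i then (x $ i) ^ n else 1)"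
    unfolding mono_eval_def by (intro prod.cong) (auto simp: lookup_single when_def)
  thus ?thesis by simp
qed

lemma msubst_superset:
  assumes "finite K" "Poly_Mapping.keys p \<subseteq> K" "\<phi> 0 = 0"
  shows "msubst \<phi> x p = (\<Sum>e\<in>K. \<phi> (Poly_Mapping.lookup p e) * mono_eval x e)"
  unfolding msubst_def mono_eval_def using assms
  by (intro sum.mono_neutral_left) (auto simp: in_keys_iff)

lemma msubst_single:
  assumes "\<phi> 0 = 0" shows "msubst \<phi> x (Poly_Mapping.single e c) = \<phi> c * mono_eval x e"
  using msubst_superset[of "{e}" "Poly_Mapping.single e c" \<phi> x] assms by simp

lemma msubst_add:
  assumes "hom_on UNIV \<phi>" shows "msubst \<phi> x (p + q) = msubst \<phi> x p + msubst \<phi> x q"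
proof -
  define K where "K = Poly_Mapping.keys p \<union> Poly_Mapping.keys q"
  have K: "finite K" "Poly_Mapping.keys p \<subseteq> K" "Poly_Mapping.keys q \<subseteq> K" "Poly_Mapping.keys (p + q) \<subseteq> K"
    using keys_add[of p q] by (auto simp: K_def)
  note h = hom_on_UNIV[OF assms]
  show ?thesis
    using K by (simp add: msubst_superset[OF K(1)] h lookup_add sum.distrib distrib_right)
qed

lemma msubst_0 [simp]: "msubst \<phi> x 0 = 0"
  by (simp add: msubst_def)

lemma msubst_sum:
  assumes "hom_on UNIV \<phi>" shows "msubst \<phi> x (sum f I) = (\<Sum>i\<in>I. msubst \<phi> x (f i))"
  by (induction I rule: infinite_finite_induct) (auto simp: msubst_add[OF assms])

lemma sum_single_lookup:
  "(\<Sum>e\<in>Poly_Mapping.keys p. Poly_Mapping.single e (Poly_Mapping.lookup p e)) = p"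
  by (rule poly_mapping_eqI)
     (auto simp: lookup_sum lookup_single when_def in_keys_iff sum.delta)

lemma msubst_mult:
  fixes p q :: "('a::comm_ring_1, 'n::finite) mpoly"
  assumes "hom_on UNIV \<phi>" shows "msubst \<phi> x (p * q) = msubst \<phi> x p * msubst \<phi> x q"
proof -
  note h = hom_on_UNIV[OF assms]
  define P where "P = (\<lambda>(p::('a, 'n) mpoly) e. Poly_Mapping.single e (Poly_Mapping.lookup p e))"
  have dec: "p = (\<Sum>e\<in>Poly_Mapping.keys p. P p e)" for p :: "('a, 'n) mpoly"
    unfolding P_def by (simp add: sum_single_lookup)
  have ev: "msubst \<phi> x p = (\<Sum>e\<in>Poly_Mapping.keys p. msubst \<phi> x (P p e))" for p :: "('a, 'n) mpoly"
    by (subst dec) (rule msubst_sum[OF assms])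
  have "msubst \<phi> x (p * q) = msubst \<phi> x ((\<Sum>e\<in>Poly_Mapping.keys p. P p e) * (\<Sum>e\<in>Poly_Mapping.keys q. P q e))"
    using dec by metis
  also have "\<dots> = (\<Sum>e\<in>Poly_Mapping.keys p. \<Sum>e'\<in>Poly_Mapping.keys q. msubst \<phi> x (P p e * P q e'))"
    by (simp add: sum_product msubst_sum[OF assms])
  also have "\<dots> = (\<Sum>e\<in>Poly_Mapping.keys p. \<Sum>e'\<in>Poly_Mapping.keys q. msubst \<phi> x (P p e) * msubst \<phi> x (P q e'))"
    by (simp add: P_def mult_single msubst_single h mono_eval_add mult_ac)
  also have "\<dots> = msubst \<phi> x p * msubst \<phi> x q"
    by (simp add: ev[of p] ev[of q] sum_product)
  finally show ?thesis .
qed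

lemma msubst_mconst: "\<phi> 0 = 0 \<Longrightarrow> msubst \<phi> x (mconst c) = \<phi> c"
  by (simp add: mconst_def msubst_single)

lemma msubst_mvar: "hom_on UNIV \<phi> \<Longrightarrow> msubst \<phi> x (mvar i) = x $ i"
  by (simp add: mvar_def msubst_single mono_eval_single hom_on_UNIV)

lemma hom_on_msubst:
  assumes "hom_on UNIV \<phi>" shows "hom_on UNIV (msubst \<phi> x)"
proof -
  have "msubst \<phi> x 1 = 1"
    using msubst_single[of \<phi> x 0 1] hom_on_UNIV[OF assms] by (simp flip: single_one)
  thus ?thesis by (simp add: hom_on_def msubst_add[OF assms] msubst_mult[OF assms])
qed

text \<open>Here \<open>h\<close> will be evaluation, for formal compositions, or a power of
  Frobenius, for equivariance and descent.\<close>

lemma hom_on_msubst_commute: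
  assumes "hom_on UNIV h"
  shows "h (msubst \<phi> x p) = msubst (\<lambda>c. h (\<phi> c)) (\<chi> i. h (x $ i)) p"
  by (simp add: msubst_def hom_on_UNIV[OF assms])

lemma hom_on_to_ac: "hom_on UNIV to_ac"
  by (simp add: hom_on_def)

lemma hom_on_ident: "hom_on UNIV (\<lambda>c. c)"
  by (simp add: hom_on_def)

lemma msubst_msubst:
  fixes G :: "('a::comm_ring_1, 'm::finite) mpoly ^ 'n::finite"
  assumes "hom_on UNIV \<phi>"
  shows "msubst \<phi> x (msubst mconst G p) = msubst \<phi> (\<chi> i. msubst \<phi> x (G $ i)) p"
  by (subst hom_on_msubst_commute[OF hom_on_msubst[OF assms]])
     (simp add: msubst_mconst hom_on_UNIV[OF assms])

lemma pmap_eval_comp: "pmap_eval (pmap_comp F G) x = pmap_eval F (pmap_eval G x)"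
  by (simp add: pmap_eval_def pmap_comp_def msubst_msubst[OF hom_on_to_ac])

lemma pmap_eval_id: "pmap_eval pmap_id x = x"
  by (simp add: pmap_eval_def pmap_id_def msubst_mvar[OF hom_on_to_ac] vec_eq_iff)

text \<open>Induction on the variables. With the others fixed, the sum is a polynomial in
  \<open>x j\<close> that vanishes on an infinite field, so the exponents with a given value at
  \<open>j\<close> form a vanishing sum of their own. Such a fibre \<open>S'\<close> is still
  separated by the remaining variables.\<close>

lemma monomial_sum_eq_0D:
  fixes c :: "('n \<Rightarrow> nat) \<Rightarrow> 'b::alg_closed_field"
  assumes "finite A" "finite S" "\<And>e e'. e \<in> S \<Longrightarrow> e' \<in> S \<Longrightarrow> (\<forall>i\<in>A. e i = e' i) \<Longrightarrow> e = e'"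
    "\<And>x :: 'n \<Rightarrow> 'b. (\<Sum>e\<in>S. c e * (\<Prod>i\<in>A. x i ^ e i)) = 0" "e \<in> S"
  shows "c e = 0"
  using assms
proof (induction A arbitrary: S e rule: finite_induct)
  case empty
  have "S = {e}" using empty.prems(2,4) by blast
  thus ?case using empty.prems(3)[of undefined] by simp
next
  case (insert j A)
  define S' where "S' = {e' \<in> S. e' j = e j}"
  show ?case
  proof (rule insert.IH)
    show "finite S'" "e \<in> S'" using insert.prems by (auto simp: S'_def)
    show "u = v" if "u \<in> S'" "v \<in> S'" "\<forall>i\<in>A. u i = v i" for u v
      using insert.prems(2)[of u v] that by (auto simp: S'_def)
    fix x :: "'n \<Rightarrow> 'b"
    define p where "p = (\<Sum>e\<in>S. monom (c e * (\<Prod>i\<in>A. x i ^ e i)) (e j))"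
    have "poly p t = 0" for t
    proof -
      have "poly p t = (\<Sum>e\<in>S. c e * (\<Prod>i\<in>insert j A. (x(j := t)) i ^ e i))"
        unfolding p_def poly_sum poly_monom
      proof (intro sum.cong refl)
        fix e
        have "(\<Prod>i\<in>A. x i ^ e i) = (\<Prod>i\<in>A. (x(j := t)) i ^ e i)"
          using insert.hyps by (intro prod.cong) auto
        thus "c e * (\<Prod>i\<in>A. x i ^ e i) * t ^ e j = c e * (\<Prod>i\<in>insert j A. (x(j := t)) i ^ e i)"
          using insert.hyps by (simp add: mult_ac)
      qed
      thus ?thesis using insert.prems(3) by simp
    qed
    hence "{t. poly p t = 0} = UNIV" by auto
    hence "p = 0" using poly_roots_finite[of p] infinite_alg_closed_field by metis
    hence "coeff p (e j) = 0" by simp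
    moreover have "coeff p (e j) = (\<Sum>e'\<in>S'. c e' * (\<Prod>i\<in>A. x i ^ e' i))"
      unfolding p_def coeff_sum coeff_monom S'_def using insert.prems(1)
      by (simp add: sum.inter_filter)
    ultimately show "(\<Sum>e'\<in>S'. c e' * (\<Prod>i\<in>A. x i ^ e' i)) = 0" by simp
  qed
qed

lemma msubst_eq_0_imp:
  fixes \<phi> :: "'a::comm_ring_1 \<Rightarrow> 'b::alg_closed_field"
  assumes \<phi>: "hom_on UNIV \<phi>" "inj \<phi>" and zero: "\<And>x. msubst \<phi> x p = 0"
  shows "p = 0"
proof (rule poly_mapping_eqI)
  fix e
  define S where "S = Poly_Mapping.lookup ` Poly_Mapping.keys p"
  have inj: "inj_on Poly_Mapping.lookup (Poly_Mapping.keys p)"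
    by (auto intro: inj_onI poly_mapping_eqI)
  have "Poly_Mapping.lookup p e = 0" if e: "e \<in> Poly_Mapping.keys p"
  proof -
    \<comment> \<open>The exponents of \<open>monomial_sum_eq_0D\<close> are plain functions;
      \<open>Abs_poly_mapping\<close> recovers the exponent vectors.\<close>
    have "\<phi> (Poly_Mapping.lookup p (Abs_poly_mapping (Poly_Mapping.lookup e))) = 0"
    proof (rule monomial_sum_eq_0D[of UNIV S "\<lambda>f. \<phi> (Poly_Mapping.lookup p (Abs_poly_mapping f))"])
      show "Poly_Mapping.lookup e \<in> S" using e by (simp add: S_def)
      fix x :: "'c \<Rightarrow> 'b"
      have "msubst \<phi> (\<chi> i. x i) p = 0" by (rule zero)
      thus "(\<Sum>e\<in>S. \<phi> (Poly_Mapping.lookup p (Abs_poly_mapping e)) * (\<Prod>i\<in>UNIV. x i ^ e i)) = 0"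
        unfolding S_def by (simp add: sum.reindex[OF inj] msubst_def)
    qed (auto simp: S_def)
    thus ?thesis using \<phi>(2) hom_on_UNIV(1)[OF \<phi>(1)] by (simp add: injD)
  qed
  thus "Poly_Mapping.lookup p e = Poly_Mapping.lookup 0 e" by (auto simp: in_keys_iff)
qed

lemma msubst_inject:
  fixes \<phi> :: "'a::comm_ring_1 \<Rightarrow> 'b::alg_closed_field"
  assumes \<phi>: "hom_on UNIV \<phi>" "inj \<phi>" and eq: "\<And>x. msubst \<phi> x p = msubst \<phi> x q"
  shows "p = q"
proof -
  have "p - q = 0"
    using eq by (intro msubst_eq_0_imp[OF \<phi>]) (simp add: hom_on_UNIV[OF hom_on_msubst[OF \<phi>(1)]])
  thus ?thesis by simp
qed

section \<open>Rings of polynomial functions\<close>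

definition coords :: "('b ^ 'n \<Rightarrow> 'b) set" where
  "coords = range (\<lambda>i x. x $ i)"

lemma polyfun_intros:
  fixes f g :: "'x \<Rightarrow> 'b::comm_ring_1"
  shows "(\<lambda>_. c) \<in> polyfuns B"
    and "f \<in> polyfuns B \<Longrightarrow> g \<in> polyfuns B \<Longrightarrow> (\<lambda>x. f x + g x) \<in> polyfuns B"
    and "f \<in> polyfuns B \<Longrightarrow> g \<in> polyfuns B \<Longrightarrow> (\<lambda>x. f x - g x) \<in> polyfuns B"
    and "f \<in> polyfuns B \<Longrightarrow> g \<in> polyfuns B \<Longrightarrow> (\<lambda>x. f x * g x) \<in> polyfuns B"
    and "f \<in> polyfuns B \<Longrightarrow> (\<lambda>x. f x ^ n) \<in> polyfuns B"
    and "(\<And>i. i \<in> I \<Longrightarrow> F i \<in> polyfuns B) \<Longrightarrow> (\<lambda>x. \<Sum>i\<in>I. F i x) \<in> polyfuns B"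
    and "(\<And>i. i \<in> I \<Longrightarrow> F i \<in> polyfuns B) \<Longrightarrow> (\<lambda>x. \<Prod>i\<in>I. F i x) \<in> polyfuns B"
proof -
  note S = unital_subringD[OF unital_subring_polyfuns]
  show const: "(\<lambda>_. c) \<in> polyfuns B" for c unfolding polyfuns_def by (rule generated.const)
  show add: "(\<lambda>x. f x + g x) \<in> polyfuns B" if "f \<in> polyfuns B" "g \<in> polyfuns B" for f g :: "'x \<Rightarrow> 'b"
    using S(3)[OF that] by (simp add: plus_fun_def)
  show "(\<lambda>x. f x - g x) \<in> polyfuns B" if "f \<in> polyfuns B" "g \<in> polyfuns B"
    using S(4)[OF that] by (simp add: fun_diff_def)
  show mult: "(\<lambda>x. f x * g x) \<in> polyfuns B" if "f \<in> polyfuns B" "g \<in> polyfuns B" for f g :: "'x \<Rightarrow> 'b"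
    using S(5)[OF that] by (simp add: times_fun_def)
  show "(\<lambda>x. f x ^ n) \<in> polyfuns B" if "f \<in> polyfuns B"
    by (induction n) (use that mult const in auto)
  show "(\<lambda>x. \<Sum>i\<in>I. F i x) \<in> polyfuns B" if "\<And>i. i \<in> I \<Longrightarrow> F i \<in> polyfuns B"
    using that by (induction I rule: infinite_finite_induct) (use const add in auto)
  show "(\<lambda>x. \<Prod>i\<in>I. F i x) \<in> polyfuns B" if "\<And>i. i \<in> I \<Longrightarrow> F i \<in> polyfuns B"
    using that by (induction I rule: infinite_finite_induct) (use const mult in auto)
qed

lemma polyfun_gen: "f \<in> B \<Longrightarrow> f \<in> polyfuns B"
  unfolding polyfuns_def by (rule generated.gen)

lemma polyfun_coord: "(\<lambda>x. x $ i) \<in> polyfuns coords"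
  by (rule polyfun_gen) (auto simp: coords_def)

lemma polyfun_induct [consumes 1, case_names const gen add mult]:
  assumes "f \<in> polyfuns B" "\<And>c. P (\<lambda>_. c)" "\<And>f. f \<in> B \<Longrightarrow> P f"
    "\<And>f g. f \<in> polyfuns B \<Longrightarrow> g \<in> polyfuns B \<Longrightarrow> P f \<Longrightarrow> P g \<Longrightarrow> P (\<lambda>x. f x + g x)"
    "\<And>f g. f \<in> polyfuns B \<Longrightarrow> g \<in> polyfuns B \<Longrightarrow> P f \<Longrightarrow> P g \<Longrightarrow> P (\<lambda>x. f x * g x)"
  shows "P f"
  using assms(1) unfolding polyfuns_def
proof (induction rule: generated.induct)
  case (add f g)
  thus ?case using assms(4)[of f g] by (simp add: polyfuns_def plus_fun_def)
next
  case (mult f g)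
  thus ?case using assms(5)[of f g] by (simp add: polyfuns_def times_fun_def)
qed (use assms in auto)

lemma polyfun_compose:
  assumes "f \<in> polyfuns B" "\<And>g. g \<in> B \<Longrightarrow> (\<lambda>x. g (h x)) \<in> polyfuns C"
  shows "(\<lambda>x. f (h x)) \<in> polyfuns C"
  using assms(1) by (induction rule: polyfun_induct) (auto intro: polyfun_intros assms(2))

lemma polyfun_compose_coords:
  fixes f :: "'b::comm_ring_1 ^ 'n \<Rightarrow> 'b" and h :: "'x \<Rightarrow> 'b ^ 'n"
  assumes "f \<in> polyfuns coords" "\<And>i. (\<lambda>x. h x $ i) \<in> polyfuns C"
  shows "(\<lambda>x. f (h x)) \<in> polyfuns C"
  by (rule polyfun_compose[OF assms(1)]) (use assms(2) in \<open>auto simp: coords_def\<close>)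

lemma polyfun_msubst: "(\<lambda>x. msubst \<phi> x p) \<in> polyfuns coords"
  unfolding msubst_def by (intro polyfun_intros polyfun_coord)

lemma polyfun_coords_msubst:
  fixes f :: "'b::comm_ring_1 ^ 'n::finite \<Rightarrow> 'b"
  assumes "f \<in> polyfuns coords"
  obtains p where "\<And>x. f x = msubst (\<lambda>c. c) x p"
proof -
  have "\<exists>p. \<forall>x. f x = msubst (\<lambda>c. c) x p"
    using assms
  proof (induction rule: polyfun_induct)
    case (const c)
    thus ?case by (intro exI[of _ "mconst c"]) (simp add: msubst_mconst)
  next
    case (gen f)
    then obtain i where "f = (\<lambda>x. x $ i)" by (auto simp: coords_def)
    thus ?case by (intro exI[of _ "mvar i"]) (simp add: msubst_mvar[OF hom_on_ident])
  next
    case (add f g)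
    then obtain p q where "\<forall>x. f x = msubst (\<lambda>c. c) x p" "\<forall>x. g x = msubst (\<lambda>c. c) x q" by blast
    thus ?case by (intro exI[of _ "p + q"]) (simp add: msubst_add[OF hom_on_ident])
  next
    case (mult f g)
    then obtain p q where "\<forall>x. f x = msubst (\<lambda>c. c) x p" "\<forall>x. g x = msubst (\<lambda>c. c) x q" by blast
    thus ?case by (intro exI[of _ "p * q"]) (simp add: msubst_mult[OF hom_on_ident])
  qed
  thus ?thesis using that by blast
qed

section \<open>Divided differences\<close>

definition coords2 :: "(('b ^ 'n) \<times> ('b ^ 'n) \<Rightarrow> 'b) set" where
  "coords2 = range (\<lambda>i z. fst z $ i) \<union> range (\<lambda>i z. snd z $ i)"

lemma polyfun_coords2:
  fixes f :: "'b::comm_ring_1 ^ 'n \<Rightarrow> 'b"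
  assumes "f \<in> polyfuns coords"
  shows "(\<lambda>z. f (fst z)) \<in> polyfuns coords2" "(\<lambda>z. f (snd z)) \<in> polyfuns coords2"
  by (rule polyfun_compose_coords[OF assms], rule polyfun_gen, auto simp: coords2_def)+

text \<open>The \<open>m j\<close> are divided differences, with the partial derivatives on the
  diagonal. This form of differentiability works in every characteristic and gives exact identities
  between distant points.\<close>

definition has_gradient :: "('b::comm_ring_1 ^ 'n::finite \<Rightarrow> 'b) \<Rightarrow> ('b ^ 'n \<Rightarrow> 'b ^ 'n) \<Rightarrow> bool" where
  "has_gradient f D \<longleftrightarrow> (\<exists>m. (\<forall>j. m j \<in> polyfuns coords2) \<and>
     (\<forall>x y. f x - f y = (\<Sum>j\<in>UNIV. m j (x, y) * (x $ j - y $ j))) \<and>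
     (\<forall>x j. m j (x, x) = D x $ j))"

lemma has_gradient_const: "has_gradient (\<lambda>_. c) (\<lambda>_. 0)"
  unfolding has_gradient_def by (intro exI[of _ "\<lambda>_ _. 0"]) (auto intro: polyfun_intros)

lemma has_gradient_coord:
  fixes i :: "'n::finite"
  shows "has_gradient (\<lambda>x :: 'b::comm_ring_1 ^ 'n. x $ i) (\<lambda>_. axis i 1)"
  unfolding has_gradient_def
proof (intro exI[of _ "\<lambda>j _. if j = i then 1 else 0"] conjI allI)
  fix x y :: "'b ^ 'n"
  have "(\<Sum>j\<in>UNIV. (if j = i then 1 else 0) * (x $ j - y $ j)) =
        (\<Sum>j\<in>UNIV. if j = i then x $ j - y $ j else 0)"
    by (intro sum.cong) auto
  thus "x $ i - y $ i = (\<Sum>j\<in>UNIV. (if j = i then 1 else 0) * (x $ j - y $ j))" by simp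
qed (auto intro: polyfun_intros simp: axis_def)

lemma has_gradient_add:
  assumes "has_gradient f D" "has_gradient g E"
  shows "has_gradient (\<lambda>x. f x + g x) (\<lambda>x. D x + E x)"
proof -
  obtain m where m: "\<And>j. m j \<in> polyfuns coords2"
    "\<And>x y. f x - f y = (\<Sum>j\<in>UNIV. m j (x, y) * (x $ j - y $ j))" "\<And>x j. m j (x, x) = D x $ j"
    using assms(1) unfolding has_gradient_def by blast
  obtain n where n: "\<And>j. n j \<in> polyfuns coords2"
    "\<And>x y. g x - g y = (\<Sum>j\<in>UNIV. n j (x, y) * (x $ j - y $ j))" "\<And>x j. n j (x, x) = E x $ j"
    using assms(2) unfolding has_gradient_def by blast
  show ?thesis
    unfolding has_gradient_def
  proof (intro exI[of _ "\<lambda>j z. m j z + n j z"] conjI allI)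
    fix x y
    have "f x + g x - (f y + g y) = (f x - f y) + (g x - g y)" by simp
    thus "f x + g x - (f y + g y) = (\<Sum>j\<in>UNIV. (m j (x, y) + n j (x, y)) * (x $ j - y $ j))"
      by (simp only: m(2) n(2) distrib_right sum.distrib)
  qed (auto intro: polyfun_intros m n simp: m n)
qed

lemma has_gradient_mult:
  fixes f g :: "'b::comm_ring_1 ^ 'n::finite \<Rightarrow> 'b"
  assumes "has_gradient f D" "has_gradient g E" and f: "f \<in> polyfuns coords" and g: "g \<in> polyfuns coords"
  shows "has_gradient (\<lambda>x. f x * g x) (\<lambda>x. f x *s E x + g x *s D x)"
proof -
  obtain m where m: "\<And>j. m j \<in> polyfuns coords2"
    "\<And>x y. f x - f y = (\<Sum>j\<in>UNIV. m j (x, y) * (x $ j - y $ j))" "\<And>x j. m j (x, x) = D x $ j"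
    using assms(1) unfolding has_gradient_def by blast
  obtain n where n: "\<And>j. n j \<in> polyfuns coords2"
    "\<And>x y. g x - g y = (\<Sum>j\<in>UNIV. n j (x, y) * (x $ j - y $ j))" "\<And>x j. n j (x, x) = E x $ j"
    using assms(2) unfolding has_gradient_def by blast
  show ?thesis
    unfolding has_gradient_def
  proof (intro exI[of _ "\<lambda>j z. f (fst z) * n j z + g (snd z) * m j z"] conjI allI)
    fix x y
    have "f x * g x - f y * g y = f x * (g x - g y) + g y * (f x - f y)" by (simp add: algebra_simps)
    thus "f x * g x - f y * g y =
        (\<Sum>j\<in>UNIV. (f (fst (x, y)) * n j (x, y) + g (snd (x, y)) * m j (x, y)) * (x $ j - y $ j))"
      by (simp only: m(2) n(2) distrib_right sum.distrib sum_distrib_left fst_conv snd_conv mult.assoc)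
  qed (auto intro!: polyfun_intros polyfun_coords2 m n f g simp: m n)
qed

lemma polyfun_mono_eval: "(\<lambda>x. mono_eval x e) \<in> polyfuns coords"
  unfolding mono_eval_def by (intro polyfun_intros polyfun_coord)

text \<open>Induction on the total degree: one variable is split off and the product rule
  applied.\<close>

lemma has_gradient_mono_eval:
  fixes e :: "'n::finite \<Rightarrow>\<^sub>0 nat"
  shows "has_gradient (\<lambda>x :: 'b::comm_ring_1 ^ 'n. mono_eval x e)
    (\<lambda>x. \<chi> j. of_nat (Poly_Mapping.lookup e j) * mono_eval x (e - Poly_Mapping.single j 1))"
proof (induction "\<Sum>i\<in>UNIV. Poly_Mapping.lookup e i" arbitrary: e)
  case 0
  hence "e = 0" by (intro poly_mapping_eqI) simp
  thus ?case using has_gradient_const[of "1 :: 'b"] by (simp add: zero_vec_def)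
next
  case (Suc n)
  then obtain i where i: "Poly_Mapping.lookup e i > 0"
    by (metis gr0I nat.distinct(1) sum.neutral)
  define e' where "e' = e - Poly_Mapping.single i 1"
  have e: "e = e' + Poly_Mapping.single i 1"
    using i by (intro poly_mapping_eqI) (auto simp: e'_def lookup_add lookup_minus lookup_single when_def)
  have "(\<Sum>i\<in>UNIV. Poly_Mapping.lookup e i) = (\<Sum>i\<in>UNIV. Poly_Mapping.lookup e' i) + 1"
    by (subst e) (simp add: lookup_add sum.distrib lookup_single when_def)
  hence "has_gradient (\<lambda>x :: 'b ^ 'n. mono_eval x e')
    (\<lambda>x. \<chi> j. of_nat (Poly_Mapping.lookup e' j) * mono_eval x (e' - Poly_Mapping.single j 1))"
    using Suc by (intro Suc.hyps(1)) simp
  from has_gradient_mult[OF this has_gradient_coord[of i] polyfun_mono_eval polyfun_coord]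
  have "has_gradient (\<lambda>x :: 'b ^ 'n. mono_eval x e' * x $ i)
    (\<lambda>x. mono_eval x e' *s axis i 1 +
       x $ i *s (\<chi> j. of_nat (Poly_Mapping.lookup e' j) * mono_eval x (e' - Poly_Mapping.single j 1)))" .
  moreover have "mono_eval x e = mono_eval x e' * x $ i" for x :: "'b ^ 'n"
    by (subst e) (simp add: mono_eval_add mono_eval_single)
  moreover have "(mono_eval x e' *s axis i 1 +
       x $ i *s (\<chi> j. of_nat (Poly_Mapping.lookup e' j) * mono_eval x (e' - Poly_Mapping.single j 1))) =
     (\<chi> j. of_nat (Poly_Mapping.lookup e j) * mono_eval x (e - Poly_Mapping.single j 1))" for x :: "'b ^ 'n"
  proof (rule vec_eq_iff[THEN iffD2], rule allI)
    fix j
    have xi: "x $ i * mono_eval x f = mono_eval x (f + Poly_Mapping.single i 1)" for f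
      by (simp add: mono_eval_add mono_eval_single mult.commute)
    show "(mono_eval x e' *s axis i 1 +
       x $ i *s (\<chi> j. of_nat (Poly_Mapping.lookup e' j) * mono_eval x (e' - Poly_Mapping.single j 1))) $ j =
     (\<chi> j. of_nat (Poly_Mapping.lookup e j) * mono_eval x (e - Poly_Mapping.single j 1)) $ j"
    proof (cases "j = i")
      case False
      have "e' - Poly_Mapping.single j 1 + Poly_Mapping.single i 1 = e - Poly_Mapping.single j 1"
        using False by (intro poly_mapping_eqI) (auto simp: e lookup_add lookup_minus lookup_single when_def)
      thus ?thesis using False xi[of "e' - Poly_Mapping.single j 1"]
        by (simp add: axis_def e lookup_add lookup_single mult.left_commute[of "x $ i"])
    next
      case True
      \<comment> \<open>If the exponent of \<open>i\<close> in \<open>e'\<close> is 0, truncated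
        subtraction produces a wrong monomial, but its coefficient is 0.\<close>
      have "of_nat (Poly_Mapping.lookup e' i) * mono_eval x (e' - Poly_Mapping.single i 1 + Poly_Mapping.single i 1)
          = of_nat (Poly_Mapping.lookup e' i) * mono_eval x e'"
      proof (cases "Poly_Mapping.lookup e' i = 0")
        case False
        hence "e' - Poly_Mapping.single i 1 + Poly_Mapping.single i 1 = e'"
          by (intro poly_mapping_eqI) (auto simp: lookup_add lookup_minus lookup_single when_def)
        thus ?thesis by simp
      qed simp
      hence "x $ i * (of_nat (Poly_Mapping.lookup e' i) * mono_eval x (e' - Poly_Mapping.single i 1))
          = of_nat (Poly_Mapping.lookup e' i) * mono_eval x e'"
        by (simp only: xi[symmetric] mult.left_commute)
      thus ?thesis using True
        by (simp add: axis_def) (simp add: e lookup_add lookup_single distrib_right add.commute)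
    qed
  qed
  ultimately show ?case by simp
qed

lemma has_gradient_sum:
  assumes "\<And>i. i \<in> I \<Longrightarrow> has_gradient (f i) (D i)"
  shows "has_gradient (\<lambda>x. \<Sum>i\<in>I. f i x) (\<lambda>x. \<Sum>i\<in>I. D i x)"
  using assms
  by (induction I rule: infinite_finite_induct) (auto intro: has_gradient_const has_gradient_add)

lemma has_gradient_msubst:
  fixes p :: "('a::comm_ring_1, 'n::finite) mpoly" and \<phi> :: "'a \<Rightarrow> 'b::comm_ring_1"
  assumes "hom_on UNIV \<phi>"
  shows "has_gradient (\<lambda>x. msubst \<phi> x p) (\<lambda>x. \<chi> j. msubst \<phi> x (mpderiv j p))"
proof -
  note h = hom_on_UNIV[OF assms]
  let ?c = "\<lambda>e. \<phi> (Poly_Mapping.lookup p e)"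
  let ?D = "\<lambda>e x. ?c e *s (\<chi> j. of_nat (Poly_Mapping.lookup e j) * mono_eval x (e - Poly_Mapping.single j 1)) + mono_eval x e *s 0"
  have "has_gradient (\<lambda>x. \<Sum>e\<in>Poly_Mapping.keys p. ?c e * mono_eval x e)
          (\<lambda>x. \<Sum>e\<in>Poly_Mapping.keys p. ?D e x)"
    by (intro has_gradient_sum has_gradient_mult has_gradient_const has_gradient_mono_eval
          polyfun_mono_eval polyfun_intros)
  moreover have "(\<Sum>e\<in>Poly_Mapping.keys p. ?D e x) = (\<chi> j. msubst \<phi> x (mpderiv j p))" for x
    by (simp add: vec_eq_iff mpderiv_def msubst_sum[OF assms] msubst_single h mult_ac)
  ultimately show ?thesis by (simp add: msubst_def mono_eval_def)
qed

section \<open>Restriction of polynomial functions to curves\<close>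

lemma polyfun_curve:
  fixes f :: "'x \<Rightarrow> 'b::comm_ring_1"
  assumes "f \<in> polyfuns B" "\<And>g. g \<in> B \<Longrightarrow> \<exists>p. \<forall>t. g (\<gamma> t) = poly p t"
  shows "\<exists>p. \<forall>t. f (\<gamma> t) = poly p t"
  using assms(1)
proof (induction rule: polyfun_induct)
  case (const c)
  show ?case by (intro exI[of _ "[:c:]"]) simp
next
  case (add f g)
  then obtain p q where "\<forall>t. f (\<gamma> t) = poly p t" "\<forall>t. g (\<gamma> t) = poly q t" by blast
  thus ?case by (intro exI[of _ "p + q"]) simp
next
  case (mult f g)
  then obtain p q where "\<forall>t. f (\<gamma> t) = poly p t" "\<forall>t. g (\<gamma> t) = poly q t" by blast
  thus ?case by (intro exI[of _ "p * q"]) simp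
qed (use assms(2) in auto)

text \<open>On the line through \<open>a\<close> and \<open>b\<close> both functions become nonzero
  polynomials in one variable, whose product has a nonzero value somewhere.\<close>

lemma polyfun_no_zero_divisors:
  fixes f g :: "'b::alg_closed_field ^ 'n::finite \<Rightarrow> 'b"
  assumes "f \<in> polyfuns coords" "g \<in> polyfuns coords" "f a \<noteq> 0" "g b \<noteq> 0"
  obtains x where "f x \<noteq> 0" "g x \<noteq> 0"
proof -
  define \<gamma> where "\<gamma> = (\<lambda>t. a + t *s (b - a))"
  have curve: "\<exists>p. \<forall>t. h (\<gamma> t) = poly p t" if h: "h \<in> coords" for h
  proof -
    obtain i where "h = (\<lambda>x. x $ i)" using h by (auto simp: coords_def)
    thus ?thesis by (intro exI[of _ "[:a $ i, b $ i - a $ i:]"]) (simp add: \<gamma>_def)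
  qed
  obtain p q where pq: "\<And>t. f (\<gamma> t) = poly p t" "\<And>t. g (\<gamma> t) = poly q t"
    using polyfun_curve[where \<gamma> = \<gamma>, OF assms(1) curve] polyfun_curve[where \<gamma> = \<gamma>, OF assms(2) curve] by blast
  have "poly p 0 \<noteq> 0" "poly q 1 \<noteq> 0"
    using assms(3,4) by (auto simp: \<gamma>_def simp flip: pq)
  hence "p * q \<noteq> 0" by auto
  hence "finite {t. poly (p * q) t = 0}" by (rule poly_roots_finite)
  then obtain t where "poly (p * q) t \<noteq> 0"
    using infinite_alg_closed_field by (metis (mono_tags, lifting) UNIV_I finite_subset mem_Collect_eq subsetI)
  thus ?thesis using that[of "\<gamma> t"] pq by auto
qed

section \<open>Birationality of injective etale maps\<close>

lemma sum_fun_apply: "(\<Sum>i\<in>A. f i) x = (\<Sum>i\<in>A. f i x :: 'b::comm_ring_1)"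
  by (induction A rule: infinite_finite_induct) auto

lemma finite_coords2: "finite (coords2 :: (('b ^ 'n::finite) \<times> ('b ^ 'n) \<Rightarrow> 'b) set)"
  by (simp add: coords2_def)

lemma coords2_independent:
  fixes a :: "(('b ^ 'n::finite) \<times> ('b ^ 'n) \<Rightarrow> 'b) \<Rightarrow> 'b"
  shows "\<exists>z. \<forall>f\<in>coords2. f z = a f"
  by (rule exI[of _ "(\<chi> i. a (\<lambda>z. fst z $ i), \<chi> i. a (\<lambda>z. snd z $ i))"]) (auto simp: coords2_def)

text \<open>
  In scheme language: an injective etale map is an epimorphism. Off the diagonal the ideal of the
  fibre product has no zeros, and near the diagonal it is the ideal of the diagonal by Cramer's rule.
\<close>

lemma injective_etale_diagonal:
  fixes F :: "'b::alg_closed_field ^ 'n::finite \<Rightarrow> 'b ^ 'n" and D :: "'b ^ 'n \<Rightarrow> 'b ^ 'n ^ 'n"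
  assumes F: "\<And>i. (\<lambda>x. F x $ i) \<in> polyfuns coords"
    and grad: "\<And>i. has_gradient (\<lambda>x. F x $ i) (\<lambda>x. D x $ i)"
    and det: "\<And>x. det (D x) \<noteq> 0" and inj: "inj F"
  obtains h where "\<And>j. h j \<in> polyfuns coords2"
    "\<And>x y. x $ k - y $ k = (\<Sum>j\<in>UNIV. h j (x, y) * (F x $ j - F y $ j))"
proof -
  let ?S = "polyfuns coords2 :: (('b ^ 'n) \<times> ('b ^ 'n) \<Rightarrow> 'b) set"
  note S = unital_subring_polyfuns[of coords2]
  have "\<forall>i. \<exists>m. (\<forall>j. m j \<in> ?S) \<and>
      (\<forall>x y. F x $ i - F y $ i = (\<Sum>j\<in>UNIV. m j (x, y) * (x $ j - y $ j))) \<and>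
      (\<forall>x j. m j (x, x) = D x $ i $ j)"
    using grad unfolding has_gradient_def by blast
  from choice[OF this] obtain m where m: "\<And>i j. m i j \<in> ?S"
    "\<And>i x y. F x $ i - F y $ i = (\<Sum>j\<in>UNIV. m i j (x, y) * (x $ j - y $ j))"
    "\<And>i j x. m i j (x, x) = D x $ i $ j"
    by blast
  define A where "A z = (\<chi> i j. m i j z)" for z
  define dF where "dF i z = F (fst z) $ i - F (snd z) $ i" for i z
  have dFS: "dF i \<in> ?S" for i
    unfolding dF_def by (intro polyfun_intros polyfun_coords2 F)
  define I where "I = {\<lambda>z. \<Sum>j\<in>UNIV. h j z * dF j z |h. \<forall>j. h j \<in> ?S}"
  have I_intro: "(\<lambda>z. \<Sum>j\<in>UNIV. h j z * dF j z) \<in> I" if "\<And>j. h j \<in> ?S" for h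
    unfolding I_def using that by blast
  have I: "ideal_of ?S I"
    unfolding ideal_of_def
  proof (intro conjI ballI subsetI)
    show "f \<in> ?S" if "f \<in> I" for f using that dFS by (auto simp: I_def intro!: polyfun_intros)
    show "0 \<in> I"
      using I_intro[of "\<lambda>_ _. 0"] by (simp add: zero_fun_def polyfun_intros)
    fix f assume "f \<in> I"
    then obtain h where h: "f = (\<lambda>z. \<Sum>j\<in>UNIV. h j z * dF j z)" "\<forall>j. h j \<in> ?S"
      unfolding I_def by blast
    show "f + g \<in> I" if gI: "g \<in> I" for g
    proof -
      obtain h' where h': "g = (\<lambda>z. \<Sum>j\<in>UNIV. h' j z * dF j z)" "\<forall>j. h' j \<in> ?S"
        using gI unfolding I_def by blast
      have "f + g = (\<lambda>z. \<Sum>j\<in>UNIV. (h j z + h' j z) * dF j z)"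
        by (simp add: h h' fun_eq_iff distrib_right sum.distrib)
      thus ?thesis
        using I_intro[of "\<lambda>j z. h j z + h' j z"] h(2) h'(2) by (simp add: polyfun_intros)
    qed
    show "g * f \<in> I" if "g \<in> ?S" for g
    proof -
      have "g * f = (\<lambda>z. \<Sum>j\<in>UNIV. (g z * h j z) * dF j z)"
        by (simp add: h fun_eq_iff sum_distrib_left mult.assoc)
      thus ?thesis using I_intro[of "\<lambda>j z. g z * h j z"] h(2) that by (simp add: polyfun_intros)
    qed
  qed
  note Id = ideal_ofD[OF I]
  have dFI: "dF i \<in> I" for i
  proof -
    have "dF i = (\<lambda>z. \<Sum>j\<in>UNIV. (if j = i then 1 else 0) * dF j z)"
      by (simp add: fun_eq_iff if_distrib[of "\<lambda>x. x * _"] cong: if_cong)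
    thus ?thesis
      using I_intro[of "\<lambda>j _. if j = i then 1 else 0"] by (simp add: polyfun_intros)
  qed
  define \<Delta> where "\<Delta> z = det (A z)" for z
  have \<Delta>S: "\<Delta> \<in> ?S"
    unfolding \<Delta>_def det_def A_def by (auto intro!: polyfun_intros m)
  have AdF: "(A z *v (fst z - snd z)) $ i = dF i z" for z i
    using m(2)[of "fst z" i "snd z"] by (simp add: A_def matrix_vector_mult_def dF_def)
  \<comment> \<open>Cramer's rule writes the product as a determinant whose column \<open>k\<close>
    holds the differences of \<open>F\<close>. Every permutation picks exactly one entry from that
    column, so every term of the expansion lies in \<open>I\<close>.\<close>
  have cramer: "(\<lambda>z. (fst z $ k - snd z $ k) * \<Delta> z) \<in> I"
  proof -
    define E where "E p i = (if p i = k then dF i else m i (p i))" for p :: "'n \<Rightarrow> 'n" and i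
    have "(fst z $ k - snd z $ k) * \<Delta> z =
        (\<Sum>p | p permutes UNIV. of_int (sign p) * (\<Prod>i\<in>UNIV. E p i z))" for z
    proof -
      have "(fst z $ k - snd z $ k) * \<Delta> z =
          det ((\<chi> i j. if j = k then (A z *v (fst z - snd z)) $ i else A z $ i $ j) :: 'b ^ 'n ^ 'n)"
        by (simp add: cramer_lemma \<Delta>_def)
      also have "\<dots> = (\<Sum>p | p permutes UNIV. of_int (sign p) * (\<Prod>i\<in>UNIV. E p i z))"
        unfolding det_def by (intro sum.cong prod.cong arg_cong2[of _ _ _ _ "(*)"] refl)
          (simp add: AdF E_def, simp add: A_def)
      finally show ?thesis .
    qed
    hence eq: "(\<lambda>z. (fst z $ k - snd z $ k) * \<Delta> z) =
        (\<Sum>p | p permutes UNIV. (\<lambda>z. of_int (sign p) * (\<Prod>i\<in>UNIV. E p i z)))"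
      by (simp add: fun_eq_iff sum_fun_apply)
    show ?thesis
      unfolding eq
    proof (rule ideal_of_sum[OF I])
      fix p :: "'n \<Rightarrow> 'n" assume "p \<in> {p. p permutes UNIV}"
      then obtain i where i: "p i = k" by (metis mem_Collect_eq permutes_surj surjD)
      have "(\<lambda>z. of_int (sign p) * (\<Prod>i\<in>UNIV. E p i z)) =
          (\<lambda>z. of_int (sign p) * (\<Prod>j\<in>UNIV - {i}. E p j z)) * dF i"
        using i by (simp add: fun_eq_iff prod.remove[of UNIV i] E_def mult_ac)
      moreover have "(\<lambda>z. of_int (sign p) * (\<Prod>j\<in>UNIV - {i}. E p j z)) \<in> ?S"
        by (intro polyfun_intros) (auto simp: E_def intro: m dFS)
      ultimately show "(\<lambda>z. of_int (sign p) * (\<Prod>i\<in>UNIV. E p i z)) \<in> I"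
        using Id(4) dFI by metis
    qed
  qed
  \<comment> \<open>Adding the determinant removes the last zeros: a zero of \<open>I\<close> lies
    on the diagonal by injectivity, and there \<open>\<Delta>\<close> is the determinant of
    \<open>D\<close>.\<close>
  define J where "J = {x + s * \<Delta> |x s. x \<in> I \<and> s \<in> ?S}"
  have J: "ideal_of ?S J" unfolding J_def by (rule ideal_of_add_principal[OF S I \<Delta>S])
  have IJ: "f \<in> J" if "f \<in> I" for f
  proof -
    have "f = f + 0 * \<Delta>" by simp
    thus ?thesis unfolding J_def using that unital_subringD(1)[OF S] by blast
  qed
  have \<Delta>J: "\<Delta> \<in> J"
  proof -
    have "\<Delta> = 0 + 1 * \<Delta>" by simp
    thus ?thesis unfolding J_def using Id(2) unital_subringD(2)[OF S] by blast
  qed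
  have "1 \<in> J"
  proof (rule weak_nullstellensatz[OF finite_coords2 coords2_independent J])
    fix z
    show "\<exists>f\<in>J. f z \<noteq> 0"
    proof (rule ccontr)
      assume "\<not> (\<exists>f\<in>J. f z \<noteq> 0)"
      hence *: "\<And>f. f \<in> J \<Longrightarrow> f z = 0" by blast
      have "F (fst z) = F (snd z)"
        using *[OF IJ[OF dFI]] by (simp add: vec_eq_iff dF_def)
      hence "fst z = snd z" using inj by (simp add: injD)
      hence "z = (fst z, fst z)" by (metis prod.collapse)
      hence "A z = D (fst z)" using m(3) by (metis (no_types, lifting) A_def vec_lambda_unique)
      thus False using *[OF \<Delta>J] det by (simp add: \<Delta>_def)
    qed
  qed
  then obtain f s where fs: "f \<in> I" "s \<in> ?S" "1 = f + s * \<Delta>" unfolding J_def by blast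
  define d where "d z = fst z $ k - snd z $ k" for z :: "('b ^ 'n) \<times> ('b ^ 'n)"
  have dS: "d \<in> ?S" unfolding d_def by (intro polyfun_intros polyfun_coords2 polyfun_coord)
  \<comment> \<open>Both resulting terms lie in \<open>I\<close>, the one with \<open>d\<close>
    times \<open>\<Delta>\<close> by Cramer's rule.\<close>
  have "d = d * (f + s * \<Delta>)" using fs(3) by (metis mult_1_right)
  also have "\<dots> = d * f + s * (\<lambda>z. d z * \<Delta> z)" by (simp add: fun_eq_iff algebra_simps)
  also have "\<dots> \<in> I"
    using cramer fs dS by (intro Id(3,4)) (auto simp: d_def)
  finally obtain h where h: "d = (\<lambda>z. \<Sum>j\<in>UNIV. h j z * dF j z)" "\<forall>j. h j \<in> ?S"
    unfolding I_def by blast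
  have "x $ k - y $ k = (\<Sum>j\<in>UNIV. h j (x, y) * (F x $ j - F y $ j))" for x y
    using fun_cong[OF h(1), of "(x, y)"] by (simp add: d_def dF_def)
  thus ?thesis using that h(2) by blast
qed

text \<open>Separating the variables makes the relation for the diagonal linear in the factors
  \<open>w y\<close>, which are then eliminated as unknowns; it is the coefficients \<open>u\<close>
  that have to be polynomial.\<close>

lemma polyfun_coords2_tensor:
  fixes f :: "('b::comm_ring_1 ^ 'n) \<times> ('b ^ 'n) \<Rightarrow> 'b"
  assumes "f \<in> polyfuns coords2"
  obtains ps where "\<And>u w. (u, w) \<in> set ps \<Longrightarrow> u \<in> polyfuns coords"
    "\<And>x y. f (x, y) = (\<Sum>(u, w)\<leftarrow>ps. u x * w y)"
proof -
  have "\<exists>ps. (\<forall>(u, w)\<in>set ps. u \<in> polyfuns coords) \<and> (\<forall>x y. f (x, y) = (\<Sum>(u, w)\<leftarrow>ps. u x * w y))"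
    using assms
  proof (induction rule: polyfun_induct)
    case (const c)
    show ?case by (intro exI[of _ "[(\<lambda>_. c, \<lambda>_. 1)]"]) (auto intro: polyfun_intros)
  next
    case (gen f)
    then consider i where "f = (\<lambda>z. fst z $ i)" | i where "f = (\<lambda>z. snd z $ i)"
      by (auto simp: coords2_def)
    thus ?case
    proof cases
      case 1
      thus ?thesis by (intro exI[of _ "[(\<lambda>x. x $ i, \<lambda>_. 1)]"]) (auto intro: polyfun_coord)
    next
      case 2
      thus ?thesis by (intro exI[of _ "[(\<lambda>_. 1, \<lambda>x. x $ i)]"]) (auto intro: polyfun_intros)
    qed
  next
    case (add f g)
    then obtain ps qs where
      ps: "\<forall>(u, w)\<in>set ps. u \<in> polyfuns coords" "\<forall>x y. f (x, y) = (\<Sum>(u, w)\<leftarrow>ps. u x * w y)" and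
      qs: "\<forall>(u, w)\<in>set qs. u \<in> polyfuns coords" "\<forall>x y. g (x, y) = (\<Sum>(u, w)\<leftarrow>qs. u x * w y)"
      by blast
    thus ?case by (intro exI[of _ "ps @ qs"]) auto
  next
    case (mult f g)
    then obtain ps qs where
      ps: "\<forall>(u, w)\<in>set ps. u \<in> polyfuns coords" "\<forall>x y. f (x, y) = (\<Sum>(u, w)\<leftarrow>ps. u x * w y)" and
      qs: "\<forall>(u, w)\<in>set qs. u \<in> polyfuns coords" "\<forall>x y. g (x, y) = (\<Sum>(u, w)\<leftarrow>qs. u x * w y)"
      by blast
    define rs where
      "rs = concat (map (\<lambda>(u, w). map (\<lambda>(u', w'). (\<lambda>x. u x * u' x, \<lambda>y. w y * w' y)) qs) ps)"
    have "(\<Sum>(u, w)\<leftarrow>rs. u x * w y) = (\<Sum>(u, w)\<leftarrow>ps. u x * w y) * (\<Sum>(u, w)\<leftarrow>qs. u x * w y)" for x y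
      unfolding rs_def
    proof (induction ps)
      case (Cons a ps)
      have "(\<Sum>(u, w)\<leftarrow>map (\<lambda>(u', w'). (\<lambda>x. fst a x * u' x, \<lambda>y. snd a y * w' y)) qs. u x * w y) =
          fst a x * snd a y * (\<Sum>(u, w)\<leftarrow>qs. u x * w y)"
        by (induction qs) (auto simp: algebra_simps)
      thus ?case using Cons by (simp add: case_prod_unfold distrib_right o_def)
    qed simp
    moreover have "\<forall>(u, w)\<in>set rs. u \<in> polyfuns coords"
      using ps(1) qs(1) by (auto simp: rs_def intro!: polyfun_intros)
    ultimately show ?case using ps qs by (intro exI[of _ rs]) auto
  qed
  thus ?thesis using that by blast
qed

text \<open>
  Specialising \<open>x\<close> to a point where the coefficient \<open>d l\<close> is nonzero gives a second relation,
  with which the factor \<open>w l\<close> is eliminated; the condition on the diagonal \<open>v = F x\<close> keeps the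
  coefficient of \<open>g\<close> from vanishing. This replaces a choice of basis over the fraction field.
\<close>

lemma eliminate_factors:
  fixes F :: "'b::alg_closed_field ^ 'n::finite \<Rightarrow> 'b ^ 'n"
  assumes F: "\<And>i. (\<lambda>x. F x $ i) \<in> polyfuns coords" and surj: "surj F"
    and "finite L"
    and "\<And>x. c x \<in> polyfuns coords" "\<And>x. e x \<in> polyfuns coords" "\<And>l x. d l x \<in> polyfuns coords"
    and "(\<lambda>x. e x (F x)) \<in> polyfuns coords"
    and "\<And>x y. c x (F y) + e x (F y) * g y + (\<Sum>l\<in>L. d l x (F y) * w l y) = 0"
    and "\<And>l x. d l x (F x) = 0" and "e z (F z) \<noteq> 0"
  shows "\<exists>a b. a \<in> polyfuns coords \<and> b \<in> polyfuns coords \<and> (\<exists>v. a v \<noteq> 0) \<and> (\<forall>y. a (F y) * g y = b (F y))"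
  using assms(3-)
proof (induction L arbitrary: c e d z rule: finite_induct)
  case empty
  \<comment> \<open>No factor is left, so specialising \<open>x\<close> to \<open>z\<close> gives
    the quotient; its denominator \<open>e z\<close> is nonzero at \<open>F z\<close>.\<close>
  have "(\<lambda>v. - 1 * c z v) \<in> polyfuns coords" by (intro polyfun_intros empty)
  moreover have "e z (F y) * g y = - 1 * c z (F y)" for y
    using empty.prems(5)[of z y] by (simp add: eq_neg_iff_add_eq_0 add.commute)
  ultimately show ?case using empty.prems(2)[of z] empty.prems(7) by blast
next
  case (insert l L)
  show ?case
  proof (cases "\<forall>x v. d l x v = 0")
    case True
    show ?thesis
      by (rule insert.IH[of c e d z]) (use insert True in auto)
  next
    case False
    then obtain x0 v0 where nz: "d l x0 v0 \<noteq> 0" by blast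
    obtain y0 where y0: "v0 = F y0" using surj by (metis surjD)
    have dF: "(\<lambda>x. d l x0 (F x)) \<in> polyfuns coords"
      by (rule polyfun_compose_coords[OF insert.prems(3) F])
    \<comment> \<open>The product of these two values is the diagonal value at \<open>z'\<close> of
      the new coefficient of \<open>g\<close>.\<close>
    obtain z' where z': "d l x0 (F z') \<noteq> 0" "e z' (F z') \<noteq> 0"
      using polyfun_no_zero_divisors[OF dF insert.prems(4), of y0 z] nz y0 insert.prems(7) by blast
    \<comment> \<open>A 2 by 2 determinant formed with the relation at \<open>x0\<close>. It is 0
      for \<open>u = d l\<close>, so \<open>w l\<close> drops out.\<close>
    define elim where "elim u x v = d l x0 v * u x v - d l x v * u x0 v" for u :: "'b ^ 'n \<Rightarrow> 'b ^ 'n \<Rightarrow> 'b" and x v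
    have diag: "elim u x (F x) = d l x0 (F x) * u x (F x)" for u x
      by (simp add: elim_def insert.prems(6))
    show ?thesis
    proof (rule insert.IH[of "elim c" "elim e" "\<lambda>k. elim (d k)" z'])
      show "elim c x \<in> polyfuns coords" "elim e x \<in> polyfuns coords" "elim (d k) x \<in> polyfuns coords" for k x
        unfolding elim_def by (intro polyfun_intros insert.prems)+
      show "(\<lambda>x. elim e x (F x)) \<in> polyfuns coords"
        unfolding diag by (intro polyfun_intros dF insert.prems)
      show "elim (d k) x (F x) = 0" for k x unfolding diag by (simp add: insert.prems)
      show "elim e z' (F z') \<noteq> 0" using z' by (simp add: diag)
      fix x y
      have id: "c x (F y) + e x (F y) * g y + d l x (F y) * w l y + (\<Sum>l\<in>L. d l x (F y) * w l y) = 0" for x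
        using insert.prems(5)[of x y] insert.hyps by (simp add: add.assoc)
      have "elim c x (F y) + elim e x (F y) * g y + (\<Sum>k\<in>L. elim (d k) x (F y) * w k y) =
          d l x0 (F y) * (c x (F y) + e x (F y) * g y + d l x (F y) * w l y + (\<Sum>l\<in>L. d l x (F y) * w l y)) -
          d l x (F y) * (c x0 (F y) + e x0 (F y) * g y + d l x0 (F y) * w l y + (\<Sum>l\<in>L. d l x0 (F y) * w l y))"
        by (simp add: elim_def algebra_simps sum_distrib_left sum_subtractf)
      also have "\<dots> = 0" by (simp only: id mult_zero_right diff_self)
      finally show "elim c x (F y) + elim e x (F y) * g y + (\<Sum>k\<in>L. elim (d k) x (F y) * w k y) = 0" .
    qed
  qed
qed

text \<open>The relation on pairs enters the elimination with \<open>y $ k\<close> as the unknown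
  \<open>g\<close>, with coefficient -1. Each coefficient of another unknown contains a component of
  \<open>F x - v\<close> as a factor and so vanishes for v = F x.\<close>

lemma bijective_etale_birational:
  fixes F :: "'b::alg_closed_field ^ 'n::finite \<Rightarrow> 'b ^ 'n" and D :: "'b ^ 'n \<Rightarrow> 'b ^ 'n ^ 'n"
  assumes F: "\<And>i. (\<lambda>x. F x $ i) \<in> polyfuns coords"
    and grad: "\<And>i. has_gradient (\<lambda>x. F x $ i) (\<lambda>x. D x $ i)"
    and det: "\<And>x. det (D x) \<noteq> 0" and bij: "bij F"
  obtains a b where "a \<in> polyfuns coords" "b \<in> polyfuns coords" "\<exists>v. a v \<noteq> 0"
    "\<And>y. a (F y) * y $ k = b (F y)"
proof -
  obtain h where h: "\<And>j. h j \<in> polyfuns coords2"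
    "\<And>x y. x $ k - y $ k = (\<Sum>j\<in>UNIV. h j (x, y) * (F x $ j - F y $ j))"
    using injective_etale_diagonal[OF F grad det bij_is_inj[OF bij]] by blast
  have "\<forall>j. \<exists>ps. (\<forall>(u, w)\<in>set ps. u \<in> polyfuns coords) \<and> (\<forall>x y. h j (x, y) = (\<Sum>(u, w)\<leftarrow>ps. u x * w y))"
  proof
    fix j
    show "\<exists>ps. (\<forall>(u, w)\<in>set ps. u \<in> polyfuns coords) \<and> (\<forall>x y. h j (x, y) = (\<Sum>(u, w)\<leftarrow>ps. u x * w y))"
      by (rule polyfun_coords2_tensor[OF h(1)[of j]]) blast
  qed
  from choice[OF this] obtain ps where ps: "\<And>j u w. (u, w) \<in> set (ps j) \<Longrightarrow> u \<in> polyfuns coords"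
    "\<And>j x y. h j (x, y) = (\<Sum>(u, w)\<leftarrow>ps j. u x * w y)" by blast
  define L where "L = (SIGMA j:(UNIV::'n set). {..<length (ps j)})"
  \<comment> \<open>The value 0 outside \<open>L\<close> makes \<open>u l\<close> polynomial for
    every l, as \<open>eliminate_factors\<close> demands of its coefficients.\<close>
  define u where "u l = (if l \<in> L then fst (ps (fst l) ! snd l) else (\<lambda>_. 0))" for l
  define w where "w l = snd (ps (fst l) ! snd l)" for l
  have u: "u l \<in> polyfuns coords" for l
  proof (cases "l \<in> L")
    case True
    hence "(fst (ps (fst l) ! snd l), w l) \<in> set (ps (fst l))" by (auto simp: L_def w_def)
    thus ?thesis using ps(1) True by (simp add: u_def)
  qed (simp add: u_def polyfun_intros)
  have hsum: "h j (x, y) = (\<Sum>i<length (ps j). u (j, i) x * w (j, i) y)" for j x y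
  proof -
    have "h j (x, y) = (\<Sum>i<length (ps j). (\<lambda>(u, w). u x * w y) (ps j ! i))"
      unfolding ps(2) sum_list_sum_nth by (simp add: atLeast0LessThan)
    thus ?thesis by (simp add: u_def w_def L_def split_beta)
  qed
  define d where "d l x v = - 1 * (u l x * (F x $ fst l - v $ fst l))" for l x v
  have "\<exists>a b. a \<in> polyfuns coords \<and> b \<in> polyfuns coords \<and> (\<exists>v. a v \<noteq> 0) \<and> (\<forall>y. a (F y) * y $ k = b (F y))"
  proof (rule eliminate_factors[OF F bij_is_surj[OF bij], where L = L and d = d and w = w and z = 0
        and c = "\<lambda>x _. x $ k" and e = "\<lambda>_ _. - 1"])
    show "finite L" by (simp add: L_def)
    show "d l x \<in> polyfuns coords" for l x
      unfolding d_def by (intro polyfun_intros polyfun_coord)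
    fix x y
    have "x $ k - y $ k = (\<Sum>j\<in>UNIV. \<Sum>i<length (ps j). u (j, i) x * w (j, i) y * (F x $ j - F y $ j))"
      using h(2)[of x y] by (simp add: hsum sum_distrib_right)
    also have "\<dots> = (\<Sum>l\<in>L. u l x * w l y * (F x $ fst l - F y $ fst l))"
      unfolding L_def by (subst sum.Sigma) (auto simp: split_beta)
    finally have "x $ k - y $ k = (\<Sum>l\<in>L. u l x * w l y * (F x $ fst l - F y $ fst l))" .
    moreover have "(\<Sum>l\<in>L. d l x (F y) * w l y) = - (\<Sum>l\<in>L. u l x * w l y * (F x $ fst l - F y $ fst l))"
      unfolding d_def sum_negf[symmetric] by (intro sum.cong) (auto simp: algebra_simps)
    ultimately show "x $ k + - 1 * y $ k + (\<Sum>l\<in>L. d l x (F y) * w l y) = 0" by simp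
  qed (auto intro: polyfun_intros simp: d_def)
  thus ?thesis using that by blast
qed

section \<open>Regularity of the inverse\<close>

lemma poly_eqI_alg_closed:
  fixes p q :: "'b::alg_closed_field poly"
  assumes "\<And>t. poly p t = poly q t" shows "p = q"
proof -
  have "{t. poly (p - q) t = 0} = UNIV" using assms by auto
  hence "p - q = 0" using poly_roots_finite[of "p - q"] infinite_alg_closed_field by metis
  thus ?thesis by simp
qed

text \<open>A root of \<open>p\<close> is a root of \<open>q\<close> by the orders; splitting off
  its linear factor from both preserves the comparison of orders.\<close>

lemma poly_dvd_if_order_le:
  fixes p q :: "'b::alg_closed_field poly"
  assumes "p \<noteq> 0" "q \<noteq> 0" "\<And>t. order t p \<le> order t q"
  shows "p dvd q"
  using assms
proof (induction "degree p" arbitrary: p q)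
  case 0
  then obtain c where "p = [:c:]" "c \<noteq> 0" by (metis degree_eq_zeroE pCons_eq_0_iff)
  hence "q = p * smult (inverse c) q" by simp
  thus ?case by (rule dvdI)
next
  case (Suc n)
  then obtain t where t: "poly p t = 0" using alg_closed_imp_poly_has_root[of p] by auto
  then obtain p' where p': "p = [:-t, 1:] * p'" using poly_eq_0_iff_dvd by blast
  have "order t p \<noteq> 0" using t Suc.prems(1) order_root by blast
  hence "order t q \<noteq> 0" using Suc.prems(3)[of t] by linarith
  hence "poly q t = 0" by (metis order_root)
  then obtain q' where q': "q = [:-t, 1:] * q'" using poly_eq_0_iff_dvd by blast
  have nz: "p' \<noteq> 0" "q' \<noteq> 0" using p' q' Suc.prems by auto
  have "p' dvd q'"
  proof (rule Suc.hyps(1)[OF _ nz])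
    show "n = degree p'" using Suc.hyps(2) nz unfolding p' by (subst (asm) degree_mult_eq) auto
    show "order s p' \<le> order s q'" for s
      using Suc.prems(1,2) Suc.prems(3)[of s] unfolding p' q' by (simp add: order_mult del: mult_pCons_left)
  qed
  thus ?case unfolding p' q' by (rule mult_dvd_mono[OF dvd_refl])
qed

lemma polyfun_has_gradient:
  fixes f :: "'b::comm_ring_1 ^ 'n::finite \<Rightarrow> 'b"
  assumes "f \<in> polyfuns coords" shows "\<exists>D. has_gradient f D"
proof -
  obtain p where p: "\<And>x. f x = msubst (\<lambda>c. c) x p" using polyfun_coords_msubst[OF assms] by blast
  have "f = (\<lambda>x. msubst (\<lambda>c. c) x p)" using p by blast
  thus ?thesis using has_gradient_msubst[OF hom_on_ident] by metis
qed

section \<open>Polynomial curves and the lifting of lines\<close>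

lemma polyfun_coords_curve:
  fixes f :: "'b::comm_ring_1 ^ 'n::finite \<Rightarrow> 'b" and \<gamma> :: "'b \<Rightarrow> 'b ^ 'n"
  assumes "f \<in> polyfuns coords" "\<And>i. \<exists>p. \<forall>t. \<gamma> t $ i = poly p t"
  shows "\<exists>p. \<forall>t. f (\<gamma> t) = poly p t"
  by (rule polyfun_curve[OF assms(1)]) (use assms(2) in \<open>auto simp: coords_def\<close>)

lemma polyfun_coords2_curve:
  fixes f :: "('b::comm_ring_1 ^ 'n::finite) \<times> ('b ^ 'n) \<Rightarrow> 'b" and \<gamma> \<delta> :: "'b \<Rightarrow> 'b ^ 'n"
  assumes "f \<in> polyfuns coords2" "\<And>i. \<exists>p. \<forall>t. \<gamma> t $ i = poly p t" "\<And>i. \<exists>p. \<forall>t. \<delta> t $ i = poly p t"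
  shows "\<exists>p. \<forall>t. f (\<gamma> t, \<delta> t) = poly p t"
  by (rule polyfun_curve[OF assms(1), where \<gamma> = "\<lambda>t. (\<gamma> t, \<delta> t)"])
     (use assms(2,3) in \<open>auto simp: coords2_def\<close>)

text \<open>Newton's correction: adding \<open>t ^ Suc r\<close> times a vector z changes the lowest
  error coefficient by \<open>D x0 *v z\<close>, and invertibility of \<open>D x0\<close> lets it
  cancel. At every finite order the lift is a polynomial curve and can be substituted into
  polynomial functions.\<close>

lemma etale_lift_line:
  fixes F :: "'b::alg_closed_field ^ 'n::finite \<Rightarrow> 'b ^ 'n" and D :: "'b ^ 'n \<Rightarrow> 'b ^ 'n ^ 'n"
  assumes grad: "\<And>i. has_gradient (\<lambda>x. F x $ i) (\<lambda>x. D x $ i)" and det: "\<And>x. det (D x) \<noteq> 0"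
  shows "\<exists>\<gamma> q. \<gamma> 0 = x0 \<and> (\<forall>i. \<exists>p. \<forall>t. \<gamma> t $ i = poly p t) \<and>
     (\<forall>j t. F (\<gamma> t) $ j = F x0 $ j + t * w $ j + t ^ Suc r * poly (q j) t)"
proof (induction r)
  case 0
  show ?case
    \<comment> \<open>The constant curve misses the line by - t w, which is an error of order
      1.\<close>
    by (intro exI[of _ "\<lambda>_. x0"] exI[of _ "\<lambda>j. [:- (w $ j):]"] conjI allI exI[of _ "[:x0 $ i:]" for i]) auto
next
  case (Suc r)
  then obtain \<gamma> :: "'b \<Rightarrow> 'b ^ 'n" and q where \<gamma>: "\<gamma> 0 = x0" "\<And>i. \<exists>p. \<forall>t. \<gamma> t $ i = poly p t"
    "\<And>j t. F (\<gamma> t) $ j = F x0 $ j + t * w $ j + t ^ Suc r * poly (q j) t" by blast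
  have "invertible (D x0)" using det by (simp add: invertible_det_nz)
  then obtain E where E: "D x0 ** E = mat 1" unfolding invertible_def by blast
  define z where "z = E *v (\<chi> j. - poly (q j) 0)"
  have z: "(D x0 *v z) $ j = - poly (q j) 0" for j
    by (simp add: z_def matrix_vector_mul_assoc E)
  define \<gamma>' where "\<gamma>' t = \<gamma> t + t ^ Suc r *s z" for t
  have \<gamma>'0: "\<gamma>' 0 = x0" by (simp add: \<gamma>'_def \<gamma>)
  have \<gamma>': "\<exists>p. \<forall>t. \<gamma>' t $ i = poly p t" for i
  proof -
    obtain p where "\<forall>t. \<gamma> t $ i = poly p t" using \<gamma>(2) by blast
    thus ?thesis by (intro exI[of _ "p + monom (z $ i) (Suc r)"]) (simp add: \<gamma>'_def poly_monom mult_ac)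
  qed
  have "\<forall>j. \<exists>p. \<forall>t. F (\<gamma>' t) $ j = F x0 $ j + t * w $ j + t ^ Suc (Suc r) * poly p t"
  proof
    fix j
    obtain m where m: "\<And>l. m l \<in> polyfuns coords2"
      "\<And>x y. F x $ j - F y $ j = (\<Sum>l\<in>UNIV. m l (x, y) * (x $ l - y $ l))"
      "\<And>l x. m l (x, x) = D x $ j $ l"
      using grad[of j] unfolding has_gradient_def by blast
    have "\<forall>l. \<exists>p. \<forall>t. m l (\<gamma>' t, \<gamma> t) = poly p t"
      using polyfun_coords2_curve[OF m(1) \<gamma>' \<gamma>(2)] by blast
    from choice[OF this] obtain \<mu> where \<mu>: "\<And>l t. m l (\<gamma>' t, \<gamma> t) = poly (\<mu> l) t" by blast
    \<comment> \<open>After the correction, \<open>u\<close> is the error divided by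
      \<open>t ^ Suc r\<close>. It vanishes at 0, which gains one order.\<close>
    define u where "u = q j + (\<Sum>l\<in>UNIV. smult (z $ l) (\<mu> l))"
    have "poly u 0 = poly (q j) 0 + (\<Sum>l\<in>UNIV. D x0 $ j $ l * z $ l)"
      by (simp add: u_def poly_sum \<gamma>'0 \<gamma> m(3) mult.commute flip: \<mu>)
    also have "\<dots> = 0" using z[of j] by (simp add: matrix_vector_mult_def)
    finally obtain p where p: "u = [:0, 1:] * p" using poly_eq_0_iff_dvd[of u 0] by auto
    have "F (\<gamma>' t) $ j = F x0 $ j + t * w $ j + t ^ Suc (Suc r) * poly p t" for t
    proof -
      have "F (\<gamma>' t) $ j - F (\<gamma> t) $ j = t ^ Suc r * (\<Sum>l\<in>UNIV. z $ l * poly (\<mu> l) t)"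
        unfolding m(2) \<mu> by (simp add: \<gamma>'_def sum_distrib_left mult_ac)
      hence "F (\<gamma>' t) $ j = F x0 $ j + t * w $ j + t ^ Suc r * poly u t"
        using \<gamma>(3)[of t j] by (simp add: u_def poly_sum algebra_simps)
      thus ?thesis by (simp add: p mult_ac)
    qed
    thus "\<exists>p. \<forall>t. F (\<gamma>' t) $ j = F x0 $ j + t * w $ j + t ^ Suc (Suc r) * poly p t" by blast
  qed
  from choice[OF this] \<gamma>'0 \<gamma>' show ?case by blast
qed

text \<open>The divided differences of \<open>f\<close> are polynomial along the two curves, so the
  factor \<open>t ^ r\<close> of the difference of the curves passes to the values.\<close>

lemma curve_perturbation:
  fixes f :: "'b::comm_ring_1 ^ 'n::finite \<Rightarrow> 'b" and \<gamma> \<delta> :: "'b \<Rightarrow> 'b ^ 'n"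
  assumes f: "f \<in> polyfuns coords" and "\<And>i. \<exists>p. \<forall>t. \<gamma> t $ i = poly p t" "\<And>i. \<exists>p. \<forall>t. \<delta> t $ i = poly p t"
    and close: "\<And>i t. \<gamma> t $ i - \<delta> t $ i = t ^ r * poly (q i) t"
  shows "\<exists>p. \<forall>t. f (\<gamma> t) - f (\<delta> t) = t ^ r * poly p t"
proof -
  obtain m where m: "\<And>l. m l \<in> polyfuns coords2"
    "\<And>x y. f x - f y = (\<Sum>l\<in>UNIV. m l (x, y) * (x $ l - y $ l))"
    using polyfun_has_gradient[OF f] unfolding has_gradient_def by blast
  have "\<forall>l. \<exists>p. \<forall>t. m l (\<gamma> t, \<delta> t) = poly p t"
    using polyfun_coords2_curve[OF m(1) assms(2,3)] by blast
  from choice[OF this] obtain \<mu> where \<mu>: "\<And>l t. m l (\<gamma> t, \<delta> t) = poly (\<mu> l) t" by blast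
  show ?thesis
    by (intro exI[of _ "\<Sum>l\<in>UNIV. \<mu> l * q l"] allI, unfold m(2))
       (simp add: \<mu> close poly_sum sum_distrib_left mult_ac)
qed

text \<open>Multiplicities are compared at each zero \<open>t0\<close> of \<open>\<alpha>\<close>.
  The line is lifted through \<open>F\<close> up to the multiplicity \<open>Suc r\<close> of that
  zero. Along the lift, \<open>b\<close> is \<open>a\<close> times the polynomial
  \<open>\<gamma> t $ k\<close>, and returning to the line changes both values only by multiples of
  \<open>t ^ Suc r\<close>.\<close>

lemma dvd_along_line:
  fixes F :: "'b::alg_closed_field ^ 'n::finite \<Rightarrow> 'b ^ 'n" and D :: "'b ^ 'n \<Rightarrow> 'b ^ 'n ^ 'n"
  assumes F: "\<And>i. (\<lambda>x. F x $ i) \<in> polyfuns coords"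
    and grad: "\<And>i. has_gradient (\<lambda>x. F x $ i) (\<lambda>x. D x $ i)"
    and det: "\<And>x. det (D x) \<noteq> 0" and surj: "surj F"
    and a: "a \<in> polyfuns coords" and b: "b \<in> polyfuns coords"
    and ab: "\<And>y. a (F y) * y $ k = b (F y)"
    and \<alpha>: "\<And>t. a (v + t *s w) = poly \<alpha> t" "\<alpha> \<noteq> 0" and \<beta>: "\<And>t. b (v + t *s w) = poly \<beta> t"
  shows "\<alpha> dvd \<beta>"
proof (cases "\<beta> = 0")
  case False
  show ?thesis
  proof (rule poly_dvd_if_order_le[OF \<alpha>(2) False])
    fix t0
    show "order t0 \<alpha> \<le> order t0 \<beta>"
    proof (cases "order t0 \<alpha>")
      case (Suc r)
      have "[:- t0, 1:] ^ Suc r dvd \<alpha>" using Suc order_divides[of t0 "Suc r" \<alpha>] by simp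
      then obtain \<alpha>' where \<alpha>': "\<alpha> = [:- t0, 1:] ^ Suc r * \<alpha>'" by (rule dvdE)
      obtain x0 where x0: "F x0 = v + t0 *s w" using surj by (metis surjD)
      obtain \<gamma> :: "'b \<Rightarrow> 'b ^ 'n" and q where \<gamma>: "\<gamma> 0 = x0" "\<And>i. \<exists>p. \<forall>t. \<gamma> t $ i = poly p t"
        "\<And>j t. F (\<gamma> t) $ j = F x0 $ j + t * w $ j + t ^ Suc r * poly (q j) t"
        using etale_lift_line[OF grad det, of x0 w r] by blast
      define line where "line t = v + (t0 + t) *s w" for t
      have line: "\<exists>p. \<forall>t. line t $ i = poly p t" for i
        by (intro exI[of _ "[:v $ i + t0 * w $ i, w $ i:]"]) (simp add: line_def algebra_simps)
      have F\<gamma>: "\<exists>p. \<forall>t. F (\<gamma> t) $ i = poly p t" for i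
        by (rule polyfun_coords_curve[OF F \<gamma>(2)])
      have close: "F (\<gamma> t) $ i - line t $ i = t ^ Suc r * poly (q i) t" for i t
        by (simp add: \<gamma>(3) x0 line_def algebra_simps)
      obtain p1 where p1: "\<And>t. a (F (\<gamma> t)) - a (line t) = t ^ Suc r * poly p1 t"
        using curve_perturbation[OF a F\<gamma> line close] by blast
      obtain p2 where p2: "\<And>t. b (F (\<gamma> t)) - b (line t) = t ^ Suc r * poly p2 t"
        using curve_perturbation[OF b F\<gamma> line close] by blast
      obtain g where g: "\<And>t. \<gamma> t $ k = poly g t" using \<gamma>(2) by blast
      have aline: "a (line t) = t ^ Suc r * poly (\<alpha>' \<circ>\<^sub>p [:t0, 1:]) t" for t
        unfolding line_def \<alpha>(1) by (simp add: \<alpha>' poly_pcompose algebra_simps)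
      define s where "s = (p1 + \<alpha>' \<circ>\<^sub>p [:t0, 1:]) * g - p2"
      have "poly \<beta> (t0 + t) = t ^ Suc r * poly s t" for t
      proof -
        have "b (line t) = a (F (\<gamma> t)) * \<gamma> t $ k - t ^ Suc r * poly p2 t"
          using p2[of t] ab[of "\<gamma> t"] by (simp add: algebra_simps)
        also have "a (F (\<gamma> t)) = t ^ Suc r * poly p1 t + t ^ Suc r * poly (\<alpha>' \<circ>\<^sub>p [:t0, 1:]) t"
          using p1[of t] aline[of t] by (simp add: algebra_simps)
        also have "b (line t) = poly \<beta> (t0 + t)" unfolding line_def by (rule \<beta>)
        finally show ?thesis by (simp add: s_def g algebra_simps)
      qed
      hence "poly \<beta> t = poly ([:- t0, 1:] ^ Suc r * (s \<circ>\<^sub>p [:- t0, 1:])) t" for t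
        using \<open>\<And>t. poly \<beta> (t0 + t) = _\<close>[of "t - t0"] by (simp add: poly_pcompose left_diff_distrib)
      hence "\<beta> = [:- t0, 1:] ^ Suc r * (s \<circ>\<^sub>p [:- t0, 1:])" by (rule poly_eqI_alg_closed)
      hence "[:- t0, 1:] ^ Suc r dvd \<beta>" by (rule dvdI)
      thus ?thesis using Suc False order_divides[of t0 "Suc r" \<beta>] by simp
    qed simp
  qed
qed simp

section \<open>Expansion along the lines of a fixed direction\<close>

lemma hom_on_apply: "hom_on UNIV (\<lambda>f :: 'x \<Rightarrow> 'b::comm_ring_1. f v)"
  by (simp add: hom_on_def)

lemma hom_on_map_poly_apply: "hom_on UNIV (map_poly (\<lambda>f :: 'x \<Rightarrow> 'b::comm_ring_1. f v))"
  using hom_on_map_poly[OF unital_subring_UNIV hom_on_apply] by (simp add: polys_over_def)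

text \<open>The base point \<open>v\<close> stays a parameter, hidden in the coefficients of
  \<open>A\<close>, so that one division with remainder treats all parallel lines at once.\<close>

lemma polyfun_line_expansion:
  fixes f :: "'b::comm_ring_1 ^ 'n::finite \<Rightarrow> 'b"
  assumes "f \<in> polyfuns coords"
  shows "\<exists>A\<in>polys_over (polyfuns coords). \<forall>v t. f (v + t *s w) = poly (map_poly (\<lambda>f. f v) A) t"
  using assms
proof (induction rule: polyfun_induct)
  case (const c)
  have "[:(\<lambda>_. c):] \<in> polys_over (polyfuns coords)"
    by (intro const_in_polys_over unital_subring_polyfuns polyfun_intros)
  thus ?case by (intro bexI[of _ "[:(\<lambda>_. c):]"]) (auto simp: map_poly_pCons)
next
  case (gen f)
  then obtain i where f: "f = (\<lambda>x. x $ i)" by (auto simp: coords_def)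
  have "[:f, (\<lambda>_. w $ i):] \<in> polys_over (polyfuns coords)"
    using polyfun_intros(1)[of 0]
    by (auto simp: polys_over_def coeff_pCons f polyfun_coord polyfun_intros zero_fun_def split: nat.split)
  thus ?case by (intro bexI[of _ "[:f, (\<lambda>_. w $ i):]"]) (auto simp: map_poly_pCons f)
next
  case (add f g)
  then obtain A B where "A \<in> polys_over (polyfuns coords)" "B \<in> polys_over (polyfuns coords)"
    "\<forall>v t. f (v + t *s w) = poly (map_poly (\<lambda>f. f v) A) t" "\<forall>v t. g (v + t *s w) = poly (map_poly (\<lambda>f. f v) B) t"
    by blast
  thus ?case
    using unital_subringD(3)[OF unital_subring_polys_over[OF unital_subring_polyfuns]]
    by (intro bexI[of _ "A + B"]) (auto simp: hom_on_UNIV[OF hom_on_map_poly_apply])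
next
  case (mult f g)
  then obtain A B where "A \<in> polys_over (polyfuns coords)" "B \<in> polys_over (polyfuns coords)"
    "\<forall>v t. f (v + t *s w) = poly (map_poly (\<lambda>f. f v) A) t" "\<forall>v t. g (v + t *s w) = poly (map_poly (\<lambda>f. f v) B) t"
    by blast
  thus ?case
    using unital_subringD(5)[OF unital_subring_polys_over[OF unital_subring_polyfuns]]
    by (intro bexI[of _ "A * B"]) (auto simp: hom_on_UNIV[OF hom_on_map_poly_apply])
qed

text \<open>Only the direction contributes to the term in \<open>t ^ d\<close>, which is why its
  coefficient does not depend on \<open>v\<close>.\<close>

lemma mono_eval_line_expansion:
  fixes e :: "'n::finite \<Rightarrow>\<^sub>0 nat" and w :: "'b::comm_ring_1 ^ 'n"
  defines "d \<equiv> \<Sum>i\<in>UNIV. Poly_Mapping.lookup e i"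
  shows "\<exists>A\<in>polys_over (polyfuns coords). degree A \<le> d \<and> coeff A d = (\<lambda>_. mono_eval w e) \<and>
     (\<forall>v t. mono_eval (v + t *s w) e = poly (map_poly (\<lambda>f. f v) A) t)"
  unfolding d_def
proof (induction "\<Sum>i\<in>UNIV. Poly_Mapping.lookup e i" arbitrary: e)
  case 0
  hence "e = 0" by (intro poly_mapping_eqI) simp
  thus ?case
    using unital_subringD(2)[OF unital_subring_polys_over[OF unital_subring_polyfuns]]
    by (intro bexI[of _ 1]) (auto simp: one_fun_def hom_on_UNIV[OF hom_on_map_poly_apply])
next
  case (Suc n)
  then obtain i where i: "Poly_Mapping.lookup e i > 0"
    by (metis gr0I nat.distinct(1) sum.neutral)
  define e' where "e' = e - Poly_Mapping.single i 1"
  have e: "e = e' + Poly_Mapping.single i 1"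
    using i by (intro poly_mapping_eqI) (auto simp: e'_def lookup_add lookup_minus lookup_single when_def)
  have "(\<Sum>i\<in>UNIV. Poly_Mapping.lookup e i) = (\<Sum>i\<in>UNIV. Poly_Mapping.lookup e' i) + 1"
    by (subst e) (simp add: lookup_add sum.distrib lookup_single when_def)
  hence n: "n = (\<Sum>i\<in>UNIV. Poly_Mapping.lookup e' i)" using Suc.hyps(2) by simp
  obtain A where A: "A \<in> polys_over (polyfuns coords)" "degree A \<le> n" "coeff A n = (\<lambda>_. mono_eval w e')"
    "\<And>v t. mono_eval (v + t *s w) e' = poly (map_poly (\<lambda>f. f v) A) t"
    using Suc.hyps(1)[OF n] n by auto
  define L where "L = [:(\<lambda>x :: 'b ^ 'n. x $ i), (\<lambda>_. w $ i):]"
  have L: "L \<in> polys_over (polyfuns coords)"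
    using polyfun_intros(1)[of 0]
    by (auto simp: L_def polys_over_def coeff_pCons polyfun_coord polyfun_intros zero_fun_def split: nat.split)
  have evL: "poly (map_poly (\<lambda>f. f v) L) t = v $ i + t * w $ i" for v t
    by (simp add: L_def map_poly_pCons)
  have mono: "mono_eval x e = x $ i * mono_eval x e'" for x :: "'b ^ 'n"
    by (subst e) (simp add: mono_eval_add mono_eval_single mult.commute)
  show ?case
    unfolding Suc.hyps(2)[symmetric]
  proof (intro bexI[of _ "L * A"] conjI allI)
    show "L * A \<in> polys_over (polyfuns coords)"
      using unital_subringD(5)[OF unital_subring_polys_over[OF unital_subring_polyfuns]] L A(1) by blast
    have "degree L \<le> 1" by (simp add: L_def)
    thus "degree (L * A) \<le> Suc n" using degree_mult_le[of L A] A(2) by linarith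
    have "coeff A (Suc n) = 0" using A(2) by (intro coeff_eq_0) auto
    hence "coeff (L * A) (Suc n) x = mono_eval w e" for x
      by (simp add: L_def A(3) mono)
    thus "coeff (L * A) (Suc n) = (\<lambda>_. mono_eval w e)" by blast
    show "mono_eval (v + t *s w) e = poly (map_poly (\<lambda>f. f v) (L * A)) t" for v t
      by (simp add: mono hom_on_UNIV[OF hom_on_map_poly_apply] evL A(4))
  qed
qed

text \<open>The coefficient of \<open>t ^ d\<close> in \<open>a (v + t *s w)\<close> is the
  homogeneous part of top degree evaluated at \<open>w\<close>. That part is a nonzero polynomial,
  so it is nonzero at some \<open>w\<close>.\<close>

lemma exists_monic_direction:
  fixes a :: "'b::alg_closed_field ^ 'n::finite \<Rightarrow> 'b"
  assumes a: "a \<in> polyfuns coords" "a v0 \<noteq> 0"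
  obtains w A d c where "A \<in> polys_over (polyfuns coords)" "degree A \<le> d" "coeff A d = (\<lambda>_. c)" "c \<noteq> 0"
    "\<And>v t. a (v + t *s w) = poly (map_poly (\<lambda>f. f v) A) t"
proof -
  obtain p where p: "\<And>x. a x = msubst (\<lambda>c. c) x p" using polyfun_coords_msubst[OF a(1)] by blast
  define K where "K = Poly_Mapping.keys p"
  define deg where "deg e = (\<Sum>i\<in>UNIV. Poly_Mapping.lookup e i)" for e :: "'n \<Rightarrow>\<^sub>0 nat"
  define d where "d = Max (deg ` K)"
  have "K \<noteq> {}" using a(2) p by (auto simp: K_def)
  have fK: "finite K" by (simp add: K_def)
  have le_d: "deg e \<le> d" if "e \<in> K" for e using that fK by (simp add: d_def)
  have "d \<in> deg ` K" unfolding d_def using fK \<open>K \<noteq> {}\<close> by (intro Max_in) auto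
  then obtain e0 where e0: "e0 \<in> K" "deg e0 = d" by blast
  define top where "top = (\<Sum>e\<in>{e\<in>K. deg e = d}. Poly_Mapping.single e (Poly_Mapping.lookup p e))"
  have "Poly_Mapping.lookup top e0 = (\<Sum>e\<in>{e\<in>K. deg e = d}. if e = e0 then Poly_Mapping.lookup p e else 0)"
    unfolding top_def lookup_sum by (intro sum.cong) (auto simp: lookup_single when_def)
  also have "\<dots> = Poly_Mapping.lookup p e0"
    using e0 fK by (simp add: sum.delta)
  finally have "top \<noteq> 0" using e0 by (auto simp: K_def in_keys_iff)
  then obtain w where w: "msubst (\<lambda>c. c) w top \<noteq> 0"
    using msubst_eq_0_imp[OF hom_on_ident, of top] by auto
  have "\<forall>e. \<exists>A. A \<in> polys_over (polyfuns coords) \<and> degree A \<le> deg e \<and> coeff A (deg e) = (\<lambda>_. mono_eval w e) \<and>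
     (\<forall>v t. mono_eval (v + t *s w) e = poly (map_poly (\<lambda>f. f v) A) t)"
    using mono_eval_line_expansion[of _ w] unfolding deg_def by blast
  from choice[OF this] obtain A where A: "\<And>e. A e \<in> polys_over (polyfuns coords)" "\<And>e. degree (A e) \<le> deg e"
    "\<And>e. coeff (A e) (deg e) = (\<lambda>_. mono_eval w e)"
    "\<And>e v t. mono_eval (v + t *s w) e = poly (map_poly (\<lambda>f. f v) (A e)) t" by blast
  note Q = unital_subringD[OF unital_subring_polys_over[OF unital_subring_polyfuns[of coords]]]
  define c where "c e = [:(\<lambda>_ :: 'b ^ 'n. Poly_Mapping.lookup p e):]" for e
  define A' where "A' = (\<Sum>e\<in>K. c e * A e)"
  show ?thesis
  proof (rule that[of A' d "msubst (\<lambda>c. c) w top" w])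
    show "A' \<in> polys_over (polyfuns coords)"
      unfolding A'_def c_def
      by (intro Q(8) Q(5) A const_in_polys_over[OF unital_subring_polyfuns] polyfun_intros)
    show "degree A' \<le> d"
      unfolding A'_def
    proof (rule degree_sum_le[OF fK])
      fix e assume "e \<in> K"
      have "degree (c e * A e) \<le> degree (c e) + degree (A e)" by (rule degree_mult_le)
      thus "degree (c e * A e) \<le> d" using A(2)[of e] le_d[OF \<open>e \<in> K\<close>] by (simp add: c_def)
    qed
    have "coeff (c e * A e) d x = (if deg e = d then Poly_Mapping.lookup p e * mono_eval w e else 0)"
      if "e \<in> K" for e x
    proof (cases "deg e = d")
      case True
      thus ?thesis using A(3)[of e] by (simp add: c_def)
    next
      case False
      hence "coeff (A e) d = 0" using A(2)[of e] le_d[OF that] by (intro coeff_eq_0) linarith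
      thus ?thesis using False by (simp add: c_def)
    qed
    hence "coeff A' d x = msubst (\<lambda>c. c) w top" for x
      using fK by (simp add: A'_def top_def coeff_sum sum_fun_apply msubst_sum[OF hom_on_ident]
          msubst_single sum.inter_filter if_distrib[of "msubst (\<lambda>c. c) w"] cong: if_cong)
    thus "coeff A' d = (\<lambda>_. msubst (\<lambda>c. c) w top)" by blast
    show "msubst (\<lambda>c. c) w top \<noteq> 0" by (rule w)
    fix v t
    have evc: "map_poly (\<lambda>f. f v) (c e) = [:Poly_Mapping.lookup p e:]" for e
      by (simp add: c_def map_poly_pCons)
    have "a (v + t *s w) = (\<Sum>e\<in>K. Poly_Mapping.lookup p e * mono_eval (v + t *s w) e)"
      by (simp add: p K_def msubst_def mono_eval_def)
    also have "\<dots> = poly (map_poly (\<lambda>f. f v) A') t"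
      by (simp add: A'_def hom_on_UNIV[OF hom_on_map_poly_apply] poly_sum A(4) evc)
    finally show "a (v + t *s w) = poly (map_poly (\<lambda>f. f v) A') t" .
  qed
qed

theorem bijective_etale_inverse:
  fixes F :: "'b::alg_closed_field ^ 'n::finite \<Rightarrow> 'b ^ 'n" and D :: "'b ^ 'n \<Rightarrow> 'b ^ 'n ^ 'n"
  assumes F: "\<And>i. (\<lambda>x. F x $ i) \<in> polyfuns coords"
    and grad: "\<And>i. has_gradient (\<lambda>x. F x $ i) (\<lambda>x. D x $ i)"
    and det: "\<And>x. det (D x) \<noteq> 0" and bij: "bij F"
  shows "\<exists>g\<in>polyfuns coords. \<forall>y. y $ k = g (F y)"
proof -
  obtain a b where a: "a \<in> polyfuns coords" "\<exists>v. a v \<noteq> 0" and b: "b \<in> polyfuns coords"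
    and ab: "\<And>y. a (F y) * y $ k = b (F y)"
    using bijective_etale_birational[OF F grad det bij] by metis
  obtain v0 where v0: "a v0 \<noteq> 0" using a by blast
  obtain w A d c where A: "A \<in> polys_over (polyfuns coords)" "degree A \<le> d" "coeff A d = (\<lambda>_. c)" "c \<noteq> 0"
    "\<And>v t. a (v + t *s w) = poly (map_poly (\<lambda>f. f v) A) t"
    using exists_monic_direction[OF a(1) v0] by metis
  obtain B where B: "B \<in> polys_over (polyfuns coords)"
    "\<And>v t. b (v + t *s w) = poly (map_poly (\<lambda>f. f v) B) t"
    using polyfun_line_expansion[OF b, of w] by blast
  have coeffA: "coeff (map_poly (\<lambda>f. f v) A) d = c" for v using A(3) by (simp add: coeff_map_poly)
  obtain g where g: "g \<in> polyfuns coords" "\<And>v. b v = a v * g v"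
  proof (cases "d = 0")
    case True
    \<comment> \<open>Here a is constant and b / a is visibly polynomial;
      \<open>pseudo_division\<close> asks for d > 0.\<close>
    have "a v = c" for v
    proof -
      have "a v = poly (map_poly (\<lambda>f. f v) A) 0" using A(5)[of v 0] by simp
      thus ?thesis using coeffA[of v] True by (simp add: poly_0_coeff_0)
    qed
    moreover have "(\<lambda>v. inverse c * b v) \<in> polyfuns coords" by (intro polyfun_intros b)
    ultimately show ?thesis using that[of "\<lambda>v. inverse c * b v"] A(4) by simp
  next
    case False
    obtain r H Q where HQ: "H \<in> polys_over (polyfuns coords)" "Q \<in> polys_over (polyfuns coords)"
      "smult (coeff A d ^ r) B = H * A + Q" "degree Q < d"
      using pseudo_division[OF unital_subring_polyfuns A(1) B(1) A(2)] False by blast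
    have H0: "coeff H 0 \<in> polyfuns coords" using HQ(1) by (simp add: polys_over_def)
    have eq: "c ^ r * b v = coeff H 0 v * a v" for v
    proof -
      let ?ev = "map_poly (\<lambda>f :: 'b ^ 'n \<Rightarrow> 'b. f v)"
      note ev = hom_on_UNIV[OF hom_on_map_poly_apply[of v]]
      have "[:coeff A d ^ r:] * B = H * A + Q" using HQ(3) by simp
      hence "?ev ([:coeff A d ^ r:] * B) = ?ev (H * A + Q)" by simp
      hence *: "[:c ^ r:] * ?ev B = ?ev H * ?ev A + ?ev Q"
        by (simp add: ev map_poly_pCons A(3) hom_on_UNIV[OF hom_on_apply] del: mult_pCons_left)
      \<comment> \<open>As \<open>c\<close> is the same for all \<open>v\<close>, no line in
        direction \<open>w\<close> lies in the zero set of \<open>a\<close>.\<close>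
      have evA: "?ev A \<noteq> 0" using coeffA[of v] A(4) by auto
      have "?ev A dvd ?ev B"
        by (rule dvd_along_line[OF F grad det bij_is_surj[OF bij] a(1) b ab A(5) evA B(2)])
      hence "?ev A dvd [:c ^ r:] * ?ev B - ?ev H * ?ev A" by (intro dvd_diff dvd_mult) auto
      hence dvd: "?ev A dvd ?ev Q" using * by simp
      \<comment> \<open>The expansion of \<open>a\<close> at \<open>v\<close> has degree at least
        \<open>d\<close>, more than the remainder that it divides.\<close>
      have "?ev Q = 0"
      proof (rule ccontr)
        assume "?ev Q \<noteq> 0"
        hence "degree (?ev A) \<le> degree (?ev Q)" using dvd dvd_imp_degree_le by blast
        moreover have "degree (?ev Q) \<le> degree Q" by (rule map_poly_degree_leq)
        moreover have "d \<le> degree (?ev A)" using coeffA[of v] A(4) by (intro le_degree) simp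
        ultimately show False using HQ(4) by linarith
      qed
      \<comment> \<open>At t = 0 the division becomes an identity in \<open>v\<close> alone: up to
        c^r, the constant coefficient of \<open>H\<close> is the quotient.\<close>
      hence "poly ([:c ^ r:] * ?ev B) 0 = poly (?ev H * ?ev A) 0" using * by simp
      hence "c ^ r * b v = poly (?ev H) 0 * a v" using A(5)[of v 0] B(2)[of v 0] by simp
      thus ?thesis by (simp add: poly_0_coeff_0 coeff_map_poly)
    qed
    have "(\<lambda>v. inverse (c ^ r) * coeff H 0 v) \<in> polyfuns coords" by (intro polyfun_intros H0)
    moreover have "b v = a v * (inverse (c ^ r) * coeff H 0 v)" for v
    proof -
      have "b v = inverse (c ^ r) * (c ^ r * b v)" using A(4) by simp
      also have "\<dots> = a v * (inverse (c ^ r) * coeff H 0 v)" unfolding eq by (simp only: mult_ac)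
      finally show ?thesis .
    qed
    ultimately show ?thesis using that by blast
  qed
  have aF: "(\<lambda>y. a (F y)) \<in> polyfuns coords" by (rule polyfun_compose_coords[OF a(1) F])
  have diff: "(\<lambda>y. y $ k - g (F y)) \<in> polyfuns coords"
    by (intro polyfun_intros polyfun_coord polyfun_compose_coords[OF g(1) F])
  obtain y0 where y0: "v0 = F y0" using bij by (metis bij_pointE)
  \<comment> \<open>The difference of both sides is killed by \<open>a (F y)\<close>, which is not
    identically zero.\<close>
  have "y $ k = g (F y)" for y
  proof (rule ccontr)
    assume "y $ k \<noteq> g (F y)"
    then obtain z where "a (F z) \<noteq> 0" "z $ k - g (F z) \<noteq> 0"
      using polyfun_no_zero_divisors[OF aF diff, of y0 y] v0 y0 by auto
    moreover have "a (F z) * (z $ k - g (F z)) = 0" using ab[of z] g(2)[of "F z"] by (simp add: right_diff_distrib)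
    ultimately show False by simp
  qed
  thus ?thesis using g(1) by blast
qed

section \<open>Points over finite fields\<close>

lemma power_CARD_power_add:
  fixes x y :: "'a::finite_field alg_closure"
  shows "(x + y) ^ (CARD('a) ^ m) = x ^ (CARD('a) ^ m) + y ^ (CARD('a) ^ m)"
proof (induction m)
  case (Suc m)
  have "(x + y) ^ (CARD('a) ^ Suc m) = ((x + y) ^ (CARD('a) ^ m)) ^ CARD('a)"
    by (simp add: mult.commute flip: power_mult)
  also have "\<dots> = x ^ (CARD('a) ^ Suc m) + y ^ (CARD('a) ^ Suc m)"
    by (simp add: Suc.IH power_CARD_add mult.commute flip: power_mult)
  finally show ?case .
qed simp

lemma hom_on_frobenius: "hom_on UNIV (\<lambda>x :: 'a::finite_field alg_closure. x ^ (CARD('a) ^ m))"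
  by (simp add: hom_on_def power_CARD_power_add power_mult_distrib)

lemma frobenius_inject:
  fixes x y :: "'a::finite_field alg_closure"
  assumes "x ^ (CARD('a) ^ m) = y ^ (CARD('a) ^ m)" shows "x = y"
proof -
  have "(x - y) ^ (CARD('a) ^ m) = 0"
    using hom_on_UNIV(9)[OF hom_on_frobenius[of m], of x y] assms by simp
  thus ?thesis by simp
qed

text \<open>The coefficients of \<open>F\<close> are fixed by the power map. This gives the
  stability of the points of degree \<open>m\<close> and, with \<open>m = 1\<close>, the descent of
  the inverse.\<close>

lemma pmap_eval_frobenius:
  fixes F :: "('a::finite_field, 'n::finite) pmap"
  shows "pmap_eval F (\<chi> i. (x $ i) ^ (CARD('a) ^ m)) $ j = (pmap_eval F x $ j) ^ (CARD('a) ^ m)"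
proof -
  have "(to_ac c :: 'a alg_closure) ^ (CARD('a) ^ m) = to_ac c" for c
    using to_ac_in_ext_field[of c m] by (simp add: ext_field_def)
  thus ?thesis
    by (simp add: pmap_eval_def hom_on_msubst_commute[OF hom_on_frobenius])
qed

lemma pmap_eval_ext_points:
  fixes F :: "('a::finite_field, 'n::finite) pmap"
  assumes "x \<in> ext_points m" shows "pmap_eval F x \<in> ext_points m"
proof -
  have "(\<chi> i. (x $ i) ^ (CARD('a) ^ m)) = x"
    using assms by (simp add: ext_points_def ext_field_def vec_eq_iff)
  thus ?thesis
    using pmap_eval_frobenius[of F x m] by (simp add: ext_points_def ext_field_def)
qed

lemma finite_ext_points:
  assumes "m > 0" shows "finite (ext_points m :: ('a::finite_field alg_closure ^ 'n::finite) set)"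
proof -
  have "card (ext_field m :: 'a alg_closure set) > 0" using card_ext_field[OF assms, where 'a = 'a] by simp
  hence "finite (ext_field m :: 'a alg_closure set)" using card_gt_0_iff by blast
  hence "finite (PiE (UNIV :: 'n set) (\<lambda>_. ext_field m :: 'a alg_closure set))" by (intro finite_PiE) auto
  moreover have "ext_points m \<subseteq> vec_lambda ` (PiE (UNIV :: 'n set) (\<lambda>_. ext_field m :: 'a alg_closure set))"
  proof
    fix x :: "'a alg_closure ^ 'n" assume "x \<in> ext_points m"
    hence "($) x \<in> PiE UNIV (\<lambda>_. ext_field m)" by (auto simp: ext_points_def)
    thus "x \<in> vec_lambda ` PiE UNIV (\<lambda>_. ext_field m)"
      by (intro image_eqI[of _ _ "($) x"]) auto
  qed
  ultimately show ?thesis by (rule finite_surj)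
qed

section \<open>The closure as a union of finite fields\<close>

lemma ext_field_mult: "x \<in> ext_field m \<Longrightarrow> x \<in> ext_field (m * k)"
proof (induction k)
  case (Suc k)
  thus ?case by (simp add: ext_field_def power_add power_mult)
\<comment> \<open>For \<open>k = 0\<close> the target \<open>ext_field 0\<close> is the whole
  closure.\<close>
qed (simp add: ext_field_def)

lemma ext_points_mult: "x \<in> ext_points m \<Longrightarrow> x \<in> ext_points (m * k)"
  by (simp add: ext_points_def ext_field_mult)

lemma finite_degree_le: "finite {p :: 'a::{finite,zero} poly. degree p \<le> n}"
proof (rule finite_surj)
  show "finite {xs :: 'a list. set xs \<subseteq> UNIV \<and> length xs \<le> Suc n}" by (rule finite_lists_length_le) auto
  show "{p :: 'a poly. degree p \<le> n} \<subseteq> Poly ` {xs. set xs \<subseteq> UNIV \<and> length xs \<le> Suc n}"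
  proof
    fix p :: "'a poly" assume "p \<in> {p. degree p \<le> n}"
    hence "length (coeffs p) \<le> Suc n" by (cases "p = 0") (auto simp: length_coeffs_degree)
    thus "p \<in> Poly ` {xs. set xs \<subseteq> UNIV \<and> length xs \<le> Suc n}"
      by (intro image_eqI[of _ _ "coeffs p"]) auto
  qed
qed

text \<open>Reduction modulo an annihilating polynomial confines all powers of \<open>x\<close> to a
  finite set, so two iterates of Frobenius agree at \<open>x\<close>; injectivity of Frobenius
  cancels the smaller one.\<close>

lemma exists_ext_field:
  fixes x :: "'a::finite_field alg_closure"
  shows "\<exists>m>0. x \<in> ext_field m"
proof -
  obtain p where p: "p \<noteq> 0" "poly (map_poly to_ac p) x = 0" by (rule alg_closure_algebraic)
  have "hom_on UNIV (map_poly (to_ac :: 'a \<Rightarrow> _))"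
    using hom_on_map_poly[OF unital_subring_UNIV hom_on_to_ac] by (simp add: polys_over_def)
  note h = hom_on_UNIV[OF this]
  define V where "V = (\<lambda>r. poly (map_poly to_ac r) x) ` {r. degree r \<le> degree p}"
  have "finite V" unfolding V_def by (intro finite_imageI finite_degree_le)
  have "x ^ n \<in> V" for n
  proof -
    define r where "r = monom 1 n mod p"
    have "degree r \<le> degree p"
      using degree_mod_less[OF p(1), of "monom 1 n"] by (auto simp: r_def)
    moreover have "poly (map_poly to_ac r) x = x ^ n"
    proof -
      have "monom 1 n = (monom 1 n div p) * p + r" by (simp add: r_def)
      hence "poly (map_poly to_ac (monom 1 n)) x = poly (map_poly to_ac ((monom 1 n div p) * p + r)) x"
        by (rule arg_cong)
      thus ?thesis by (simp add: h p map_poly_monom poly_monom)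
    qed
    ultimately show ?thesis unfolding V_def by (metis (mono_tags, lifting) image_eqI mem_Collect_eq)
  qed
  hence "range (\<lambda>i. x ^ (CARD('a) ^ i)) \<subseteq> V" by blast
  hence "finite (range (\<lambda>i. x ^ (CARD('a) ^ i)))" using \<open>finite V\<close> finite_subset by blast
  hence "\<not> inj (\<lambda>i. x ^ (CARD('a) ^ i))" using finite_imageD infinite_UNIV_nat by blast
  then obtain i j where ij: "i < j" "x ^ (CARD('a) ^ i) = x ^ (CARD('a) ^ j)"
    unfolding inj_def by (metis linorder_neqE_nat)
  have "x ^ (CARD('a) ^ j) = x ^ (CARD('a) ^ ((j - i) + i))" using ij(1) by simp
  also have "\<dots> = (x ^ (CARD('a) ^ (j - i))) ^ (CARD('a) ^ i)" by (simp only: power_add power_mult)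
  finally have "x = x ^ (CARD('a) ^ (j - i))" using ij(2) frobenius_inject by metis
  thus ?thesis using ij(1) by (intro exI[of _ "j - i"]) (simp add: ext_field_def)
qed

lemma finite_subset_ext_field:
  fixes A :: "'a::finite_field alg_closure set"
  assumes "finite A" shows "\<exists>m>0. A \<subseteq> ext_field m"
  using assms
proof (induction A rule: finite_induct)
  case (insert x A)
  then obtain m where m: "m > 0" "A \<subseteq> ext_field m" by blast
  obtain k where k: "k > 0" "x \<in> ext_field k" using exists_ext_field by blast
  have "insert x A \<subseteq> ext_field (m * k)"
    using m k ext_field_mult[of _ m k] ext_field_mult[of x k m] by (auto simp: mult.commute)
  thus ?case using m k by (intro exI[of _ "m * k"]) auto
qed auto

lemma exists_ext_points:
  fixes x y :: "'a::finite_field alg_closure ^ 'n::finite"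
  obtains m where "m > 0" "x \<in> ext_points m" "y \<in> ext_points m"
proof -
  obtain m where "m > 0" "range (($) x) \<union> range (($) y) \<subseteq> ext_field m"
    using finite_subset_ext_field[of "range (($) x) \<union> range (($) y)"] by auto
  thus ?thesis using that[of m] by (auto simp: ext_points_def)
qed

section \<open>Degrees of bijectivity\<close>

lemma bijective_degrees_divisor:
  fixes F :: "('a::finite_field, 'n::finite) pmap"
  assumes "m * k \<in> bijective_degrees F" "m > 0"
  shows "m \<in> bijective_degrees F"
proof -
  have "inj_on (pmap_eval F) (ext_points (m * k))"
    using assms(1) by (simp add: bijective_degrees_def bij_betw_def)
  hence inj: "inj_on (pmap_eval F) (ext_points m)"
    by (rule inj_on_subset) (auto intro: ext_points_mult)
  have "pmap_eval F ` ext_points m = ext_points m"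
    by (rule endo_inj_surj[OF finite_ext_points[OF assms(2)] _ inj]) (auto intro: pmap_eval_ext_points)
  thus ?thesis using inj assms(2) by (simp add: bijective_degrees_def bij_betw_def)
qed

lemma cofinite_bijective_degrees:
  assumes "cofinite_pos (bijective_degrees F)"
  shows "bijective_degrees F = {0<..}"
proof (intro equalityI subsetI)
  fix m :: nat assume "m \<in> {0<..}"
  hence m: "m > 0" by simp
  obtain N where N: "\<And>n. n \<in> {0<..} - bijective_degrees F \<Longrightarrow> n \<le> N"
    using assms finite_nat_set_iff_bounded_le unfolding cofinite_pos_def by meson
  \<comment> \<open>A multiple of \<open>m\<close> beyond all exceptional degrees.\<close>
  have "m * Suc N > N" using m by (cases m) auto
  hence "m * Suc N \<in> bijective_degrees F" using N[of "m * Suc N"] by force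
  thus "m \<in> bijective_degrees F" using m bijective_degrees_divisor by blast
qed (simp add: bijective_degrees_def)

text \<open>The inverse has its coefficients in the finite field too, so it preserves the points of
  every degree and inverts \<open>F\<close> there.\<close>

lemma polynomial_automorphism_bijective_degrees:
  assumes "polynomial_automorphism F" shows "bijective_degrees F = {0<..}"
proof -
  obtain G where G: "pmap_comp F G = pmap_id" "pmap_comp G F = pmap_id"
    using assms by (auto simp: polynomial_automorphism_def)
  have "pmap_eval F (pmap_eval G x) = x" "pmap_eval G (pmap_eval F x) = x" for x
    using G by (simp_all add: pmap_eval_id flip: pmap_eval_comp)
  hence "bij_betw (pmap_eval F) (ext_points m) (ext_points m)" for m
    by (intro bij_betw_byWitness[of _ "pmap_eval G"]) (auto intro: pmap_eval_ext_points)
  thus ?thesis by (auto simp: bijective_degrees_def)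
qed

text \<open>Injectivity concerns two points and surjectivity one, and finitely many points lie over
  a common finite extension.\<close>

lemma bij_pmap_eval:
  fixes F :: "('a::finite_field, 'n::finite) pmap"
  assumes "bijective_degrees F = {0<..}" shows "bij (pmap_eval F)"
proof (rule bijI)
  have bij: "bij_betw (pmap_eval F) (ext_points m) (ext_points m)" if "m > 0" for m
    using assms that unfolding bijective_degrees_def by blast
  show "inj (pmap_eval F)"
  proof (rule injI)
    fix x y assume eq: "pmap_eval F x = pmap_eval F y"
    obtain m where m: "m > 0" "x \<in> ext_points m" "y \<in> ext_points m" by (rule exists_ext_points)
    show "x = y" using bij_betw_imp_inj_on[OF bij[OF m(1)]] m eq by (auto dest: inj_onD)
  qed
  show "surj (pmap_eval F)"
    unfolding surj_def
  proof
    fix y :: "'a alg_closure ^ 'n"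
    obtain m where m: "m > 0" "y \<in> ext_points m" "y \<in> ext_points m" by (rule exists_ext_points)
    thus "\<exists>x. y = pmap_eval F x" using bij_betw_imp_surj_on[OF bij[OF m(1)]] by blast
  qed
qed

section \<open>Descent of the inverse to the finite field\<close>

lemma hom_on_det:
  fixes A :: "'r::comm_ring_1 ^ 'n::finite ^ 'n" and h :: "'r \<Rightarrow> 's::comm_ring_1"
  assumes "hom_on UNIV h" shows "h (det A) = det (\<chi> i j. h (A $ i $ j))"
proof -
  note h = hom_on_UNIV[OF assms]
  have "h (of_int z) = of_int z" for z by (cases z rule: int_cases2) (simp_all add: h)
  thus ?thesis by (simp add: det_def h)
qed

text \<open>X^q - X has exactly q roots, and the q elements of the finite field are among
  them.\<close>

lemma ext_field_1: "ext_field 1 = range (to_ac :: 'a::finite_field \<Rightarrow> _)"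
proof (rule sym, rule card_subset_eq)
  have "card (ext_field 1 :: 'a alg_closure set) = CARD('a)" using card_ext_field[of 1, where 'a = 'a] by simp
  thus "card (range (to_ac :: 'a \<Rightarrow> _)) = card (ext_field 1 :: 'a alg_closure set)"
    by (simp add: card_image inj_to_ac)
  show "finite (ext_field 1 :: 'a alg_closure set)"
    using \<open>card (ext_field 1 :: 'a alg_closure set) = CARD('a)\<close> by (intro card_ge_0_finite) simp
qed (auto intro: to_ac_in_ext_field)

lemma lookup_map_zero: "f 0 = 0 \<Longrightarrow> Poly_Mapping.lookup (Poly_Mapping.map f p) e = f (Poly_Mapping.lookup p e)"
  by (simp add: map.rep_eq when_def)

lemma msubst_map:
  assumes "f 0 = 0" "\<phi> 0 = 0" "\<And>e. \<phi> (f (Poly_Mapping.lookup p e)) = \<psi> (Poly_Mapping.lookup p e)" "\<psi> 0 = 0"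
  shows "msubst \<phi> x (Poly_Mapping.map f p) = msubst \<psi> x p"
proof -
  have "Poly_Mapping.keys (Poly_Mapping.map f p) \<subseteq> Poly_Mapping.keys p"
    using assms(1) by (auto simp: in_keys_iff lookup_map_zero)
  thus ?thesis
    using assms by (simp add: msubst_superset[OF finite_keys[of p]] lookup_map_zero)
qed

text \<open>The polynomial and its conjugate by Frobenius on the coefficients agree at all
  componentwise q-th powers. These are all points, because the closure has q-th roots, so every
  coefficient is fixed by Frobenius.\<close>

lemma frobenius_equivariant_descends:
  fixes g :: "'a::finite_field alg_closure ^ 'n::finite \<Rightarrow> 'a alg_closure"
  assumes g: "g \<in> polyfuns coords" and equiv: "\<And>v. g (\<chi> i. (v $ i) ^ CARD('a)) = g v ^ CARD('a)"
  obtains p :: "('a, 'n) mpoly" where "\<And>v. g v = msubst to_ac v p"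
proof -
  let ?frob = "\<lambda>x :: 'a alg_closure. x ^ CARD('a)"
  have hom: "hom_on UNIV ?frob" using hom_on_frobenius[of 1, where 'a = 'a] by simp
  have q: "CARD('a) > 0" by simp
  obtain r where r: "\<And>v. g v = msubst (\<lambda>c. c) v r" using polyfun_coords_msubst[OF g] by blast
  have "Poly_Mapping.map ?frob r = r"
  proof (rule msubst_inject[OF hom_on_ident inj_on_id2])
    fix x :: "'a alg_closure ^ 'n"
    have "\<forall>i. \<exists>y. y ^ CARD('a) = x $ i" using nth_root_exists[OF q] by metis
    from choice[OF this] obtain y where y: "\<And>i. y i ^ CARD('a) = x $ i" by blast
    define v where "v = (\<chi> i. y i)"
    have x: "x = (\<chi> i. ?frob (v $ i))" by (simp add: v_def y vec_eq_iff)
    have "msubst (\<lambda>c. c) x (Poly_Mapping.map ?frob r) = msubst ?frob x r"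
      by (rule msubst_map) (use q in auto)
    also have "\<dots> = ?frob (msubst (\<lambda>c. c) v r)"
      unfolding x by (simp add: hom_on_msubst_commute[OF hom])
    also have "\<dots> = msubst (\<lambda>c. c) x r" using equiv[of v] unfolding r x by simp
    finally show "msubst (\<lambda>c. c) x (Poly_Mapping.map ?frob r) = msubst (\<lambda>c. c) x r" .
  qed
  hence "?frob (Poly_Mapping.lookup r e) = Poly_Mapping.lookup r e" for e
    using lookup_map_zero[of ?frob r e] q by simp
  hence "Poly_Mapping.lookup r e \<in> range to_ac" for e
    unfolding ext_field_1[symmetric] by (simp add: ext_field_def)
  hence "to_ac (of_ac (Poly_Mapping.lookup r e)) = Poly_Mapping.lookup r e" for e
    by (rule to_ac_of_ac)
  hence "msubst to_ac v (Poly_Mapping.map of_ac r) = g v" for v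
    unfolding r by (intro msubst_map) auto
  thus ?thesis using that by metis
qed

lemma keller_bijective_automorphism:
  fixes F :: "('a::finite_field, 'n::finite) pmap"
  assumes "keller F" "bijective_degrees F = {0<..}"
  shows "polynomial_automorphism F"
proof -
  let ?F = "pmap_eval F"
  have bij: "bij ?F" by (rule bij_pmap_eval[OF assms(2)])
  obtain c where c: "c \<noteq> 0" "det (jacobian F) = mconst c" using assms(1) by (auto simp: keller_def)
  define D where "D x = (\<chi> i j. msubst to_ac x (jacobian F $ i $ j))" for x
  have F: "(\<lambda>x. ?F x $ i) \<in> polyfuns coords" for i
    by (simp add: pmap_eval_def polyfun_msubst)
  have grad: "has_gradient (\<lambda>x. ?F x $ i) (\<lambda>x. D x $ i)" for i
    using has_gradient_msubst[OF hom_on_to_ac, of "F $ i"] by (simp add: pmap_eval_def D_def jacobian_def)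
  have "det (D x) = to_ac c" for x
    using hom_on_det[OF hom_on_msubst[OF hom_on_to_ac], of x "jacobian F"] c(2)
    by (simp add: D_def msubst_mconst)
  hence det: "det (D x) \<noteq> 0" for x using c(1) by simp
  have "\<forall>k. \<exists>p :: ('a, 'n) mpoly. \<forall>y. y $ k = msubst to_ac (?F y) p"
  proof
    fix k
    obtain g where g: "g \<in> polyfuns coords" "\<And>y. y $ k = g (?F y)"
      using bijective_etale_inverse[OF F grad det bij] by blast
    \<comment> \<open>Every v is a value of \<open>F\<close>, and \<open>g\<close> recovers
      coordinate k of the preimage; so \<open>g\<close> inherits the commutation with Frobenius from
      \<open>F\<close>.\<close>
    have "g (\<chi> i. (v $ i) ^ CARD('a)) = g v ^ CARD('a)" for v
    proof -
      obtain y where y: "v = ?F y" using bij by (metis bij_pointE)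
      have "(\<chi> i. (?F y $ i) ^ CARD('a)) = ?F (\<chi> i. (y $ i) ^ CARD('a))"
        using pmap_eval_frobenius[of F y 1] by (simp add: vec_eq_iff)
      hence "g (\<chi> i. (v $ i) ^ CARD('a)) = (\<chi> i. (y $ i) ^ CARD('a)) $ k"
        by (simp only: y g(2))
      thus ?thesis using g(2)[of y] by (simp add: y)
    qed
    from frobenius_equivariant_descends[OF g(1) this]
    obtain p :: "('a, 'n) mpoly" where "\<And>v. g v = msubst to_ac v p" by blast
    thus "\<exists>p :: ('a, 'n) mpoly. \<forall>y. y $ k = msubst to_ac (?F y) p" using g(2) by metis
  qed
  from choice[OF this] obtain p :: "'n \<Rightarrow> ('a, 'n) mpoly" where
    p: "\<And>k y. y $ k = msubst to_ac (?F y) (p k)" by blast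
  define G where "G = (\<chi> k. p k)"
  have GF: "pmap_eval G (?F y) = y" for y
    by (simp add: G_def pmap_eval_def[of "\<chi> k. p k"] vec_eq_iff flip: p)
  have FG: "?F (pmap_eval G v) = v" for v
    using GF bij by (metis bij_pointE)
  \<comment> \<open>Agreement of the evaluations over the infinite closure is agreement of formal
    tuples, which the notion of automorphism demands.\<close>
  have eqI: "H = pmap_id" if H: "\<And>x. pmap_eval H x = x" for H :: "('a, 'n) pmap"
  proof -
    have "H $ i = pmap_id $ i" for i
    proof (rule msubst_inject[OF hom_on_to_ac inj_to_ac])
      fix x :: "'a alg_closure ^ 'n"
      have "pmap_eval H x $ i = pmap_eval pmap_id x $ i" by (simp add: H pmap_eval_id)
      thus "msubst to_ac x (H $ i) = msubst to_ac x (pmap_id $ i)" by (simp add: pmap_eval_def)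
    qed
    thus ?thesis by (simp add: vec_eq_iff)
  qed
  have "pmap_comp F G = pmap_id" "pmap_comp G F = pmap_id"
    by (rule eqI, simp add: pmap_eval_comp FG GF)+
  thus ?thesis by (auto simp: polynomial_automorphism_def)
qed

theorem proposition8p2:
  fixes F :: "('a::finite_field, 'n::finite) pmap"
  shows "(cofinite_pos (bijective_degrees F) \<longrightarrow> bijective_degrees F = {0<..}) \<and>
         (keller F \<longrightarrow>
            (polynomial_automorphism F \<longleftrightarrow> bijective_degrees F = {0<..}) \<and>
            (bijective_degrees F = {0<..} \<longleftrightarrow> cofinite_pos (bijective_degrees F)))"
proof (intro conjI impI)
  show "bijective_degrees F = {0<..}" if "cofinite_pos (bijective_degrees F)"
    using that by (rule cofinite_bijective_degrees)
  show "polynomial_automorphism F \<longleftrightarrow> bijective_degrees F = {0<..}" if "keller F"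
    using that keller_bijective_automorphism polynomial_automorphism_bijective_degrees by blast
  show "bijective_degrees F = {0<..} \<longleftrightarrow> cofinite_pos (bijective_degrees F)"
    using cofinite_bijective_degrees by (auto simp: cofinite_pos_def)
qed

end
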